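(* Let $d\ge1$, $\phi\in\mathcal{S}(\mathbb{R}^{d+1})$ and $\chi\in C_0^\infty(\mathbb{R}^{d+1})$, and write $\phi_t=\phi(t,\cdot)$, $\chi_t=\chi(t,\cdot)$. Let $\alpha\in(0,\frac14]$, $\beta\ge0$ and $r\in[2,\infty)$ satisfy $$ \begin{cases} 2\alpha+\beta<\frac{d+1}{r}-\frac d2 & \text{if } r\in(2,\infty),\\[1mm] 2\alpha+\beta\le\frac12 & \text{if } r=2. \end{cases} $$ Then $$ \left\|(|x|^\alpha+1)\,\Lambda_{\alpha+\beta}\int_{\mathbb{R}}dt\,e^{-it\Delta}(\chi_t\phi_t)\right\|_{L^2(\mathbb{R}^d)}\le C_\chi\,\|\phi\|_{L^{r'}(\mathbb{R}^{d+1})}, $$ where $\frac1r+\frac1{r'}=1$ and the constant $C_\chi$ depends on $\chi$ (and on the parameters $d,\alpha,\beta,r$) but not on $\phi$.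
   Context: For $\gamma\in\mathbb{R}$, $\Lambda_\gamma=(\mathbb{I}-\Delta)^{\gamma/2}$ is the Fourier multiplier on $\mathbb{R}^d$ with symbol $(1+|\xi|^2)^{\gamma/2}$. $e^{-it\Delta}$ is the Schrödinger group on $\mathbb{R}^d$, acting in the $x$ variable. $|x|^\alpha+1$ denotes multiplication by that function. $\mathcal{S}(\mathbb{R}^{d+1})$ is the Schwartz space in $(t,x)\in\mathbb{R}\times\mathbb{R}^d$. *)

theory Defs
  imports "HOL-Analysis.Analysis"
begin

text \<open>The first element of the list is the outermost derivative. The values are meaningful
  only for functions satisfying the predicate \<open>smooth\<close> below.\<close>

primrec iter_partial ::
  "'a::euclidean_space list \<Rightarrow> ('a \<Rightarrow> 'b::real_normed_vector) \<Rightarrow> 'a \<Rightarrow> 'b" where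
  "iter_partial [] f = f"
| "iter_partial (b # bs) f = (\<lambda>x. frechet_derivative (iter_partial bs f) (at x) b)"

definition smooth :: "('a::euclidean_space \<Rightarrow> 'b::real_normed_vector) \<Rightarrow> bool" where
  "smooth f \<longleftrightarrow> (\<forall>bs. set bs \<subseteq> Basis \<longrightarrow> (\<forall>x. iter_partial bs f differentiable (at x)))"

definition schwartz :: "('a::euclidean_space \<Rightarrow> complex) \<Rightarrow> bool" where
  "schwartz f \<longleftrightarrow> smooth f \<and>
     (\<forall>bs k. set bs \<subseteq> Basis \<longrightarrow>
        (\<exists>B. \<forall>x. norm x ^ k * norm (iter_partial bs f x) \<le> B))"

definition test_function :: "('a::euclidean_space \<Rightarrow> complex) \<Rightarrow> bool" where
  "test_function f \<longleftrightarrow> smooth f \<and> compact (closure {x. f x \<noteq> 0})"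

text \<open>The \<open>L\<^sup>p\<close> norm for \<open>0 < p < \<infinity>\<close>, with values in \<open>[0, \<infinity>]\<close>, so that an upper bound by a
  finite number includes finiteness of the integral.\<close>

definition Lp_norm :: "real \<Rightarrow> ('a::euclidean_space \<Rightarrow> complex) \<Rightarrow> ennreal" where
  "Lp_norm p f =
     (let I = (\<integral>\<^sup>+ x. ennreal (norm (f x) powr p) \<partial>lborel)
      in if I = \<infinity> then \<infinity> else ennreal (enn2real I powr (1 / p)))"

text \<open>The normalisation of the Fourier transform is the one for which \<open>\<Delta>\<close> has symbol
  \<open>- |\<xi>|\<^sup>2\<close>. Both integrals are absolutely convergent for Schwartz functions.\<close>

definition fourier :: "('a::euclidean_space \<Rightarrow> complex) \<Rightarrow> 'a \<Rightarrow> complex" where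
  "fourier f \<xi> = (\<integral>x. exp (- \<i> * of_real (x \<bullet> \<xi>)) * f x \<partial>lborel)"

definition inverse_fourier :: "('a::euclidean_space \<Rightarrow> complex) \<Rightarrow> 'a \<Rightarrow> complex" where
  "inverse_fourier g x =
     of_real (1 / (2 * pi) ^ DIM('a)) * (\<integral>\<xi>. exp (\<i> * of_real (x \<bullet> \<xi>)) * g \<xi> \<partial>lborel)"

definition fourier_multiplier ::
  "('a::euclidean_space \<Rightarrow> complex) \<Rightarrow> ('a \<Rightarrow> complex) \<Rightarrow> 'a \<Rightarrow> complex" where
  "fourier_multiplier m f = inverse_fourier (\<lambda>\<xi>. m \<xi> * fourier f \<xi>)"

definition Lambda :: "real \<Rightarrow> ('a::euclidean_space \<Rightarrow> complex) \<Rightarrow> 'a \<Rightarrow> complex" where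
  "Lambda \<gamma> = fourier_multiplier (\<lambda>\<xi>. of_real ((1 + (norm \<xi>)\<^sup>2) powr (\<gamma> / 2)))"

text \<open>\<open>exp (- i t \<Delta>)\<close>: since \<open>\<Delta>\<close> has symbol \<open>- |\<xi>|\<^sup>2\<close>, the exponent is \<open>+ i t |\<xi>|\<^sup>2\<close>.\<close>

definition schroedinger :: "real \<Rightarrow> ('a::euclidean_space \<Rightarrow> complex) \<Rightarrow> 'a \<Rightarrow> complex" where
  "schroedinger t = fourier_multiplier (\<lambda>\<xi>. exp (\<i> * of_real (t * (norm \<xi>)\<^sup>2)))"

text \<open>\<open>\<integral> dt exp (- i t \<Delta>) F\<^sub>t\<close>, where \<open>F\<^sub>t = F(t, \<cdot>)\<close>; the integral in \<open>t\<close> is taken pointwise in \<open>x\<close>.\<close>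

definition schroedinger_integral ::
  "(real \<times> 'a::euclidean_space \<Rightarrow> complex) \<Rightarrow> 'a \<Rightarrow> complex" where
  "schroedinger_integral F x = (\<integral>t. schroedinger t (\<lambda>y. F (t, y)) x \<partial>lborel)"

end

theory Submission
  imports Defs "HOL-Probability.Characteristic_Functions" "HOL-Probability.Sinc_Integral"
begin

text \<open>On the Fourier side \<open>\<integral> dt exp (- i t \<Delta>) F\<^sub>t\<close> is the restriction \<open>A F\<close> of the space-time Fourier transform
  of \<open>F\<close> to the paraboloid \<open>\<tau> = - |\<xi>|\<^sup>2\<close>. Cutting a function at frequency \<open>R\<close> and integrating over
  \<open>R\<close> shows that \<open>|x|\<^sup>\<alpha>\<close> is controlled by \<open>\<langle>\<xi>\<rangle>\<^sup>\<alpha>\<close> and \<open>\<langle>\<xi>\<rangle>\<close> to the power \<open>\<alpha> - 1\<close> times the gradient in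
  \<open>\<xi>\<close>. Since \<open>t\<close> and \<open>x\<close> are bounded on the support of the cutoff, a \<open>\<xi>\<close>-derivative of \<open>A F\<close> costs only one
  factor \<open>\<langle>\<xi>\<rangle>\<close>. So it suffices to bound \<open>\<langle>\<xi>\<rangle>\<close> to the power \<open>2\<alpha> + \<beta>\<close> times \<open>A F\<close> in \<open>L\<^sup>2\<close>.

  For \<open>r = 2\<close> this is local smoothing by half a derivative: by Cauchy-Schwarz in the bounded variable \<open>x\<^sub>b\<close> one
  may freeze it, and then \<open>\<xi>\<^sub>b \<mapsto> - |\<xi>|\<^sup>2\<close> is a change of variables with Jacobian \<open>2 |\<xi>\<^sub>b|\<close>, so Plancherel
  in \<open>t\<close> and the remaining variables applies. For \<open>r > 2\<close> it is interpolated with the trivial bound of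
  \<open>A F\<close> by the \<open>L\<^sup>1\<close> norm on each dyadic shell in \<open>\<xi>\<close>, by splitting \<open>\<phi>\<close> at a height depending on the shell;
  the strict inequality makes the sum over the shells geometric.\<close>

section \<open>Gaussians, Plancherel and Fourier inversion\<close>

text \<open>The order 2\<alpha> + \<beta> has two sources: the symbol of \<open>Lambda\<close>
  contributes \<alpha> + \<beta> and the weight another \<alpha>. At r = 2 the hypothesis says that
  this is at most the half derivative gained by local smoothing. On the shell where the bracket of
  \<xi> is about \<rho>, the squared L^2 norm of A F is bounded by \<rho>^d times the squared L^1
  norm of F and by 1/\<rho> times its squared L^2 norm. Interpolation at r' gives the exponent d -
  2(d+1)/r; adding 2(2\<alpha> + \<beta>) for the weight, the hypothesis for r > 2 says exactly that
  the sum is negative.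

  Differentiating A F in \<xi> multiplies F by t or by a coordinate of x. These factors are moved
  into the cutoff, so the cutoff and its products with t and with the coordinates are all covered by
  one estimate.

  Only the upper half of Plancherel's theorem occurs, for integrable functions, so no L^2 theory of
  the transform is set up. Upper bounds are stated in [0, \<infinity>]; where a function is not
  known to be integrable, its transform has the default value 0 and the bound is trivial.\<close>

lemma
  fixes f :: "'a::euclidean_space \<Rightarrow> real \<Rightarrow> complex"
  assumes "\<And>b. b \<in> Basis \<Longrightarrow> integrable lborel (f b)"
  shows integrable_lborel_prod_Basis: "integrable lborel (\<lambda>x::'a. \<Prod>b\<in>Basis. f b (x \<bullet> b))"
    and integral_lborel_prod_Basis:
      "(\<integral>x. (\<Prod>b\<in>Basis. f b (x \<bullet> b)) \<partial>(lborel :: 'a measure)) = (\<Prod>b\<in>Basis. \<integral>x. f b x \<partial>lborel)"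
proof -
  interpret product_sigma_finite "\<lambda>b::'a. lborel :: real measure"
    by standard
  have [measurable]: "f b \<in> borel_measurable borel" if "b \<in> Basis" for b
    using borel_measurable_integrable[OF assms[OF that]] by simp
  have inn: "(\<Prod>b\<in>Basis. f b ((\<Sum>b\<in>Basis. z b *\<^sub>R b) \<bullet> b)) = (\<Prod>b\<in>Basis. f b (z b))" for z
    by (intro prod.cong) (auto simp: inner_sum_left inner_Basis if_distrib sum.delta cong: if_cong)
  show "integrable lborel (\<lambda>x::'a. \<Prod>b\<in>Basis. f b (x \<bullet> b))"
    by (subst lborel_eq, subst integrable_distr_eq) (auto simp: inn intro!: product_integrable_prod assms)
  show "(\<integral>x. (\<Prod>b\<in>Basis. f b (x \<bullet> b)) \<partial>(lborel :: 'a measure)) = (\<Prod>b\<in>Basis. \<integral>x. f b x \<partial>lborel)"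
    by (subst lborel_eq, subst integral_distr)
       (auto simp: inn product_integral_prod assms)
qed

text \<open>The parameter is the reciprocal of the width: as \<open>e\<close> tends to 0 the
  function increases to the constant 1, while its Fourier transform, a multiple of
  \<open>gauss (1 / e)\<close>, concentrates at the origin.\<close>

definition gauss :: "real \<Rightarrow> 'a::euclidean_space \<Rightarrow> real" where
  "gauss e x = exp (- (e * norm x)\<^sup>2 / 2)"

lemma gauss_measurable [measurable]: "gauss e \<in> borel_measurable borel"
  unfolding gauss_def[abs_def] by measurable

lemma gauss_real: "gauss e (x::real) = exp (- (e * x)\<^sup>2 / 2)"
  by (simp add: gauss_def power_mult_distrib)

text \<open>The characteristic function of the standard normal law is the case \<open>e = 1\<close>;
  rescaling by \<open>e\<close> gives the rest.\<close>

lemma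
  assumes e: "e > 0"
  shows integrable_gauss_real: "integrable lborel (\<lambda>x::real. cis (t * x) * of_real (gauss e x))"
    and fourier_gauss_real:
      "(\<integral>x. cis (t * x) * of_real (gauss e x) \<partial>lborel) = of_real (sqrt (2 * pi) / e * gauss (1 / e) t)"
proof -
  have dens: "std_normal_density x = gauss 1 x / sqrt (2 * pi)" for x
    by (simp add: normal_density_def gauss_real)
  have i1: "integrable lborel (\<lambda>x::real. cis (s * x) * of_real (gauss 1 x))" for s
  proof (rule Bochner_Integration.integrable_bound)
    show "integrable lborel (\<lambda>x. sqrt (2 * pi) * std_normal_density x)"
      by (intro integrable_mult_right) simp
    show "(\<lambda>x. cis (s * x) * of_real (gauss 1 x)) \<in> borel_measurable lborel"
      unfolding cis_conv_exp by measurable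
    show "AE x in lborel. norm (cis (s * x) * of_real (gauss 1 x)) \<le> norm (sqrt (2 * pi) * std_normal_density x)"
      by (simp add: dens norm_mult gauss_def)
  qed
  have c1: "(\<integral>x. cis (s * x) * of_real (gauss 1 x) \<partial>lborel) = of_real (sqrt (2 * pi) * gauss 1 s)" for s
  proof -
    have "of_real (gauss 1 s) = char std_normal_distribution s"
      by (simp add: char_std_normal_distribution gauss_real)
    also have "\<dots> = (\<integral>x. std_normal_density x *\<^sub>R cis (s * x) \<partial>lborel)"
      unfolding char_def by (subst integral_density) (auto simp: cis_conv_exp)
    also have "\<dots> = (\<integral>x. of_real (1 / sqrt (2 * pi)) * (cis (s * x) * of_real (gauss 1 x)) \<partial>lborel)"
      by (intro Bochner_Integration.integral_cong) (auto simp: dens scaleR_conv_of_real)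
    also have "\<dots> = of_real (1 / sqrt (2 * pi)) * (\<integral>x. cis (s * x) * of_real (gauss 1 x) \<partial>lborel)"
      by (rule integral_mult_right_zero)
    finally show ?thesis by (simp add: field_simps)
  qed
  have sc: "cis (t * (0 + (1 / e) * x)) * of_real (gauss e (0 + (1 / e) * x)) = cis (t / e * x) * of_real (gauss 1 x)" for x :: real
    using e by (simp add: gauss_real)
  show "integrable lborel (\<lambda>x::real. cis (t * x) * of_real (gauss e x))"
    using i1[of "t / e"] lborel_integrable_real_affine_iff[of "1 / e" "\<lambda>x::real. cis (t * x) * of_real (gauss e x)" 0] e
    unfolding sc by simp
  show "(\<integral>x. cis (t * x) * of_real (gauss e x) \<partial>lborel) = of_real (sqrt (2 * pi) / e * gauss (1 / e) t)"
    using lborel_integral_real_affine[of "1 / e" "\<lambda>x::real. cis (t * x) * of_real (gauss e x)" 0] e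
    unfolding sc c1 by (simp add: scaleR_conv_of_real gauss_real)
qed

lemma gauss_prod: "gauss e (x::'a::euclidean_space) = (\<Prod>b\<in>Basis. gauss e (x \<bullet> b))"
proof -
  have "(e * norm x)\<^sup>2 = (\<Sum>b\<in>Basis. (e * (x \<bullet> b))\<^sup>2)"
    by (simp add: power_mult_distrib power2_norm_eq_inner euclidean_inner[of x x] sum_distrib_left) (simp add: power2_eq_square)
  then show ?thesis
    by (simp add: gauss_def exp_sum[symmetric] sum_divide_distrib sum_negf power_mult_distrib)
qed

lemma cis_sum: "finite A \<Longrightarrow> cis (\<Sum>a\<in>A. f a) = (\<Prod>a\<in>A. cis (f a))"
  by (induction A rule: finite_induct) (auto simp: cis_mult[symmetric])

text \<open>A character and a Gaussian are both products over the coordinates, so the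
  one-dimensional integrals multiply.\<close>

lemma
  fixes \<xi> :: "'a::euclidean_space"
  assumes e: "e > 0"
  shows integrable_cis_gauss: "integrable lborel (\<lambda>x. cis (x \<bullet> \<xi>) * of_real (gauss e x))"
    and fourier_gauss: "(\<integral>x. cis (x \<bullet> \<xi>) * of_real (gauss e x) \<partial>lborel) =
      of_real ((sqrt (2 * pi) / e) ^ DIM('a) * gauss (1 / e) \<xi>)"
proof -
  have *: "cis (x \<bullet> \<xi>) * of_real (gauss e x) =
    (\<Prod>b\<in>Basis. cis ((\<xi> \<bullet> b) * (x \<bullet> b)) * of_real (gauss e (x \<bullet> b)))" for x :: 'a
    by (subst gauss_prod, subst euclidean_inner) (simp add: cis_sum prod.distrib mult.commute)
  show "integrable lborel (\<lambda>x. cis (x \<bullet> \<xi>) * of_real (gauss e x))"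
    unfolding * by (rule integrable_lborel_prod_Basis) (rule integrable_gauss_real[OF e])
  show "(\<integral>x. cis (x \<bullet> \<xi>) * of_real (gauss e x) \<partial>lborel) =
      of_real ((sqrt (2 * pi) / e) ^ DIM('a) * gauss (1 / e) \<xi>)"
    unfolding *
    by (subst integral_lborel_prod_Basis[OF integrable_gauss_real[OF e]])
       (simp_all add: fourier_gauss_real[OF e] prod.distrib gauss_prod[of _ \<xi>] prod_dividef power_divide)
qed

lemma
  assumes e: "e > 0"
  shows integrable_gauss: "integrable lborel (gauss e :: 'a::euclidean_space \<Rightarrow> real)"
    and integral_gauss: "(\<integral>x. gauss e (x::'a) \<partial>lborel) = (sqrt (2 * pi) / e) ^ DIM('a)"
proof -
  have "integrable lborel (\<lambda>x::'a. Re (of_real (gauss e x)))"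
    using integrable_Re[OF integrable_cis_gauss[OF e, of 0]] by simp
  then show i: "integrable lborel (gauss e :: 'a \<Rightarrow> real)" by simp
  have "complex_of_real (\<integral>x. gauss e (x::'a) \<partial>lborel) = of_real ((sqrt (2 * pi) / e) ^ DIM('a))"
    using fourier_gauss[OF e, of "0::'a"] by (simp add: gauss_def)
  then show "(\<integral>x. gauss e (x::'a) \<partial>lborel) = (sqrt (2 * pi) / e) ^ DIM('a)"
    by (simp only: of_real_eq_iff)
qed

text \<open>No integrability is assumed: when it fails, the Bochner integral is 0 by convention.
  This keeps later bounds in \<open>ennreal\<close> free of side conditions.\<close>

lemma ennreal_norm_integral_le:
  fixes f :: "'a \<Rightarrow> 'b::{banach, second_countable_topology}"
  shows "ennreal (norm (integral\<^sup>L M f)) \<le> (\<integral>\<^sup>+x. ennreal (norm (f x)) \<partial>M)"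
  by (cases "integrable M f") (auto simp: not_integrable_integral_eq intro: integral_norm_bound_ennreal)

text \<open>A majorant of product form is integrable on the product space by Tonelli. This supplies
  the hypothesis of Fubini's theorem when Bochner integrals are exchanged below.\<close>

lemma integrable_lborel_pair_bound:
  fixes f :: "'a::euclidean_space \<times> 'b::euclidean_space \<Rightarrow> 'c::{banach, second_countable_topology}"
    and a :: "'a \<Rightarrow> real" and b :: "'b \<Rightarrow> real"
  assumes a: "integrable lborel a" and b: "integrable lborel b"
    and f: "f \<in> borel_measurable (lborel \<Otimes>\<^sub>M lborel)"
    and le: "\<And>x y. norm (f (x, y)) \<le> a x * b y"
  shows "integrable (lborel \<Otimes>\<^sub>M lborel) f"
proof -
  have [measurable]: "a \<in> borel_measurable borel" "b \<in> borel_measurable borel"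
    using a b by auto
  have "integrable (lborel \<Otimes>\<^sub>M lborel) (\<lambda>z. a (fst z) * b (snd z))"
  proof (subst integrable_iff_bounded, intro conjI)
    have "(\<integral>\<^sup>+ z. ennreal (norm (a (fst z) * b (snd z))) \<partial>(lborel \<Otimes>\<^sub>M lborel)) =
        (\<integral>\<^sup>+ x. \<integral>\<^sup>+ y. ennreal (norm (a x)) * ennreal (norm (b y)) \<partial>lborel \<partial>lborel)"
      by (subst lborel.nn_integral_fst[symmetric]) (auto simp: abs_mult ennreal_mult)
    also have "\<dots> = (\<integral>\<^sup>+ x. ennreal (norm (a x)) \<partial>lborel) * (\<integral>\<^sup>+ y. ennreal (norm (b y)) \<partial>lborel)"
      by (simp add: nn_integral_cmult nn_integral_multc)
    also have "\<dots> < \<infinity>"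
      using a b by (simp add: integrable_iff_bounded ennreal_mult_less_top)
    finally show "(\<integral>\<^sup>+ z. ennreal (norm (a (fst z) * b (snd z))) \<partial>(lborel \<Otimes>\<^sub>M lborel)) < \<infinity>" .
  qed measurable
  then show ?thesis
  proof (rule Bochner_Integration.integrable_bound)
    show "f \<in> borel_measurable (lborel \<Otimes>\<^sub>M lborel)"
      by (rule f)
    show "AE z in lborel \<Otimes>\<^sub>M lborel. norm (f z) \<le> norm (a (fst z) * b (snd z))"
    proof (rule AE_I2)
      fix z :: "'a \<times> 'b"
      show "norm (f z) \<le> norm (a (fst z) * b (snd z))"
        using order_trans[OF le[of "fst z" "snd z"] abs_ge_self] by simp
    qed
  qed
qed

lemma nn_integral_lborel_translate:
  fixes c :: "'a::euclidean_space" and f :: "'a \<Rightarrow> ennreal"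
  assumes [measurable]: "f \<in> borel_measurable borel"
  shows "(\<integral>\<^sup>+x. f (c + x) \<partial>lborel) = (\<integral>\<^sup>+x. f x \<partial>lborel)"
  by (subst (2) lborel_distr_plus[of c, symmetric]) (simp add: nn_integral_distr)

lemma
  fixes t :: "'a::euclidean_space" and f :: "'a \<Rightarrow> 'b::{banach, second_countable_topology}"
  assumes c: "c > 0" and f: "integrable lborel f"
  shows integrable_lborel_affine: "integrable lborel (\<lambda>x. f (t + c *\<^sub>R x))"
    and integral_lborel_affine: "(\<integral>x. f x \<partial>lborel) = c ^ DIM('a) *\<^sub>R (\<integral>x. f (t + c *\<^sub>R x) \<partial>lborel)"
proof -
  have [measurable]: "f \<in> borel_measurable borel" using f by simp
  have c0: "c \<noteq> 0" "0 \<le> c" using c by auto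
  from f have "integrable (density (distr lborel borel (\<lambda>x. t + c *\<^sub>R x)) (\<lambda>_. ennreal (\<bar>c\<bar> ^ DIM('a)))) f"
    using lborel_affine[OF c0(1), of t] by simp
  then have "integrable lborel (\<lambda>x. c ^ DIM('a) *\<^sub>R f (t + c *\<^sub>R x))"
    by (subst (asm) integrable_density) (auto simp: integrable_distr_eq c0)
  then show i: "integrable lborel (\<lambda>x. f (t + c *\<^sub>R x))"
    using integrable_scaleR_right[of "inverse (c ^ DIM('a))" lborel "\<lambda>x. c ^ DIM('a) *\<^sub>R f (t + c *\<^sub>R x)"] c0 by simp
  have "(\<integral>x. f x \<partial>lborel) = (\<integral>x. f x \<partial>density (distr lborel borel (\<lambda>x. t + c *\<^sub>R x)) (\<lambda>_. ennreal (\<bar>c\<bar> ^ DIM('a))))"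
    using lborel_affine[OF c0(1), of t] by simp
  also have "\<dots> = c ^ DIM('a) *\<^sub>R (\<integral>x. f (t + c *\<^sub>R x) \<partial>lborel)"
    by (subst integral_density) (auto simp: integral_distr c0)
  finally show "(\<integral>x. f x \<partial>lborel) = c ^ DIM('a) *\<^sub>R (\<integral>x. f (t + c *\<^sub>R x) \<partial>lborel)" .
qed

lemma gauss_minus: "gauss e (x - y) = gauss e (y - x)"
  by (simp add: gauss_def norm_minus_commute)

lemma gauss_nonneg [simp]: "0 \<le> gauss e x"
  by (simp add: gauss_def)

lemma gauss_le_one: "gauss e x \<le> 1"
  by (simp add: gauss_def)

lemma cis_measurable [measurable]: "cis \<in> borel_measurable borel"
  by (simp add: cis_conv_exp[abs_def])

lemma gauss_tendsto_one: "(\<lambda>n. gauss (1 / real (Suc n)) x) \<longlonglongrightarrow> 1"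
proof -
  have "(\<lambda>n. 1 / real (Suc n)) \<longlonglongrightarrow> 0"
    by (rule LIMSEQ_Suc[OF lim_1_over_n])
  then have "(\<lambda>n. gauss (1 / real (Suc n)) x) \<longlonglongrightarrow> exp (- (0 * norm x)\<^sup>2 / 2)"
    unfolding gauss_def by (intro tendsto_intros) auto
  then show ?thesis by simp
qed

lemma cnj_measurable [measurable]: "cnj \<in> borel_measurable borel"
  by (intro borel_measurable_continuous_onI continuous_intros)

lemma
  fixes h :: "'a::euclidean_space \<Rightarrow> complex"
  assumes h: "integrable lborel h"
  shows norm_integral_cis_le: "norm (\<integral>\<xi>. cis (x \<bullet> \<xi>) * h \<xi> \<partial>lborel) \<le> (\<integral>\<xi>. norm (h \<xi>) \<partial>lborel)"
    and integrable_cis_mult: "integrable lborel (\<lambda>\<xi>. cis (x \<bullet> \<xi>) * h \<xi>)"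
    and measurable_integral_cis: "(\<lambda>x. \<integral>\<xi>. cis (x \<bullet> \<xi>) * h \<xi> \<partial>lborel) \<in> borel_measurable borel"
proof -
  have [measurable]: "h \<in> borel_measurable borel" using h by simp
  show "norm (\<integral>\<xi>. cis (x \<bullet> \<xi>) * h \<xi> \<partial>lborel) \<le> (\<integral>\<xi>. norm (h \<xi>) \<partial>lborel)"
    by (rule order_trans[OF integral_norm_bound]) (simp add: norm_mult)
  show "integrable lborel (\<lambda>\<xi>. cis (x \<bullet> \<xi>) * h \<xi>)"
    by (rule Bochner_Integration.integrable_bound[OF h]) (auto simp: norm_mult)
  have "(\<lambda>x. \<integral>\<xi>. cis (x \<bullet> \<xi>) * h \<xi> \<partial>lborel) \<in> borel_measurable lborel"
    by (rule lborel.borel_measurable_lebesgue_integral) (simp add: split_beta')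
  then show "(\<lambda>x. \<integral>\<xi>. cis (x \<bullet> \<xi>) * h \<xi> \<partial>lborel) \<in> borel_measurable borel"
    by simp
qed

text \<open>A character has norm 1, so multiplying by its inverse recovers \<open>h\<close> and
  integrability transfers back. The transform of a non-integrable function is thus identically 0,
  and upper bounds for it are trivial.\<close>

lemma integral_cis_mult_eq_0:
  fixes h :: "'a::euclidean_space \<Rightarrow> complex"
  assumes "\<not> integrable lborel h"
  shows "(\<integral>\<xi>. cis (x \<bullet> \<xi>) * h \<xi> \<partial>lborel) = 0"
proof (rule not_integrable_integral_eq, rule notI)
  assume i: "integrable lborel (\<lambda>\<xi>. cis (x \<bullet> \<xi>) * h \<xi>)"
  have "integrable lborel h"
    using integrable_cis_mult[OF i, of "- x"] by (simp add: mult.assoc[symmetric] cis_mult)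
  with assms show False ..
qed

section \<open>The Plancherel inequality by Gaussian regularisation\<close>

text \<open>Fubini moves the transform from \<open>h\<close> to the Gaussian, whose transform is
  explicit. What remains is \<open>h\<close> tested against a bump of width \<open>e\<close> around
  -\<zeta>. Both the Plancherel inequality and Fourier inversion start from this identity.\<close>

lemma gauss_pairing:
  fixes h k :: "'a::euclidean_space \<Rightarrow> complex"
  assumes e: "e > 0" and h: "integrable lborel h"
  shows "(\<integral>x. of_real (gauss e x) * cis (x \<bullet> \<zeta>) * (\<integral>\<xi>. cis (x \<bullet> \<xi>) * h \<xi> \<partial>lborel) \<partial>lborel) =
    (\<integral>\<xi>. h \<xi> * of_real ((sqrt (2 * pi) / e) ^ DIM('a) * gauss (1 / e) (\<zeta> + \<xi>)) \<partial>lborel)"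
proof -
  have [measurable]: "h \<in> borel_measurable borel" using h by simp
  let ?f = "\<lambda>x \<xi>. of_real (gauss e x) * cis (x \<bullet> \<zeta>) * (cis (x \<bullet> \<xi>) * h \<xi>)"
  have i: "integrable (lborel \<Otimes>\<^sub>M lborel) (case_prod ?f)"
    by (rule integrable_lborel_pair_bound[OF integrable_gauss[OF e] integrable_norm[OF h]])
       (measurable, simp add: norm_mult)
  have "(\<integral>x. of_real (gauss e x) * cis (x \<bullet> \<zeta>) * (\<integral>\<xi>. cis (x \<bullet> \<xi>) * h \<xi> \<partial>lborel) \<partial>lborel) =
      (\<integral>x. \<integral>\<xi>. ?f x \<xi> \<partial>lborel \<partial>lborel)"
    by simp
  also have "\<dots> = (\<integral>\<xi>. \<integral>x. ?f x \<xi> \<partial>lborel \<partial>lborel)"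
    by (rule lborel_pair.Fubini_integral[OF i, symmetric])
  also have "\<dots> = (\<integral>\<xi>. h \<xi> * (\<integral>x. cis (x \<bullet> (\<zeta> + \<xi>)) * of_real (gauss e x) \<partial>lborel) \<partial>lborel)"
    unfolding integral_mult_right_zero[symmetric]
    by (intro Bochner_Integration.integral_cong refl) (simp add: inner_add_right cis_mult[symmetric] mult_ac)
  also have "\<dots> = (\<integral>\<xi>. h \<xi> * of_real ((sqrt (2 * pi) / e) ^ DIM('a) * gauss (1 / e) (\<zeta> + \<xi>)) \<partial>lborel)"
    by (subst fourier_gauss[OF e]) simp
  finally show ?thesis .
qed

text \<open>The mass does not depend on \<open>e\<close>, because the dilation factors of the kernel
  and of its integral cancel. It is the row sum in the Schur test that follows.\<close>

lemma nn_integral_gauss_kernel: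
  fixes y :: "'a::euclidean_space"
  assumes e: "e > 0"
  shows "(\<integral>\<^sup>+x. ennreal ((sqrt (2 * pi) / e) ^ DIM('a) * gauss (1 / e) (x - y)) \<partial>lborel) = ennreal ((2 * pi) ^ DIM('a))"
proof -
  have "(\<integral>\<^sup>+x. ennreal ((sqrt (2 * pi) / e) ^ DIM('a) * gauss (1 / e) (x - y)) \<partial>lborel) =
      (\<integral>\<^sup>+x. ennreal ((sqrt (2 * pi) / e) ^ DIM('a) * gauss (1 / e) (x::'a)) \<partial>lborel)"
    using nn_integral_lborel_translate[of "\<lambda>x::'a. ennreal ((sqrt (2 * pi) / e) ^ DIM('a) * gauss (1 / e) x)" "- y"]
    by (simp add: algebra_simps)
  also have "\<dots> = ennreal ((sqrt (2 * pi) / e) ^ DIM('a) * (\<integral>x. gauss (1 / e) (x::'a) \<partial>lborel))"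
    using e by (subst nn_integral_eq_integral) (auto intro!: integrable_gauss integrable_mult_right)
  also have "\<dots> = ennreal ((sqrt (2 * pi) / e * (sqrt (2 * pi) / (1 / e))) ^ DIM('a))"
    using e by (simp only: integral_gauss zero_less_divide_1_iff power_mult_distrib)
  also have "sqrt (2 * pi) / e * (sqrt (2 * pi) / (1 / e)) = 2 * pi"
    using e by simp
  finally show ?thesis .
qed

text \<open>Writing one factor of the squared norm as an integral turns the left side into a
  quadratic form in \<open>h\<close> with kernel \<open>G\<close>. All row and column integrals of
  \<open>G\<close> are equal, so the Schur test bounds the form. The Gaussian weight makes Fubini
  legitimate, since the transform of \<open>h\<close> is only known to be bounded.\<close>

lemma plancherel_gauss_le:
  fixes h :: "'a::euclidean_space \<Rightarrow> complex"
  assumes e: "e > 0" and h: "integrable lborel h"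
  shows "(\<integral>\<^sup>+x. ennreal (gauss e x * (norm (\<integral>\<xi>. cis (x \<bullet> \<xi>) * h \<xi> \<partial>lborel))\<^sup>2) \<partial>lborel)
    \<le> ennreal ((2 * pi) ^ DIM('a)) * (\<integral>\<^sup>+\<xi>. ennreal ((norm (h \<xi>))\<^sup>2) \<partial>lborel)"
proof -
  have [measurable]: "h \<in> borel_measurable borel" using h by simp
  define H where "H x = (\<integral>\<xi>. cis (x \<bullet> \<xi>) * h \<xi> \<partial>lborel)" for x
  define M where "M = (\<integral>\<xi>. norm (h \<xi>) \<partial>lborel)"
  define G where "G x = (sqrt (2 * pi) / e) ^ DIM('a) * gauss (1 / e) x" for x :: 'a
  have G_nonneg: "0 \<le> G x" for x using e by (simp add: G_def)
  have ker: "(\<integral>\<^sup>+x. ennreal (G (x - y)) \<partial>lborel) = ennreal ((2 * pi) ^ DIM('a))" for y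
    unfolding G_def by (rule nn_integral_gauss_kernel[OF e])
  have [measurable]: "G \<in> borel_measurable borel" unfolding G_def[abs_def] by measurable
  have HM: "norm (H x) \<le> M" for x unfolding H_def M_def by (rule norm_integral_cis_le[OF h])
  have [measurable]: "H \<in> borel_measurable borel"
    unfolding H_def[abs_def] by (rule measurable_integral_cis[OF h])
  let ?f = "\<lambda>x \<xi>. of_real (gauss e x) * cnj (H x) * (cis (x \<bullet> \<xi>) * h \<xi>)"
  have i: "integrable (lborel \<Otimes>\<^sub>M lborel) (case_prod ?f)"
  proof (rule integrable_lborel_pair_bound)
    show "integrable lborel (\<lambda>x::'a. M * gauss e x)"
      by (intro integrable_mult_right integrable_gauss e)
    show "integrable lborel (\<lambda>\<xi>. norm (h \<xi>))" using h by simp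
    show "norm (case (x, y) of (x, y) \<Rightarrow> ?f x y) \<le> M * gauss e x * norm (h y)" for x y
      using mult_right_mono[OF mult_right_mono[OF HM[of x] gauss_nonneg[of e x]] norm_ge_zero[of "h y"]]
      by (simp add: norm_mult mult_ac)
  qed measurable
  \<comment> \<open>For fixed \<xi> the integral over \<open>x\<close> is the conjugate of a
    Gaussian pairing at -\<xi>, which leaves the kernel \<open>G (\<eta> - \<xi>)\<close>.\<close>
  have inner: "(\<integral>x. of_real (gauss e x) * cnj (H x) * cis (x \<bullet> \<xi>) \<partial>lborel) =
      (\<integral>\<eta>. cnj (h \<eta>) * of_real (G (\<eta> - \<xi>)) \<partial>lborel)" for \<xi>
  proof -
    have "(\<integral>x. of_real (gauss e x) * cnj (H x) * cis (x \<bullet> \<xi>) \<partial>lborel) =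
        cnj (\<integral>x. of_real (gauss e x) * cis (x \<bullet> (- \<xi>)) * H x \<partial>lborel)"
      by (simp flip: Bochner_Integration.integral_cnj add: cis_cnj mult_ac)
    also have "(\<integral>x. of_real (gauss e x) * cis (x \<bullet> (- \<xi>)) * H x \<partial>lborel) = (\<integral>\<eta>. h \<eta> * of_real (G (- \<xi> + \<eta>)) \<partial>lborel)"
      unfolding H_def G_def by (rule gauss_pairing[OF e h])
    also have "cnj \<dots> = (\<integral>\<eta>. cnj (h \<eta>) * of_real (G (\<eta> - \<xi>)) \<partial>lborel)"
      by (simp flip: Bochner_Integration.integral_cnj)
    finally show ?thesis .
  qed
  have "integrable lborel (\<lambda>x. gauss e x * (norm (H x))\<^sup>2)"
  proof (rule Bochner_Integration.integrable_bound)
    show "integrable lborel (\<lambda>x::'a. gauss e x * M\<^sup>2)"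
      by (intro integrable_mult_left integrable_gauss e)
    show "AE x in lborel. norm (gauss e x * (norm (H x))\<^sup>2) \<le> norm (gauss e x * M\<^sup>2)"
      using HM by (auto intro!: AE_I2 mult_left_mono power_mono)
  qed measurable
  then have "(\<integral>\<^sup>+x. ennreal (gauss e x * (norm (H x))\<^sup>2) \<partial>lborel) =
      ennreal (\<integral>x. gauss e x * (norm (H x))\<^sup>2 \<partial>lborel)"
    by (subst nn_integral_eq_integral) auto
  also have "\<dots> \<le> ennreal (norm (complex_of_real (\<integral>x. gauss e x * (norm (H x))\<^sup>2 \<partial>lborel)))"
    by (intro ennreal_leI) simp
  also have "complex_of_real (\<integral>x. gauss e x * (norm (H x))\<^sup>2 \<partial>lborel) =
      (\<integral>x. of_real (gauss e x) * cnj (H x) * H x \<partial>lborel)"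
    by (subst integral_complex_of_real[symmetric])
       (auto simp: complex_norm_square mult_ac simp del: of_real_power intro!: Bochner_Integration.integral_cong)
  also have "\<dots> = (\<integral>x. \<integral>\<xi>. ?f x \<xi> \<partial>lborel \<partial>lborel)"
    by (simp add: H_def)
  also have "\<dots> = (\<integral>\<xi>. \<integral>x. ?f x \<xi> \<partial>lborel \<partial>lborel)"
    by (rule lborel_pair.Fubini_integral[OF i, symmetric])
  also have "\<dots> = (\<integral>\<xi>. h \<xi> * (\<integral>\<eta>. cnj (h \<eta>) * of_real (G (\<eta> - \<xi>)) \<partial>lborel) \<partial>lborel)"
    unfolding inner[symmetric]
    by (subst integral_mult_right_zero[symmetric]) (simp add: mult_ac)
  also have "ennreal (norm \<dots>) \<le> (\<integral>\<^sup>+\<xi>. ennreal (norm (h \<xi> * (\<integral>\<eta>. cnj (h \<eta>) * of_real (G (\<eta> - \<xi>)) \<partial>lborel))) \<partial>lborel)"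
    by (rule ennreal_norm_integral_le)
  also have "\<dots> \<le> (\<integral>\<^sup>+\<xi>. \<integral>\<^sup>+\<eta>. ennreal (norm (h \<xi>) * norm (h \<eta>) * G (\<eta> - \<xi>)) \<partial>lborel \<partial>lborel)"
  proof (rule nn_integral_mono)
    fix \<xi>
    have "ennreal (norm (h \<xi> * (\<integral>\<eta>. cnj (h \<eta>) * of_real (G (\<eta> - \<xi>)) \<partial>lborel))) \<le>
        ennreal (norm (h \<xi>)) * (\<integral>\<^sup>+\<eta>. ennreal (norm (cnj (h \<eta>) * of_real (G (\<eta> - \<xi>)))) \<partial>lborel)"
      by (subst norm_mult, subst ennreal_mult) (auto intro!: mult_left_mono ennreal_norm_integral_le)
    also have "\<dots> = (\<integral>\<^sup>+\<eta>. ennreal (norm (h \<xi>) * norm (h \<eta>) * G (\<eta> - \<xi>)) \<partial>lborel)"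
      by (subst nn_integral_cmult[symmetric]) (auto simp: norm_mult ennreal_mult mult.assoc G_nonneg)
    finally show "ennreal (norm (h \<xi> * (\<integral>\<eta>. cnj (h \<eta>) * of_real (G (\<eta> - \<xi>)) \<partial>lborel)))
      \<le> (\<integral>\<^sup>+\<eta>. ennreal (norm (h \<xi>) * norm (h \<eta>) * G (\<eta> - \<xi>)) \<partial>lborel)" .
  qed
  \<comment> \<open>The inequality between the geometric and the arithmetic mean separates the
    variables: in each half one of them occurs only in \<open>G\<close> and can be integrated
    out.\<close>
  also have "\<dots> \<le> (\<integral>\<^sup>+\<xi>. \<integral>\<^sup>+\<eta>. ennreal (1/2) * (ennreal ((norm (h \<xi>))\<^sup>2) * ennreal (G (\<eta> - \<xi>))) +
      ennreal (1/2) * (ennreal ((norm (h \<eta>))\<^sup>2) * ennreal (G (\<eta> - \<xi>))) \<partial>lborel \<partial>lborel)"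
  proof (intro nn_integral_mono)
    fix \<xi> \<eta>
    have "norm (h \<xi>) * norm (h \<eta>) * G (\<eta> - \<xi>) \<le> ((norm (h \<xi>))\<^sup>2 + (norm (h \<eta>))\<^sup>2) / 2 * G (\<eta> - \<xi>)"
      using sum_squares_bound[of "norm (h \<xi>)" "norm (h \<eta>)"] by (intro mult_right_mono G_nonneg) simp
    also have "\<dots> = 1/2 * ((norm (h \<xi>))\<^sup>2 * G (\<eta> - \<xi>)) + 1/2 * ((norm (h \<eta>))\<^sup>2 * G (\<eta> - \<xi>))"
      by (simp add: field_simps)
    finally have "ennreal (norm (h \<xi>) * norm (h \<eta>) * G (\<eta> - \<xi>)) \<le>
       ennreal (1/2 * ((norm (h \<xi>))\<^sup>2 * G (\<eta> - \<xi>)) + 1/2 * ((norm (h \<eta>))\<^sup>2 * G (\<eta> - \<xi>)))"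
      by (rule ennreal_leI)
    also have "\<dots> = ennreal (1/2) * (ennreal ((norm (h \<xi>))\<^sup>2) * ennreal (G (\<eta> - \<xi>))) +
       ennreal (1/2) * (ennreal ((norm (h \<eta>))\<^sup>2) * ennreal (G (\<eta> - \<xi>)))"
      by (simp only: ennreal_plus ennreal_mult G_nonneg zero_le_power2 mult_nonneg_nonneg zero_le_divide_1_iff zero_le_numeral)
    finally show "ennreal (norm (h \<xi>) * norm (h \<eta>) * G (\<eta> - \<xi>)) \<le>
       ennreal (1/2) * (ennreal ((norm (h \<xi>))\<^sup>2) * ennreal (G (\<eta> - \<xi>))) +
       ennreal (1/2) * (ennreal ((norm (h \<eta>))\<^sup>2) * ennreal (G (\<eta> - \<xi>)))" .
  qed
  also have "\<dots> = ennreal (1/2) * (\<integral>\<^sup>+\<xi>. ennreal ((norm (h \<xi>))\<^sup>2) * (\<integral>\<^sup>+\<eta>. ennreal (G (\<eta> - \<xi>)) \<partial>lborel) \<partial>lborel) +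
      ennreal (1/2) * (\<integral>\<^sup>+\<xi>. \<integral>\<^sup>+\<eta>. ennreal ((norm (h \<eta>))\<^sup>2) * ennreal (G (\<eta> - \<xi>)) \<partial>lborel \<partial>lborel)"
    by (simp add: nn_integral_add nn_integral_cmult)
  also have "(\<integral>\<^sup>+\<xi>. \<integral>\<^sup>+\<eta>. ennreal ((norm (h \<eta>))\<^sup>2) * ennreal (G (\<eta> - \<xi>)) \<partial>lborel \<partial>lborel) =
      (\<integral>\<^sup>+\<eta>. \<integral>\<^sup>+\<xi>. ennreal ((norm (h \<eta>))\<^sup>2) * ennreal (G (\<eta> - \<xi>)) \<partial>lborel \<partial>lborel)"
    by (rule lborel_pair.Fubini') measurable
  also have "\<dots> = (\<integral>\<^sup>+\<eta>. ennreal ((norm (h \<eta>))\<^sup>2) * (\<integral>\<^sup>+\<xi>. ennreal (G (\<xi> - \<eta>)) \<partial>lborel) \<partial>lborel)"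
    unfolding G_def by (subst gauss_minus) (simp add: nn_integral_cmult)
  also have "ennreal (1/2) * (\<integral>\<^sup>+\<xi>. ennreal ((norm (h \<xi>))\<^sup>2) * (\<integral>\<^sup>+\<eta>. ennreal (G (\<eta> - \<xi>)) \<partial>lborel) \<partial>lborel) +
      ennreal (1/2) * (\<integral>\<^sup>+\<eta>. ennreal ((norm (h \<eta>))\<^sup>2) * (\<integral>\<^sup>+\<xi>. ennreal (G (\<xi> - \<eta>)) \<partial>lborel) \<partial>lborel) =
      ennreal (1 / 2) * (\<integral>\<^sup>+ \<xi>. ennreal ((norm (h \<xi>))\<^sup>2) * ennreal ((2 * pi) ^ DIM('a)) \<partial>lborel) +
      ennreal (1 / 2) * (\<integral>\<^sup>+ \<eta>. ennreal ((norm (h \<eta>))\<^sup>2) * ennreal ((2 * pi) ^ DIM('a)) \<partial>lborel)"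
    by (simp only: ker)
  also have "\<dots> =
      (ennreal (1/2) + ennreal (1/2)) * (ennreal ((2 * pi) ^ DIM('a)) * (\<integral>\<^sup>+\<xi>. ennreal ((norm (h \<xi>))\<^sup>2) \<partial>lborel))"
    by (simp add: nn_integral_multc distrib_right distrib_left mult_ac del: ennreal_half)
  also have "ennreal (1/2) + ennreal (1/2) = 1"
    by (subst ennreal_plus[symmetric]) auto
  finally show ?thesis by (simp add: H_def)
qed

text \<open>Fatou's lemma in the form in which a uniform bound survives a pointwise limit. It
  removes the Gaussian weight here and exhausts a half-line later.\<close>

lemma nn_integral_limit_le:
  assumes "\<And>n. f n \<in> borel_measurable M" "\<And>x. (\<lambda>n. f n x) \<longlonglongrightarrow> g x" "\<And>n. (\<integral>\<^sup>+x. f n x \<partial>M) \<le> C"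
  shows "(\<integral>\<^sup>+x. g x \<partial>M) \<le> C"
proof -
  have "(\<integral>\<^sup>+x. g x \<partial>M) = (\<integral>\<^sup>+x. liminf (\<lambda>n. f n x) \<partial>M)"
    by (intro nn_integral_cong lim_imp_Liminf[symmetric] assms(2)) simp
  also have "\<dots> \<le> liminf (\<lambda>n. \<integral>\<^sup>+x. f n x \<partial>M)"
    by (rule nn_integral_liminf) (rule assms(1))
  also have "\<dots> \<le> liminf (\<lambda>n::nat. C)"
    by (intro Liminf_mono always_eventually allI assms(3))
  finally show ?thesis by (simp add: Liminf_const)
qed

lemma plancherel_le:
  fixes h :: "'a::euclidean_space \<Rightarrow> complex"
  assumes h: "integrable lborel h"
  shows "(\<integral>\<^sup>+x. ennreal ((norm (\<integral>\<xi>. cis (x \<bullet> \<xi>) * h \<xi> \<partial>lborel))\<^sup>2) \<partial>lborel)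
    \<le> ennreal ((2 * pi) ^ DIM('a)) * (\<integral>\<^sup>+\<xi>. ennreal ((norm (h \<xi>))\<^sup>2) \<partial>lborel)"
proof -
  define H where "H x = (\<integral>\<xi>. cis (x \<bullet> \<xi>) * h \<xi> \<partial>lborel)" for x
  have [measurable]: "H \<in> borel_measurable borel"
    unfolding H_def[abs_def] by (rule measurable_integral_cis[OF h])
  let ?u = "\<lambda>n x. ennreal (gauss (1 / real (Suc n)) x * (norm (H x))\<^sup>2)"
  have "(\<integral>\<^sup>+x. ennreal ((norm (H x))\<^sup>2) \<partial>lborel) \<le> ennreal ((2 * pi) ^ DIM('a)) * (\<integral>\<^sup>+\<xi>. ennreal ((norm (h \<xi>))\<^sup>2) \<partial>lborel)"
  proof (rule nn_integral_limit_le)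
    show "?u n \<in> borel_measurable lborel" for n by measurable
    show "(\<lambda>n. ?u n x) \<longlonglongrightarrow> ennreal ((norm (H x))\<^sup>2)" for x
      using tendsto_ennrealI[OF tendsto_mult_right[OF gauss_tendsto_one[of x], of "(norm (H x))\<^sup>2"]] by simp
    show "(\<integral>\<^sup>+x. ?u n x \<partial>lborel) \<le> ennreal ((2 * pi) ^ DIM('a)) * (\<integral>\<^sup>+\<xi>. ennreal ((norm (h \<xi>))\<^sup>2) \<partial>lborel)" for n
      unfolding H_def by (rule plancherel_gauss_le[OF _ h]) simp
  qed
  then show ?thesis by (simp add: H_def)
qed

text \<open>A Gaussian factor turns the left side into averages of \<open>u\<close> around \<xi>.
  After rescaling, the averaging density is fixed and only the point at which \<open>u\<close> is
  evaluated moves, so continuity and boundedness of \<open>u\<close> give the limit by dominated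
  convergence. On the other side the integrable transform itself is the majorant.\<close>

lemma fourier_inversion:
  fixes u :: "'a::euclidean_space \<Rightarrow> complex"
  assumes u: "integrable lborel u" and cont: "continuous_on UNIV u"
    and v: "integrable lborel (\<lambda>x. \<integral>\<eta>. cis (x \<bullet> \<eta>) * u \<eta> \<partial>lborel)"
    and bdd: "\<And>x. norm (u x) \<le> B"
  shows "(\<integral>x. cis (- (x \<bullet> \<xi>)) * (\<integral>\<eta>. cis (x \<bullet> \<eta>) * u \<eta> \<partial>lborel) \<partial>lborel) = of_real ((2 * pi) ^ DIM('a)) * u \<xi>"
proof -
  have [measurable]: "u \<in> borel_measurable borel" using u by simp
  define V where "V x = (\<integral>\<eta>. cis (x \<bullet> \<eta>) * u \<eta> \<partial>lborel)" for x
  have V: "integrable lborel V" unfolding V_def[abs_def] by (rule v)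
  then have [measurable]: "V \<in> borel_measurable borel" by simp
  let ?e = "\<lambda>n. 1 / real (Suc n)"
  let ?I = "\<lambda>n. \<integral>x. of_real (gauss (?e n) x) * cis (x \<bullet> (- \<xi>)) * V x \<partial>lborel"
  have "?I \<longlonglongrightarrow> (\<integral>x. cis (- (x \<bullet> \<xi>)) * V x \<partial>lborel)"
  proof (rule integral_dominated_convergence)
    show "integrable lborel (\<lambda>x. norm (V x))" using V by simp
    show "AE x in lborel. (\<lambda>n. of_real (gauss (?e n) x) * cis (x \<bullet> (- \<xi>)) * V x) \<longlonglongrightarrow> cis (- (x \<bullet> \<xi>)) * V x"
    proof (rule AE_I2)
      fix x
      have "(\<lambda>n. of_real (gauss (?e n) x) * cis (x \<bullet> (- \<xi>)) * V x) \<longlonglongrightarrow> of_real 1 * cis (x \<bullet> (- \<xi>)) * V x"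
        by (intro tendsto_intros gauss_tendsto_one)
      then show "(\<lambda>n. of_real (gauss (?e n) x) * cis (x \<bullet> (- \<xi>)) * V x) \<longlonglongrightarrow> cis (- (x \<bullet> \<xi>)) * V x"
        by simp
    qed
    show "AE x in lborel. norm (of_real (gauss (?e n) x) * cis (x \<bullet> (- \<xi>)) * V x) \<le> norm (V x)" for n
      by (auto simp: norm_mult gauss_le_one intro!: AE_I2 mult_left_le_one_le)
  qed measurable
  moreover have "?I n = (\<integral>y. u (\<xi> + ?e n *\<^sub>R y) * of_real (sqrt (2 * pi) ^ DIM('a) * gauss 1 y) \<partial>lborel)" for n
  proof -
    define f where "f \<eta> = u \<eta> * of_real ((sqrt (2 * pi) / ?e n) ^ DIM('a) * gauss (1 / ?e n) (- \<xi> + \<eta>))" for \<eta>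
    have f: "integrable lborel f"
    proof (rule Bochner_Integration.integrable_bound)
      show "integrable lborel (\<lambda>\<eta>. (sqrt (2 * pi) / ?e n) ^ DIM('a) * norm (u \<eta>))" using u by simp
      show "AE \<eta> in lborel. norm (f \<eta>) \<le> norm ((sqrt (2 * pi) / ?e n) ^ DIM('a) * norm (u \<eta>))"
        unfolding f_def norm_mult norm_of_real abs_mult
        by (auto intro!: AE_I2 mult_left_le simp: gauss_le_one mult.commute[of "norm (u _)"] mult.assoc mult_left_mono mult_left_le_one_le)
    qed (simp add: f_def[abs_def])
    have "?I n = (\<integral>\<eta>. f \<eta> \<partial>lborel)"
      unfolding V_def f_def by (rule gauss_pairing[OF _ u]) simp
    also have "\<dots> = ?e n ^ DIM('a) *\<^sub>R (\<integral>y. f (\<xi> + ?e n *\<^sub>R y) \<partial>lborel)"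
      by (rule integral_lborel_affine[OF _ f]) simp
    also have "\<dots> = (\<integral>y. ?e n ^ DIM('a) *\<^sub>R f (\<xi> + ?e n *\<^sub>R y) \<partial>lborel)"
      by (rule integral_scaleR_right[symmetric])
    also have "\<dots> = (\<integral>y. u (\<xi> + ?e n *\<^sub>R y) * of_real (sqrt (2 * pi) ^ DIM('a) * gauss 1 y) \<partial>lborel)"
    proof (rule Bochner_Integration.integral_cong[OF refl])
      fix y :: 'a
      have "gauss (1 / ?e n) (?e n *\<^sub>R y) = gauss 1 y" by (simp add: gauss_def)
      moreover have "?e n ^ DIM('a) * (sqrt (2 * pi) / ?e n) ^ DIM('a) = sqrt (2 * pi) ^ DIM('a)"
        by (subst power_mult_distrib[symmetric]) simp
      ultimately show "?e n ^ DIM('a) *\<^sub>R f (\<xi> + ?e n *\<^sub>R y) = u (\<xi> + ?e n *\<^sub>R y) * of_real (sqrt (2 * pi) ^ DIM('a) * gauss 1 y)"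
        by (simp add: f_def scaleR_conv_of_real del: of_real_power of_real_divide flip: of_real_mult mult.assoc)
    qed
    finally show ?thesis .
  qed
  moreover have "(\<lambda>n. \<integral>y. u (\<xi> + ?e n *\<^sub>R y) * of_real (sqrt (2 * pi) ^ DIM('a) * gauss 1 y) \<partial>lborel)
      \<longlonglongrightarrow> (\<integral>y. u \<xi> * of_real (sqrt (2 * pi) ^ DIM('a) * gauss 1 y) \<partial>(lborel :: 'a measure))"
  proof (rule integral_dominated_convergence)
    show "integrable lborel (\<lambda>y::'a. B * (sqrt (2 * pi) ^ DIM('a) * gauss 1 y))"
      by (intro integrable_mult_right integrable_gauss) simp
    show "AE y in lborel. (\<lambda>n. u (\<xi> + ?e n *\<^sub>R y) * of_real (sqrt (2 * pi) ^ DIM('a) * gauss 1 y))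
        \<longlonglongrightarrow> u \<xi> * of_real (sqrt (2 * pi) ^ DIM('a) * gauss 1 y)"
    proof (intro AE_I2 tendsto_mult tendsto_const)
      fix y :: 'a
      have "(\<lambda>n. \<xi> + ?e n *\<^sub>R y) \<longlonglongrightarrow> \<xi> + 0 *\<^sub>R y"
        by (intro tendsto_intros LIMSEQ_Suc[OF lim_1_over_n])
      then show "(\<lambda>n. u (\<xi> + ?e n *\<^sub>R y)) \<longlonglongrightarrow> u \<xi>"
        using continuous_on_tendsto_compose[OF cont] by simp
    qed
    show "AE y in lborel. norm (u (\<xi> + ?e n *\<^sub>R y) * of_real (sqrt (2 * pi) ^ DIM('a) * gauss 1 y))
        \<le> B * (sqrt (2 * pi) ^ DIM('a) * gauss 1 y)" for n
      unfolding norm_mult norm_of_real by (auto intro!: AE_I2 mult_right_mono bdd simp: abs_mult power_abs)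
  qed measurable
  moreover have "(\<integral>y. u \<xi> * of_real (sqrt (2 * pi) ^ DIM('a) * gauss 1 y) \<partial>(lborel :: 'a measure)) = of_real ((2 * pi) ^ DIM('a)) * u \<xi>"
  proof -
    have "(\<integral>y. u \<xi> * of_real (sqrt (2 * pi) ^ DIM('a) * gauss 1 y) \<partial>(lborel :: 'a measure)) =
        u \<xi> * of_real (sqrt (2 * pi) ^ DIM('a) * (\<integral>y. gauss 1 y \<partial>(lborel :: 'a measure)))"
      by (simp only: integral_mult_right_zero integral_complex_of_real)
    also have "sqrt (2 * pi) ^ DIM('a) * (\<integral>y. gauss 1 y \<partial>(lborel :: 'a measure)) = (2 * pi) ^ DIM('a)"
      by (simp only: integral_gauss[OF zero_less_one] div_by_1 power_mult_distrib[symmetric]) simp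
    finally show ?thesis by (simp add: mult.commute)
  qed
  ultimately show ?thesis
    using LIMSEQ_unique unfolding V_def by (metis (no_types, lifting) ext)
qed

section \<open>Line derivatives\<close>

text \<open>Only derivatives along single directions occur. A function given by an integral can then
  be differentiated under the integral sign along a line, without a discussion of total
  differentiability.\<close>

definition has_line_derivative ::
  "('a::euclidean_space \<Rightarrow> 'b::real_normed_vector) \<Rightarrow> 'a \<Rightarrow> ('a \<Rightarrow> 'b) \<Rightarrow> bool" where
  "has_line_derivative f b f' \<longleftrightarrow> (\<forall>x. ((\<lambda>s. f (x + s *\<^sub>R b)) has_vector_derivative f' x) (at 0))"

lemma has_line_derivativeI:
  "(\<And>x. ((\<lambda>s. f (x + s *\<^sub>R b)) has_vector_derivative f' x) (at 0)) \<Longrightarrow> has_line_derivative f b f'"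
  by (simp add: has_line_derivative_def)

lemma has_line_derivativeD:
  assumes "has_line_derivative f b f'"
  shows "((\<lambda>s. f (x + s *\<^sub>R b)) has_vector_derivative f' (x + s *\<^sub>R b)) (at s)"
proof -
  have "((\<lambda>u. f ((x + s *\<^sub>R b) + u *\<^sub>R b)) has_vector_derivative f' (x + s *\<^sub>R b)) (at (s - s))"
    using assms by (simp add: has_line_derivative_def)
  then have "((\<lambda>u. f ((x + s *\<^sub>R b) + (u - s) *\<^sub>R b)) has_vector_derivative (1 *\<^sub>R f' (x + s *\<^sub>R b))) (at s)"
    by (intro vector_diff_chain_at[where f = "\<lambda>u. u - s", unfolded o_def]) (auto intro!: derivative_eq_intros)
  then show ?thesis by (simp add: scaleR_diff_left)
qed

lemma has_line_derivative_mult: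
  fixes f g :: "'a::euclidean_space \<Rightarrow> 'b::real_normed_algebra"
  assumes "has_line_derivative f b f'" "has_line_derivative g b g'"
  shows "has_line_derivative (\<lambda>x. f x * g x) b (\<lambda>x. f x * g' x + f' x * g x)"
proof (rule has_line_derivativeI)
  fix x
  show "((\<lambda>s. f (x + s *\<^sub>R b) * g (x + s *\<^sub>R b)) has_vector_derivative f x * g' x + f' x * g x) (at 0)"
    using has_vector_derivative_mult[OF has_line_derivativeD[OF assms(1), of x 0] has_line_derivativeD[OF assms(2), of x 0]]
    by simp
qed

lemma has_line_derivative_of_real:
  assumes "has_line_derivative f b f'"
  shows "has_line_derivative (\<lambda>x. of_real (f x) :: complex) b (\<lambda>x. of_real (f' x))"
proof (rule has_line_derivativeI)
  fix x
  show "((\<lambda>s. of_real (f (x + s *\<^sub>R b)) :: complex) has_vector_derivative of_real (f' x)) (at 0)"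
    using bounded_linear.has_vector_derivative[OF bounded_linear_of_real has_line_derivativeD[OF assms, of x 0]]
    by simp
qed

lemma has_line_derivative_cis: "has_line_derivative (\<lambda>\<xi>. cis (x \<bullet> \<xi>)) b (\<lambda>\<xi>. \<i> * of_real (x \<bullet> b) * cis (x \<bullet> \<xi>))"
proof (rule has_line_derivativeI)
  fix \<xi>
  have "((\<lambda>s. cis (x \<bullet> (\<xi> + s *\<^sub>R b))) has_derivative (\<lambda>s. (s * (x \<bullet> b)) *\<^sub>R (\<i> * cis (x \<bullet> (\<xi> + 0 *\<^sub>R b))))) (at 0)"
    by (auto intro!: derivative_eq_intros simp: inner_add_right)
  then show "((\<lambda>s. cis (x \<bullet> (\<xi> + s *\<^sub>R b))) has_vector_derivative \<i> * of_real (x \<bullet> b) * cis (x \<bullet> \<xi>)) (at 0)"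
    unfolding has_vector_derivative_def by (simp add: scaleR_conv_of_real mult_ac)
qed

text \<open>Mean value inequality on the line through \<open>x\<close>. It dominates difference
  quotients when a limit is taken under an integral.\<close>

lemma has_line_derivative_lipschitz:
  assumes "has_line_derivative f b f'" and bdd: "\<And>x. norm (f' x) \<le> B"
  shows "norm (f (x + s *\<^sub>R b) - f x) \<le> B * \<bar>s\<bar>"
proof -
  have "norm ((\<lambda>s. f (x + s *\<^sub>R b)) s - (\<lambda>s. f (x + s *\<^sub>R b)) 0) \<le> B * norm (s - 0)"
  proof (rule differentiable_bound[of UNIV _ "\<lambda>s h. h *\<^sub>R f' (x + s *\<^sub>R b)"])
    show "((\<lambda>s. f (x + s *\<^sub>R b)) has_derivative (\<lambda>h. h *\<^sub>R f' (x + s *\<^sub>R b))) (at s)" for s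
      using has_line_derivativeD[OF assms(1), of x s] by (simp add: has_vector_derivative_def)
    show "onorm (\<lambda>h. h *\<^sub>R f' (x + s *\<^sub>R b)) \<le> B" for s
      by (rule onorm_le) (use bdd[of "x + s *\<^sub>R b"] in \<open>simp add: mult.commute[of B] mult_left_mono\<close>)
  qed auto
  then show ?thesis by simp
qed

lemma has_vector_derivative_at_quotient:
  "(f has_vector_derivative D) (at a) \<longleftrightarrow> ((\<lambda>s. (f s - f a) /\<^sub>R (s - a)) \<longlongrightarrow> D) (at a)"
proof -
  have "norm ((f s - f a - (s - a) *\<^sub>R D) /\<^sub>R norm (s - a)) = norm ((f s - f a) /\<^sub>R (s - a) - D)" if "s \<noteq> a" for s
  proof -
    have "(f s - f a) /\<^sub>R (s - a) - D = (f s - f a - (s - a) *\<^sub>R D) /\<^sub>R (s - a)"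
      using that by (simp add: scaleR_diff_right)
    then show ?thesis by simp
  qed
  then have "\<forall>\<^sub>F s in at a. norm ((f s - f a - (s - a) *\<^sub>R D) /\<^sub>R norm (s - a)) = norm ((f s - f a) /\<^sub>R (s - a) - D)"
    by (auto simp: eventually_at intro: exI[of _ 1])
  then have "((\<lambda>s. norm ((f s - f a - (s - a) *\<^sub>R D) /\<^sub>R norm (s - a))) \<longlongrightarrow> 0) (at a) \<longleftrightarrow>
      ((\<lambda>s. norm ((f s - f a) /\<^sub>R (s - a) - D)) \<longlongrightarrow> 0) (at a)"
    by (rule tendsto_cong)
  also have "\<dots> \<longleftrightarrow> ((\<lambda>s. (f s - f a) /\<^sub>R (s - a)) \<longlongrightarrow> D) (at a)"
    by (simp only: tendsto_norm_zero_iff LIM_zero_iff)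
  finally have eq: "((\<lambda>s. norm ((f s - f a - (s - a) *\<^sub>R D) /\<^sub>R norm (s - a))) \<longlongrightarrow> 0) (at a) \<longleftrightarrow>
      ((\<lambda>s. (f s - f a) /\<^sub>R (s - a)) \<longlongrightarrow> D) (at a)" .
  show ?thesis
    unfolding eq[symmetric] tendsto_norm_zero_iff has_vector_derivative_def has_derivative_def
    by (simp add: bounded_linear_scaleR_left)
qed

lemma difference_quotient_tendsto:
  assumes "has_line_derivative f b f'"
  shows "(\<lambda>n. real (Suc n) *\<^sub>R (f (x + (1 / real (Suc n)) *\<^sub>R b) - f x)) \<longlonglongrightarrow> f' x"
proof -
  have "((\<lambda>s. f (x + s *\<^sub>R b)) has_vector_derivative f' x) (at 0)"
    using has_line_derivativeD[OF assms, of x 0] by simp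
  then have "((\<lambda>s. (f (x + s *\<^sub>R b) - f x) /\<^sub>R s) \<longlongrightarrow> f' x) (at 0)"
    unfolding has_vector_derivative_at_quotient by simp
  moreover have "filterlim (\<lambda>n. 1 / real (Suc n)) (at 0) sequentially"
    by (auto simp: filterlim_at simp del: of_nat_Suc intro!: LIMSEQ_Suc[OF lim_1_over_n])
  ultimately have "(\<lambda>n. (f (x + (1 / real (Suc n)) *\<^sub>R b) - f x) /\<^sub>R (1 / real (Suc n))) \<longlonglongrightarrow> f' x"
    by (rule filterlim_compose)
  then show ?thesis by simp
qed

section \<open>Integration by parts for Fourier integrals\<close>

text \<open>Each difference quotient has integral 0 by translation invariance. The quotients are
  bounded by \<open>B\<close> and, since the steps \<open>1 / real (Suc n)\<close> are at most 1,
  vanish outside the ball of radius \<open>R + norm b\<close>. Dominated convergence gives the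
  claim.\<close>

lemma integral_line_derivative_eq_0:
  fixes f f' :: "'a::euclidean_space \<Rightarrow> complex"
  assumes der: "has_line_derivative f b f'"
    and f: "integrable lborel f" and f' [measurable]: "f' \<in> borel_measurable borel"
    and bdd: "\<And>x. norm (f' x) \<le> B"
    and supp: "\<And>x. R < norm x \<Longrightarrow> f x = 0"
  shows "(\<integral>x. f' x \<partial>lborel) = 0"
proof -
  have [measurable]: "f \<in> borel_measurable borel" using f by simp
  let ?q = "\<lambda>n x. real (Suc n) *\<^sub>R (f (x + (1 / real (Suc n)) *\<^sub>R b) - f x)"
  have "(\<lambda>n. \<integral>x. ?q n x \<partial>lborel) \<longlonglongrightarrow> (\<integral>x. f' x \<partial>lborel)"
  proof (rule integral_dominated_convergence)
    show "integrable lborel (\<lambda>x::'a. B * indicator (cball 0 (R + norm b)) x :: real)"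
      by (intro integrable_mult_right integrable_real_indicator emeasure_bounded_finite bounded_cball) auto
    show "AE x in lborel. (\<lambda>n. ?q n x) \<longlonglongrightarrow> f' x"
      by (intro AE_I2 difference_quotient_tendsto der)
    show "AE x in lborel. norm (?q n x) \<le> B * indicator (cball 0 (R + norm b)) x" for n
    proof (rule AE_I2)
      fix x
      have "norm (?q n x) \<le> real (Suc n) * (B * \<bar>1 / real (Suc n)\<bar>)"
        unfolding norm_scaleR using has_line_derivative_lipschitz[OF der bdd, of x "1 / real (Suc n)"]
        by (intro mult_mono) auto
      then have *: "norm (?q n x) \<le> B" by simp
      show "norm (?q n x) \<le> B * indicator (cball 0 (R + norm b)) x"
      proof (cases "x \<in> cball 0 (R + norm b)")
        case True
        then show ?thesis using * by simp
      next
        case False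
        then have x: "R + norm b < norm x" by simp
        have "norm ((1 / real (Suc n)) *\<^sub>R b) \<le> norm b"
          by (simp add: divide_le_eq mult_le_cancel_left1)
        moreover have "norm x \<le> norm (x + (1 / real (Suc n)) *\<^sub>R b) + norm ((1 / real (Suc n)) *\<^sub>R b)"
          by (metis add_diff_cancel_right' norm_triangle_ineq4)
        ultimately have "R < norm (x + (1 / real (Suc n)) *\<^sub>R b)" using x by linarith
        moreover have "R < norm x" using x by (smt (verit) norm_ge_zero)
        ultimately show ?thesis using False by (simp add: supp)
      qed
    qed
  qed measurable
  moreover have "(\<integral>x. ?q n x \<partial>lborel) = 0" for n
  proof -
    have c: "f (x + (1 / real (Suc n)) *\<^sub>R b) = f ((1 / real (Suc n)) *\<^sub>R b + 1 *\<^sub>R x)" for x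
      by (simp add: add.commute)
    have i: "integrable lborel (\<lambda>x. f (x + (1 / real (Suc n)) *\<^sub>R b))"
      unfolding c by (rule integrable_lborel_affine[OF _ f]) simp
    have "(\<integral>x. f (x + (1 / real (Suc n)) *\<^sub>R b) \<partial>lborel) = (\<integral>x. f x \<partial>lborel)"
      unfolding c using integral_lborel_affine[OF zero_less_one f, of "(1 / real (Suc n)) *\<^sub>R b"] by simp
    then show ?thesis
      using i f by simp
  qed
  ultimately show ?thesis
    using LIMSEQ_unique tendsto_const by (metis (no_types, lifting) ext)
qed

lemma integrable_bounded_support:
  fixes F :: "'a::euclidean_space \<Rightarrow> complex"
  assumes "F \<in> borel_measurable borel" "\<And>z. norm (F z) \<le> C" "\<And>z. L < norm z \<Longrightarrow> F z = 0"
  shows "integrable lborel F"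
proof (rule Bochner_Integration.integrable_bound)
  show "integrable lborel (\<lambda>x::'a. C * indicator (cball 0 L) x :: real)"
    by (intro integrable_mult_right integrable_real_indicator emeasure_bounded_finite bounded_cball) auto
  show "AE x in lborel. norm (F x) \<le> norm (C * indicator (cball 0 L) x :: real)"
    using order_trans[OF assms(2) abs_ge_self] assms(3) by (intro AE_I2) (auto simp: indicator_def)
qed (use assms(1) in simp)

lemma bounded_on_cball:
  fixes f :: "'a::euclidean_space \<Rightarrow> complex"
  assumes "continuous_on UNIV f"
  obtains B where "0 \<le> B" "\<And>z. norm z \<le> L \<Longrightarrow> norm (f z) \<le> B"
proof -
  have "bounded (f ` cball 0 L)"
    by (intro compact_imp_bounded compact_continuous_image continuous_on_subset[OF assms]) auto
  then obtain B where "\<forall>z\<in>cball 0 L. norm (f z) \<le> B" unfolding bounded_iff by auto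
  then have "norm z \<le> L \<Longrightarrow> norm (f z) \<le> B" for z by simp
  then show ?thesis by (intro that[of "max 0 B"]) (auto simp: le_max_iff_disj)
qed

text \<open>Integration by parts: the derivative of the character times \<open>f\<close> has
  integral 0. The support condition is why this is applied to a function only after its high
  frequencies have been cut off.\<close>

lemma mult_fourier_line_derivative:
  fixes f f' :: "'a::euclidean_space \<Rightarrow> complex"
  assumes der: "has_line_derivative f b f'"
    and f [measurable]: "f \<in> borel_measurable borel" and f' [measurable]: "f' \<in> borel_measurable borel"
    and bdd: "\<And>x. norm (f x) \<le> B" and bdd': "\<And>x. norm (f' x) \<le> B'"
    and supp: "\<And>x. R < norm x \<Longrightarrow> f x = 0" and supp': "\<And>x. R < norm x \<Longrightarrow> f' x = 0"
  shows "of_real (x \<bullet> b) * (\<integral>\<xi>. cis (x \<bullet> \<xi>) * f \<xi> \<partial>lborel) = \<i> * (\<integral>\<xi>. cis (x \<bullet> \<xi>) * f' \<xi> \<partial>lborel)"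
proof -
  have i: "integrable lborel f" and i': "integrable lborel f'"
    by (rule integrable_bounded_support[OF f bdd supp] integrable_bounded_support[OF f' bdd' supp'], assumption)+
  have "(\<integral>\<xi>. cis (x \<bullet> \<xi>) * f' \<xi> + \<i> * of_real (x \<bullet> b) * cis (x \<bullet> \<xi>) * f \<xi> \<partial>lborel) = 0"
  proof (rule integral_line_derivative_eq_0[OF has_line_derivative_mult[OF has_line_derivative_cis der]])
    show "integrable lborel (\<lambda>\<xi>. cis (x \<bullet> \<xi>) * f \<xi>)" by (rule integrable_cis_mult[OF i])
    show "norm (cis (x \<bullet> \<xi>) * f' \<xi> + \<i> * of_real (x \<bullet> b) * cis (x \<bullet> \<xi>) * f \<xi>) \<le> B' + \<bar>x \<bullet> b\<bar> * B" for \<xi>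
      by (rule order_trans[OF norm_triangle_ineq]) (auto simp: norm_mult intro!: add_mono bdd' mult_left_mono bdd)
    show "R < norm \<xi> \<Longrightarrow> cis (x \<bullet> \<xi>) * f \<xi> = 0" for \<xi> by (simp add: supp)
  qed measurable
  also have "(\<integral>\<xi>. cis (x \<bullet> \<xi>) * f' \<xi> + \<i> * of_real (x \<bullet> b) * cis (x \<bullet> \<xi>) * f \<xi> \<partial>lborel) =
      (\<integral>\<xi>. cis (x \<bullet> \<xi>) * f' \<xi> \<partial>lborel) + \<i> * of_real (x \<bullet> b) * (\<integral>\<xi>. cis (x \<bullet> \<xi>) * f \<xi> \<partial>lborel)"
    using integrable_cis_mult[OF i, of x] integrable_cis_mult[OF i', of x]
    by (simp add: mult.assoc)
  finally have "\<i> * (\<integral>\<xi>. cis (x \<bullet> \<xi>) * f' \<xi> \<partial>lborel) + \<i> * (\<i> * of_real (x \<bullet> b) * (\<integral>\<xi>. cis (x \<bullet> \<xi>) * f \<xi> \<partial>lborel)) = 0"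
    by (metis distrib_left mult_zero_right)
  then show ?thesis by (simp add: mult.assoc[symmetric])
qed

section \<open>One-dimensional integrals and derivatives for the radial variable\<close>

lemma nn_integral_powr_Icc:
  fixes a y :: real
  assumes "1 \<le> y" "0 < a"
  shows "(\<integral>\<^sup>+R. ennreal (R powr (a - 1)) * indicator {1..y} R \<partial>lborel) \<le> ennreal (y powr a / a)"
proof -
  have "(\<integral>\<^sup>+R. ennreal (R powr (a - 1)) * indicator {1..y} R \<partial>lborel) = ennreal (y powr a / a - 1 powr a / a)"
    using assms
    by (intro nn_integral_FTC_Icc) (auto intro!: derivative_eq_intros)
  also have "\<dots> \<le> ennreal (y powr a / a)"
    using assms by (intro ennreal_leI) auto
  finally show ?thesis .
qed

lemma nn_integral_powr_atLeast:
  fixes c y :: real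
  assumes "0 < y" "0 < c"
  shows "(\<integral>\<^sup>+R. ennreal (R powr (- c - 1)) * indicator {y..} R \<partial>lborel) = ennreal (y powr (- c) / c)"
proof -
  have "((\<lambda>R. - (R powr (- c) / c)) \<longlongrightarrow> - (0 / c)) at_top"
    using assms by (intro tendsto_intros tendsto_neg_powr filterlim_ident) auto
  then have "(\<integral>\<^sup>+R. ennreal (R powr (- c - 1)) * indicator {y..} R \<partial>lborel) = ennreal (- (0 / c) - - (y powr (- c) / c))"
    using assms by (intro nn_integral_FTC_atLeast) (auto intro!: derivative_eq_intros)
  then show ?thesis by simp
qed

text \<open>The square flattens the kink of the positive part: at 0 the difference quotient is at
  most |y|.\<close>

lemma has_real_derivative_pos_part_square:
  "((\<lambda>s::real. (max 0 s)\<^sup>2) has_real_derivative 2 * max 0 s) (at s)"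
proof (cases "s = 0")
  case False
  then consider "s < 0" | "0 < s" by linarith
  then show ?thesis
  proof cases
    case 1
    show ?thesis
      by (rule has_field_derivative_transform_within_open[of "\<lambda>_. 0" _ _ "{..<0}"]) (use 1 in auto)
  next
    case 2
    show ?thesis
      by (rule has_field_derivative_transform_within_open[of "\<lambda>s. s\<^sup>2" _ _ "{0<..}"])
         (use 2 in \<open>auto intro!: derivative_eq_intros\<close>)
  qed
next
  case True
  have "((\<lambda>y::real. (max 0 y)\<^sup>2 / y) \<longlongrightarrow> 0) (at 0)"
  proof (rule Lim_null_comparison)
    show "\<forall>\<^sub>F y in at 0. norm ((max 0 y)\<^sup>2 / y) \<le> \<bar>y\<bar>" for y :: real
      by (intro always_eventually) (auto simp: max_def power2_eq_square)
    show "((\<lambda>y::real. \<bar>y\<bar>) \<longlongrightarrow> 0) (at 0)"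
      by (rule tendsto_eq_intros | simp)+
  qed
  then show ?thesis using True by (simp add: has_field_derivative_iff)
qed

section \<open>The weight \<open>|x|\<^sup>\<alpha>\<close> on the Fourier side\<close>

text \<open>The square of the usual bracket of \<xi>, kept without a root because it is quadratic
  along lines. The power \<open>bracket_sq \<xi> powr s\<close> is the bracket to the power
  \<open>2 * s\<close>, which suits squared norms.\<close>

definition bracket_sq :: "'a::euclidean_space \<Rightarrow> real" where
  "bracket_sq \<xi> = 1 + (norm \<xi>)\<^sup>2"

lemma bracket_sq_ge_one [simp]: "1 \<le> bracket_sq \<xi>"
  by (simp add: bracket_sq_def)

lemma bracket_sq_pos [simp]: "0 < bracket_sq \<xi>"
  using bracket_sq_ge_one[of \<xi>] by linarith

lemma bracket_sq_measurable [measurable]: "bracket_sq \<in> borel_measurable borel"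
  unfolding bracket_sq_def[abs_def] by measurable

lemma continuous_on_bracket_sq [continuous_intros]:
  "continuous_on A f \<Longrightarrow> continuous_on A (\<lambda>x. bracket_sq (f x))"
  unfolding bracket_sq_def by (intro continuous_intros)

lemma bracket_sq_line: "bracket_sq (\<xi> + s *\<^sub>R b) = bracket_sq \<xi> + 2 * s * (\<xi> \<bullet> b) + s\<^sup>2 * (b \<bullet> b)"
  unfolding bracket_sq_def power2_norm_eq_inner
  by (simp add: inner_add_left inner_add_right inner_commute[of b \<xi>] power2_eq_square algebra_simps)

lemma has_line_derivative_bracket_sq: "has_line_derivative bracket_sq b (\<lambda>\<xi>. 2 * (\<xi> \<bullet> b))"
  unfolding bracket_sq_line
  by (rule has_line_derivativeI)
     (auto simp: bracket_sq_line has_real_derivative_iff_has_vector_derivative[symmetric] intro!: derivative_eq_intros)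

lemma has_line_derivative_chain:
  fixes f :: "'a::euclidean_space \<Rightarrow> real"
  assumes f: "has_line_derivative f b f'" and g: "\<And>x. (g has_real_derivative g' (f x)) (at (f x))"
  shows "has_line_derivative (\<lambda>x. g (f x)) b (\<lambda>x. g' (f x) * f' x)"
proof (rule has_line_derivativeI)
  fix x
  have "((\<lambda>s. f (x + s *\<^sub>R b)) has_real_derivative f' x) (at 0)"
    using has_line_derivativeD[OF f, of x 0] by (simp add: has_real_derivative_iff_has_vector_derivative)
  moreover have "(g has_real_derivative g' (f x)) (at (f (x + 0 *\<^sub>R b)))"
    using g[of x] by simp
  ultimately have "((\<lambda>s. g (f (x + s *\<^sub>R b))) has_real_derivative g' (f x) * f' x) (at 0)"
    by (rule DERIV_chain2[rotated])
  then show "((\<lambda>s. g (f (x + s *\<^sub>R b))) has_vector_derivative g' (f x) * f' x) (at 0)"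
    by (simp add: has_real_derivative_iff_has_vector_derivative)
qed

text \<open>The square makes the cutoff continuously differentiable.\<close>

definition cutoff :: "real \<Rightarrow> 'a::euclidean_space \<Rightarrow> real" where
  "cutoff R \<xi> = (max 0 (1 - bracket_sq \<xi> / R\<^sup>2))\<^sup>2"

definition cutoff_deriv :: "real \<Rightarrow> 'a::euclidean_space \<Rightarrow> 'a \<Rightarrow> real" where
  "cutoff_deriv R b \<xi> = - 4 * max 0 (1 - bracket_sq \<xi> / R\<^sup>2) * (\<xi> \<bullet> b) / R\<^sup>2"

lemma has_line_derivative_cutoff: "has_line_derivative (cutoff R) b (cutoff_deriv R b)"
proof -
  have "has_line_derivative (\<lambda>\<xi>::'a. 1 - inverse (R\<^sup>2) * bracket_sq \<xi>) b (\<lambda>\<xi>. (- inverse (R\<^sup>2)) * (2 * (\<xi> \<bullet> b)))"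
    by (rule has_line_derivative_chain[OF has_line_derivative_bracket_sq, of "\<lambda>y. 1 - inverse (R\<^sup>2) * y"])
       (auto intro!: derivative_eq_intros)
  from has_line_derivative_chain[OF this, of "\<lambda>s. (max 0 s)\<^sup>2" "\<lambda>s. 2 * max 0 s", OF has_real_derivative_pos_part_square]
  show ?thesis
    by (simp add: cutoff_def[abs_def] cutoff_deriv_def[abs_def] divide_inverse mult_ac)
qed

lemma cutoff_measurable [measurable]: "cutoff R \<in> borel_measurable borel"
  unfolding cutoff_def[abs_def] by measurable

lemma cutoff_deriv_measurable [measurable]: "cutoff_deriv R b \<in> borel_measurable borel"
  unfolding cutoff_deriv_def[abs_def] by measurable

text \<open>With \<open>y = bracket_sq \<xi> / R\<^sup>2\<close> \<le> 1 the cutoff is the square of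
  \<open>1 - y\<close>, so its distance from 1 is \<open>2 * y - y\<^sup>2\<close>. As
  \<open>R < norm \<xi>\<close> implies \<open>R\<^sup>2 < bracket_sq \<xi>\<close>, the support
  lies in the ball of radius \<open>R\<close>.\<close>

lemma
  assumes "1 \<le> R"
  shows cutoff_range: "0 \<le> cutoff R \<xi>" "cutoff R \<xi> \<le> 1"
    and cutoff_compl_le: "1 - cutoff R \<xi> \<le> 2 * (bracket_sq \<xi> / R\<^sup>2)"
    and cutoff_eq_0: "R\<^sup>2 < bracket_sq \<xi> \<Longrightarrow> cutoff R \<xi> = 0"
    and cutoff_deriv_eq_0: "R\<^sup>2 < bracket_sq \<xi> \<Longrightarrow> cutoff_deriv R b \<xi> = 0"
    and cutoff_deriv_abs_le: "\<bar>cutoff_deriv R b \<xi>\<bar> \<le> 4 * \<bar>\<xi> \<bullet> b\<bar> / R\<^sup>2"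
proof -
  let ?y = "bracket_sq \<xi> / R\<^sup>2"
  have y: "0 < ?y" using assms bracket_sq_pos[of \<xi>] by (intro divide_pos_pos) auto
  show "0 \<le> cutoff R \<xi>" by (simp add: cutoff_def)
  show "cutoff R \<xi> \<le> 1" unfolding cutoff_def using y by (intro power_le_one) auto
  show "1 - cutoff R \<xi> \<le> 2 * ?y"
  proof (cases "?y \<le> 1")
    case True
    then have "cutoff R \<xi> = 1 - 2 * ?y + ?y\<^sup>2"
      by (simp add: cutoff_def max_def power2_eq_square algebra_simps)
    then show ?thesis by simp
  next
    case False
    then show ?thesis by (simp add: cutoff_def max_def)
  qed
  show "cutoff R \<xi> = 0" if "R\<^sup>2 < bracket_sq \<xi>"
    using that assms by (simp add: cutoff_def max_def field_simps)
  show "cutoff_deriv R b \<xi> = 0" if "R\<^sup>2 < bracket_sq \<xi>"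
    using that assms by (simp add: cutoff_deriv_def max_def field_simps)
  have "\<bar>max 0 (1 - ?y)\<bar> \<le> 1" using y by auto
  then have "4 * (\<bar>max 0 (1 - ?y)\<bar> * \<bar>\<xi> \<bullet> b\<bar>) / R\<^sup>2 \<le> 4 * (1 * \<bar>\<xi> \<bullet> b\<bar>) / R\<^sup>2"
    by (intro divide_right_mono mult_left_mono mult_right_mono) auto
  then show "\<bar>cutoff_deriv R b \<xi>\<bar> \<le> 4 * \<bar>\<xi> \<bullet> b\<bar> / R\<^sup>2"
    by (simp add: cutoff_deriv_def abs_mult mult.assoc)
qed

section \<open>Tails of a Fourier transform outside a ball\<close>

lemma sum_inner_sq_Basis: "(\<Sum>b\<in>Basis. (x \<bullet> b)\<^sup>2) = (norm x)\<^sup>2"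
  unfolding power2_norm_eq_inner euclidean_inner[of x x] by (simp add: power2_eq_square)

text \<open>Here \<open>J\<close> stands for \<open>bracket_sq \<xi>\<close>, \<open>A\<close> for
  the square of |h| and \<open>B\<close> for the squared length of its gradient. Where the cutoff at
  \<open>R\<close> vanishes only the high part of \<open>h\<close> is present; elsewhere both parts
  contribute, with decaying powers of \<open>R\<close>. The two branches make the later integral
  over \<open>R\<close> finite.\<close>

definition tail_weight :: "real \<Rightarrow> real \<Rightarrow> real \<Rightarrow> real \<Rightarrow> real" where
  "tail_weight R J A B = (if R\<^sup>2 < J then 2 * A else 72 * (J / R\<^sup>2)\<^sup>2 * A + 4 / R\<^sup>2 * B)"

lemma norm_add_sq_le: "(norm (x + y))\<^sup>2 \<le> 2 * (norm x)\<^sup>2 + 2 * (norm y)\<^sup>2"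
proof -
  have "(norm (x + y))\<^sup>2 \<le> (norm x + norm y)\<^sup>2" by (intro power_mono norm_triangle_ineq) auto
  also have "\<dots> \<le> 2 * (norm x)\<^sup>2 + 2 * (norm y)\<^sup>2"
    using sum_squares_bound[of "norm x" "norm y"] by (simp add: power2_sum)
  finally show ?thesis .
qed

text \<open>Up to factors 2, the left side is the energy of the high part plus that of the gradient
  of the low part divided by \<open>R\<^sup>2\<close>. The constant 72 is 8 from
  \<open>1 - cutoff R \<xi>\<close> and 64 from the derivative of the cutoff; the 4 comes from
  splitting the gradient by the product rule.\<close>

lemma tail_weight_ge:
  fixes h :: complex and h' :: "'a::euclidean_space \<Rightarrow> complex"
  assumes R: "1 \<le> R"
  shows "2 * (norm (of_real (1 - cutoff R \<xi>) * h))\<^sup>2 +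
    2 / R\<^sup>2 * (\<Sum>b\<in>Basis. (norm (of_real (cutoff R \<xi>) * h' b + of_real (cutoff_deriv R b \<xi>) * h))\<^sup>2)
    \<le> tail_weight R (bracket_sq \<xi>) ((norm h)\<^sup>2) (\<Sum>b\<in>Basis. (norm (h' b))\<^sup>2)"
proof (cases "R\<^sup>2 < bracket_sq \<xi>")
  case True
  then show ?thesis
    by (simp add: tail_weight_def cutoff_eq_0[OF R] cutoff_deriv_eq_0[OF R])
next
  case False
  define y where "y = bracket_sq \<xi> / R\<^sup>2"
  have Rp: "0 < R\<^sup>2" "1 \<le> R\<^sup>2" using R by (auto intro: one_le_power)
  have alg: "2 / r * (2 * S + 32 / r\<^sup>2 * H * X) = 64 * (1 / r * (X / r\<^sup>2)) * H + 4 / r * S" if "0 < r" for r S H X :: real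
    using that by (simp add: field_simps power2_eq_square)
  have y0: "0 \<le> y" using Rp by (simp add: y_def less_imp_le)
  have 1: "(norm (of_real (1 - cutoff R \<xi>) * h))\<^sup>2 \<le> 4 * y\<^sup>2 * (norm h)\<^sup>2"
  proof -
    have "(1 - cutoff R \<xi>)\<^sup>2 \<le> (2 * y)\<^sup>2"
      using cutoff_compl_le[OF R, of \<xi>] cutoff_range[OF R, of \<xi>] by (intro power_mono) (auto simp: y_def)
    then show ?thesis
      unfolding norm_mult power_mult_distrib norm_of_real power2_abs by (intro mult_right_mono) auto
  qed
  have 2: "(norm (of_real (cutoff R \<xi>) * h' b + of_real (cutoff_deriv R b \<xi>) * h))\<^sup>2 \<le>
      2 * (norm (h' b))\<^sup>2 + 32 / (R\<^sup>2)\<^sup>2 * (norm h)\<^sup>2 * (\<xi> \<bullet> b)\<^sup>2" for b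
  proof -
    have "(norm (of_real (cutoff R \<xi>) * h' b))\<^sup>2 \<le> (norm (h' b))\<^sup>2"
      using cutoff_range[OF R, of \<xi>] by (intro power_mono) (auto simp: norm_mult mult_left_le_one_le)
    moreover have "(norm (of_real (cutoff_deriv R b \<xi>) * h))\<^sup>2 \<le> (4 * \<bar>\<xi> \<bullet> b\<bar> / R\<^sup>2 * norm h)\<^sup>2"
      unfolding norm_mult norm_of_real
      by (intro power_mono mult_right_mono cutoff_deriv_abs_le[OF R]) auto
    ultimately have "(norm (of_real (cutoff R \<xi>) * h' b + of_real (cutoff_deriv R b \<xi>) * h))\<^sup>2 \<le>
        2 * (norm (h' b))\<^sup>2 + 2 * (4 * \<bar>\<xi> \<bullet> b\<bar> / R\<^sup>2 * norm h)\<^sup>2"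
      using norm_add_sq_le[of "of_real (cutoff R \<xi>) * h' b" "of_real (cutoff_deriv R b \<xi>) * h"] by linarith
    also have "2 * (4 * \<bar>\<xi> \<bullet> b\<bar> / R\<^sup>2 * norm h)\<^sup>2 = 32 / (R\<^sup>2)\<^sup>2 * (norm h)\<^sup>2 * (\<xi> \<bullet> b)\<^sup>2"
      by (simp add: power_mult_distrib power_divide)
    finally show ?thesis .
  qed
  have "2 * (norm (of_real (1 - cutoff R \<xi>) * h))\<^sup>2 +
    2 / R\<^sup>2 * (\<Sum>b\<in>Basis. (norm (of_real (cutoff R \<xi>) * h' b + of_real (cutoff_deriv R b \<xi>) * h))\<^sup>2) \<le>
    2 * (4 * y\<^sup>2 * (norm h)\<^sup>2) + 2 / R\<^sup>2 * (\<Sum>b\<in>Basis. 2 * (norm (h' b))\<^sup>2 + 32 / (R\<^sup>2)\<^sup>2 * (norm h)\<^sup>2 * (\<xi> \<bullet> b)\<^sup>2)"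
    using Rp by (intro add_mono mult_left_mono 1 sum_mono 2) auto
  also have "(\<Sum>b\<in>Basis. 2 * (norm (h' b))\<^sup>2 + 32 / (R\<^sup>2)\<^sup>2 * (norm h)\<^sup>2 * (\<xi> \<bullet> b)\<^sup>2) =
      2 * (\<Sum>b\<in>Basis. (norm (h' b))\<^sup>2) + 32 / (R\<^sup>2)\<^sup>2 * (norm h)\<^sup>2 * (norm \<xi>)\<^sup>2"
    by (simp only: sum.distrib sum_distrib_left[symmetric] sum_inner_sq_Basis)
  also have "2 * (4 * y\<^sup>2 * (norm h)\<^sup>2) + 2 / R\<^sup>2 * (2 * (\<Sum>b\<in>Basis. (norm (h' b))\<^sup>2) + 32 / (R\<^sup>2)\<^sup>2 * (norm h)\<^sup>2 * (norm \<xi>)\<^sup>2) =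
      8 * y\<^sup>2 * (norm h)\<^sup>2 + 64 * (1 / R\<^sup>2 * ((norm \<xi>)\<^sup>2 / (R\<^sup>2)\<^sup>2)) * (norm h)\<^sup>2 + 4 / R\<^sup>2 * (\<Sum>b\<in>Basis. (norm (h' b))\<^sup>2)"
    using alg[OF Rp(1)] by simp
  \<comment> \<open>A factor \<open>1 / R\<^sup>2\<close> \<le> 1 is given away and
    \<open>(norm \<xi>)\<^sup>2\<close> is raised to \<open>(bracket_sq \<xi>)\<^sup>2\<close>, so
    that both contributions of \<open>h\<close> take the form
    \<open>(J / R\<^sup>2)\<^sup>2\<close>.\<close>
  also have "1 / R\<^sup>2 * ((norm \<xi>)\<^sup>2 / (R\<^sup>2)\<^sup>2) \<le> 1 * ((bracket_sq \<xi>)\<^sup>2 / (R\<^sup>2)\<^sup>2)"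
  proof (intro mult_mono divide_right_mono)
    show "(norm \<xi>)\<^sup>2 \<le> (bracket_sq \<xi>)\<^sup>2"
      by (rule order_trans[of _ "bracket_sq \<xi>"]) (simp_all add: bracket_sq_def self_le_power)
  qed (use Rp in auto)
  finally show ?thesis
    using False by (simp add: tail_weight_def y_def power_divide mult_right_mono algebra_simps)
qed

text \<open>Multiplication by \<open>x\<close> is differentiation in \<xi>, so for
  \<open>norm x\<close> \<ge> \<open>R\<close> the transform of the low part is at most
  \<open>1 / R\<close> times that of its gradient. The high part is used as it is. Plancherel is
  applied to each piece, and the energies are compared pointwise in \<xi>.\<close>

lemma tail_bound:
  fixes h :: "'a::euclidean_space \<Rightarrow> complex" and h' :: "'a \<Rightarrow> 'a \<Rightarrow> complex"
  assumes h: "integrable lborel h" and ch: "continuous_on UNIV h" and ch': "\<And>b. b \<in> Basis \<Longrightarrow> continuous_on UNIV (h' b)"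
    and der: "\<And>b. b \<in> Basis \<Longrightarrow> has_line_derivative h b (h' b)" and R: "1 \<le> R"
  shows "(\<integral>\<^sup>+x. ennreal ((norm (\<integral>\<xi>. cis (x \<bullet> \<xi>) * h \<xi> \<partial>lborel))\<^sup>2) * indicator {x. R \<le> norm x} x \<partial>lborel) \<le>
    ennreal ((2 * pi) ^ DIM('a)) *
      (\<integral>\<^sup>+\<xi>. ennreal (tail_weight R (bracket_sq \<xi>) ((norm (h \<xi>))\<^sup>2) (\<Sum>b\<in>Basis. (norm (h' b \<xi>))\<^sup>2)) \<partial>lborel)"
proof -
  have [measurable]: "h \<in> borel_measurable borel" using h by simp
  have mh' [measurable]: "h' b \<in> borel_measurable borel" if "b \<in> Basis" for b
    using ch'[OF that] by (rule borel_measurable_continuous_onI)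
  define low where "low \<xi> = of_real (cutoff R \<xi>) * h \<xi>" for \<xi>
  define high where "high \<xi> = of_real (1 - cutoff R \<xi>) * h \<xi>" for \<xi>
  define D where "D b \<xi> = of_real (cutoff R \<xi>) * h' b \<xi> + of_real (cutoff_deriv R b \<xi>) * h \<xi>" for b \<xi>
  define F where "F k x = (\<integral>\<xi>. cis (x \<bullet> \<xi>) * k \<xi> \<partial>lborel)" for k :: "'a \<Rightarrow> complex" and x
  have [measurable]: "low \<in> borel_measurable borel" "high \<in> borel_measurable borel"
    unfolding low_def[abs_def] high_def[abs_def] by measurable
  have mD [measurable]: "D b \<in> borel_measurable borel" if "b \<in> Basis" for b
    using mh'[OF that] unfolding D_def[abs_def] by measurable
  have suppR: "R\<^sup>2 < bracket_sq \<xi>" if "R < norm \<xi>" for \<xi> :: 'a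
    using power_strict_mono[OF that, of 2] R by (simp add: bracket_sq_def)
  obtain B where B0: "0 \<le> B" and B: "\<And>\<xi>. norm \<xi> \<le> R \<Longrightarrow> norm (h \<xi>) \<le> B"
    using bounded_on_cball[OF ch, of R] by metis
  have low_int: "integrable lborel low"
    by (rule Bochner_Integration.integrable_bound[OF h])
       (use cutoff_range[OF R] in \<open>auto simp: low_def norm_mult abs_of_nonneg[OF cutoff_range(1)[OF R]] intro!: AE_I2 mult_left_le_one_le\<close>)
  have high_int: "integrable lborel high"
  proof (rule Bochner_Integration.integrable_bound[OF h])
    have "\<bar>1 - cutoff R \<xi>\<bar> \<le> 1" for \<xi> :: 'a using cutoff_range[OF R, of \<xi>] by simp
    then show "AE \<xi> in lborel. norm (high \<xi>) \<le> norm (h \<xi>)"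
      by (intro AE_I2) (auto simp: high_def norm_mult simp del: of_real_diff intro!: mult_left_le_one_le)
  qed simp
  \<comment> \<open>\<open>D b\<close> is the derivative of \<open>low\<close> along
    \<open>b\<close>. Both vanish outside the ball of radius \<open>R\<close> and are bounded on it
    by continuity of \<open>h\<close> and \<open>h' b\<close>, so integration by parts
    applies.\<close>
  have D_props: "of_real (x \<bullet> b) * F low x = \<i> * F (D b) x \<and> integrable lborel (D b)" if b: "b \<in> Basis" for b x
  proof -
    obtain B' where B'0: "0 \<le> B'" and B': "\<And>\<xi>. norm \<xi> \<le> R \<Longrightarrow> norm (h' b \<xi>) \<le> B'"
      using bounded_on_cball[OF ch'[OF b], of R] by metis
    have Dbd: "norm (D b \<xi>) \<le> B' + 4 * R / R\<^sup>2 * B" for \<xi>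
    proof (cases "R < norm \<xi>")
      case True
      then show ?thesis using suppR[OF True] B0 B'0 R by (simp add: D_def cutoff_eq_0[OF R] cutoff_deriv_eq_0[OF R])
    next
      case False
      have "\<bar>\<xi> \<bullet> b\<bar> \<le> R" using False Basis_le_norm[OF b, of \<xi>] by linarith
      then have "\<bar>cutoff_deriv R b \<xi>\<bar> \<le> 4 * R / R\<^sup>2"
        using R by (intro order_trans[OF cutoff_deriv_abs_le[OF R]] divide_right_mono) auto
      then have "norm (of_real (cutoff_deriv R b \<xi>) * h \<xi>) \<le> 4 * R / R\<^sup>2 * B"
        unfolding norm_mult using B[of \<xi>] False R by (intro mult_mono) auto
      moreover have "norm (of_real (cutoff R \<xi>) * h' b \<xi>) \<le> 1 * B'"
        unfolding norm_mult using cutoff_range[OF R, of \<xi>] B'[of \<xi>] False by (intro mult_mono) auto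
      ultimately show ?thesis unfolding D_def by (intro order_trans[OF norm_triangle_ineq]) auto
    qed
    have D0: "R < norm \<xi> \<Longrightarrow> D b \<xi> = 0" for \<xi>
      using suppR[of \<xi>] by (simp add: D_def cutoff_eq_0[OF R] cutoff_deriv_eq_0[OF R])
    have "of_real (x \<bullet> b) * F low x = \<i> * F (D b) x"
      unfolding F_def
    proof (rule mult_fourier_line_derivative[where R=R and B=B])
      show "has_line_derivative low b (D b)"
        using has_line_derivative_mult[OF has_line_derivative_of_real[OF has_line_derivative_cutoff] der[OF b]]
        by (simp add: low_def[abs_def] D_def[abs_def])
      show "norm (low \<xi>) \<le> B" for \<xi>
      proof (cases "R < norm \<xi>")
        case True
        then show ?thesis using suppR[OF True] B0 by (simp add: low_def cutoff_eq_0[OF R])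
      next
        case False
        have "norm (low \<xi>) \<le> 1 * B"
          unfolding norm_mult low_def using cutoff_range[OF R, of \<xi>] B[of \<xi>] False by (intro mult_mono) auto
        then show ?thesis by simp
      qed
      show "R < norm \<xi> \<Longrightarrow> low \<xi> = 0" for \<xi> using suppR[of \<xi>] by (simp add: low_def cutoff_eq_0[OF R])
    qed (use b in \<open>auto simp: D0 intro: Dbd\<close>)
    moreover have "integrable lborel (D b)"
      using b by (intro integrable_bounded_support[OF _ Dbd D0, where L = R]) auto
    ultimately show ?thesis by blast
  qed
  have mF: "F k \<in> borel_measurable borel" if "integrable lborel k" for k
    unfolding F_def[abs_def] by (rule measurable_integral_cis[OF that])
  have [measurable]: "F low \<in> borel_measurable borel" "F high \<in> borel_measurable borel"
    by (intro mF low_int high_int)+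
  have mFD [measurable]: "b \<in> Basis \<Longrightarrow> F (D b) \<in> borel_measurable borel" for b
    using D_props by (intro mF) blast
  have split: "F h x = F high x + F low x" for x
  proof -
    have "F high x + F low x = (\<integral>\<xi>. cis (x \<bullet> \<xi>) * high \<xi> + cis (x \<bullet> \<xi>) * low \<xi> \<partial>lborel)"
      unfolding F_def by (intro Bochner_Integration.integral_add[symmetric] integrable_cis_mult low_int high_int)
    also have "\<dots> = F h x"
      unfolding F_def low_def high_def by (intro Bochner_Integration.integral_cong) (auto simp: algebra_simps)
    finally show ?thesis by simp
  qed
  have low_le: "(norm (F low x))\<^sup>2 \<le> 1 / R\<^sup>2 * (\<Sum>b\<in>Basis. (norm (F (D b) x))\<^sup>2)" if "R \<le> norm x" for x
  proof -
    have "(\<Sum>b\<in>Basis. (norm (F (D b) x))\<^sup>2) = (\<Sum>b\<in>Basis. (norm (of_real (x \<bullet> b) * F low x))\<^sup>2)"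
      using D_props by (intro sum.cong) (auto simp: norm_mult)
    also have "\<dots> = (norm x)\<^sup>2 * (norm (F low x))\<^sup>2"
      by (simp add: norm_mult power_mult_distrib sum_distrib_right[symmetric] sum_inner_sq_Basis)
    also have "\<dots> \<ge> R\<^sup>2 * (norm (F low x))\<^sup>2"
      using that R by (intro mult_right_mono power_mono) auto
    finally show ?thesis using R by (simp add: field_simps)
  qed
  have "(\<integral>\<^sup>+x. ennreal ((norm (F h x))\<^sup>2) * indicator {x. R \<le> norm x} x \<partial>lborel) \<le>
      (\<integral>\<^sup>+x. ennreal 2 * ennreal ((norm (F high x))\<^sup>2) + ennreal (2 / R\<^sup>2) * (\<Sum>b\<in>Basis. ennreal ((norm (F (D b) x))\<^sup>2)) \<partial>lborel)"
  proof (rule nn_integral_mono)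
    fix x
    show "ennreal ((norm (F h x))\<^sup>2) * indicator {x. R \<le> norm x} x \<le>
      ennreal 2 * ennreal ((norm (F high x))\<^sup>2) + ennreal (2 / R\<^sup>2) * (\<Sum>b\<in>Basis. ennreal ((norm (F (D b) x))\<^sup>2))"
    proof (cases "R \<le> norm x")
      case True
      have "(norm (F h x))\<^sup>2 \<le> 2 * (norm (F high x))\<^sup>2 + 2 * (norm (F low x))\<^sup>2"
        unfolding split by (rule norm_add_sq_le)
      also have "\<dots> \<le> 2 * (norm (F high x))\<^sup>2 + 2 / R\<^sup>2 * (\<Sum>b\<in>Basis. (norm (F (D b) x))\<^sup>2)"
        using low_le[OF True] by simp
      finally have "ennreal ((norm (F h x))\<^sup>2) \<le> ennreal (2 * (norm (F high x))\<^sup>2 + 2 / R\<^sup>2 * (\<Sum>b\<in>Basis. (norm (F (D b) x))\<^sup>2))"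
        by (rule ennreal_leI)
      also have "\<dots> = ennreal 2 * ennreal ((norm (F high x))\<^sup>2) + ennreal (2 / R\<^sup>2) * (\<Sum>b\<in>Basis. ennreal ((norm (F (D b) x))\<^sup>2))"
        by (subst ennreal_plus) (auto simp: ennreal_mult sum_ennreal sum_nonneg simp del: times_divide_eq_left)
      finally show ?thesis using True by simp
    qed simp
  qed
  also have "\<dots> = ennreal 2 * (\<integral>\<^sup>+x. ennreal ((norm (F high x))\<^sup>2) \<partial>lborel) +
      ennreal (2 / R\<^sup>2) * (\<Sum>b\<in>Basis. \<integral>\<^sup>+x. ennreal ((norm (F (D b) x))\<^sup>2) \<partial>lborel)"
    by (subst nn_integral_add, measurable) (simp add: nn_integral_cmult nn_integral_sum del: sum_ennreal)
  also have "\<dots> \<le> ennreal 2 * (ennreal ((2 * pi) ^ DIM('a)) * (\<integral>\<^sup>+\<xi>. ennreal ((norm (high \<xi>))\<^sup>2) \<partial>lborel)) +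
      ennreal (2 / R\<^sup>2) * (\<Sum>b\<in>Basis. ennreal ((2 * pi) ^ DIM('a)) * (\<integral>\<^sup>+\<xi>. ennreal ((norm (D b \<xi>))\<^sup>2) \<partial>lborel))"
    using D_props unfolding F_def by (intro add_mono mult_left_mono sum_mono plancherel_le high_int) auto
  also have "\<dots> = ennreal ((2 * pi) ^ DIM('a)) *
     (\<integral>\<^sup>+\<xi>. ennreal 2 * ennreal ((norm (high \<xi>))\<^sup>2) + ennreal (2 / R\<^sup>2) * (\<Sum>b\<in>Basis. ennreal ((norm (D b \<xi>))\<^sup>2)) \<partial>lborel)"
    by (subst nn_integral_add, measurable)
       (simp add: nn_integral_cmult nn_integral_sum sum_distrib_left[symmetric] distrib_left mult_ac del: sum_ennreal)
  also have "\<dots> \<le> ennreal ((2 * pi) ^ DIM('a)) *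
      (\<integral>\<^sup>+\<xi>. ennreal (tail_weight R (bracket_sq \<xi>) ((norm (h \<xi>))\<^sup>2) (\<Sum>b\<in>Basis. (norm (h' b \<xi>))\<^sup>2)) \<partial>lborel)"
  proof (intro mult_left_mono nn_integral_mono)
    fix \<xi>
    have "ennreal 2 * ennreal ((norm (high \<xi>))\<^sup>2) + ennreal (2 / R\<^sup>2) * (\<Sum>b\<in>Basis. ennreal ((norm (D b \<xi>))\<^sup>2)) =
      ennreal (2 * (norm (high \<xi>))\<^sup>2 + 2 / R\<^sup>2 * (\<Sum>b\<in>Basis. (norm (D b \<xi>))\<^sup>2))"
      by (subst ennreal_plus) (auto simp: ennreal_mult sum_ennreal sum_nonneg simp del: times_divide_eq_left)
    also have "\<dots> \<le> ennreal (tail_weight R (bracket_sq \<xi>) ((norm (h \<xi>))\<^sup>2) (\<Sum>b\<in>Basis. (norm (h' b \<xi>))\<^sup>2))"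
      unfolding high_def D_def by (intro ennreal_leI tail_weight_ge R)
    finally show "ennreal 2 * ennreal ((norm (high \<xi>))\<^sup>2) + ennreal (2 / R\<^sup>2) * (\<Sum>b\<in>Basis. ennreal ((norm (D b \<xi>))\<^sup>2)) \<le>
      ennreal (tail_weight R (bracket_sq \<xi>) ((norm (h \<xi>))\<^sup>2) (\<Sum>b\<in>Basis. (norm (h' b \<xi>))\<^sup>2))" .
  qed simp
  finally show ?thesis unfolding F_def .
qed

lemma tail_weight_nonneg: "0 \<le> A \<Longrightarrow> 0 \<le> B \<Longrightarrow> 0 \<le> tail_weight R J A B"
  by (simp add: tail_weight_def)

text \<open>The factor \<open>2 * a * R powr (2 * a - 1)\<close> is the derivative of
  \<open>R powr (2 * a)\<close>. Splitting at \<open>R = sqrt J\<close>, where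
  \<open>tail_weight\<close> changes branch, leaves three power integrals that scale like
  \<open>J powr a\<close> and \<open>J powr (a - 1)\<close>. The upper bound on \<open>a\<close>
  gives convergence at infinity with bounded coefficients; 74 is 2 + 72.\<close>

lemma nn_integral_tail_weight:
  assumes J: "1 \<le> J" and A: "0 \<le> A" and B: "0 \<le> B" and a: "0 < a" "a \<le> 1/2"
  shows "(\<integral>\<^sup>+R. ennreal (2 * a * R powr (2 * a - 1) * tail_weight R J A B) * indicator {1..} R \<partial>lborel) \<le>
    ennreal (74 * (J powr a * A + J powr (a - 1) * B))"
proof -
  define y where "y = sqrt J"
  have y: "1 \<le> y" using J by (simp add: y_def)
  have Jy: "J = y powr 2" using J by (simp add: y_def)
  have yp: "0 < y" "y \<noteq> 0" using y by auto
  let ?c1 = "4 * a * A" and ?c2 = "2 * a * 72 * J\<^sup>2 * A" and ?c3 = "2 * a * 4 * B"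
  let ?I1 = "\<lambda>R. ennreal (R powr (2 * a - 1)) * indicator {1..y} R"
  let ?I2 = "\<lambda>R. ennreal (R powr (- (4 - 2 * a) - 1)) * indicator {y..} R"
  let ?I3 = "\<lambda>R. ennreal (R powr (- (2 - 2 * a) - 1)) * indicator {y..} R"
  have "(\<integral>\<^sup>+R. ennreal (2 * a * R powr (2 * a - 1) * tail_weight R J A B) * indicator {1..} R \<partial>lborel) \<le>
    (\<integral>\<^sup>+R. ennreal ?c1 * ?I1 R + (ennreal ?c2 * ?I2 R + ennreal ?c3 * ?I3 R) \<partial>lborel)"
  proof (rule nn_integral_mono)
    fix R :: real
    show "ennreal (2 * a * R powr (2 * a - 1) * tail_weight R J A B) * indicator {1..} R \<le>
      ennreal ?c1 * ?I1 R + (ennreal ?c2 * ?I2 R + ennreal ?c3 * ?I3 R)"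
    proof (cases "1 \<le> R")
      case R: True
      show ?thesis
      proof (cases "R\<^sup>2 < J")
        case True
        then have "R \<le> y" unfolding y_def by (intro real_le_rsqrt) auto
        then have "ennreal (2 * a * R powr (2 * a - 1) * tail_weight R J A B) * indicator {1..} R = ennreal ?c1 * ?I1 R"
          using R True a A by (simp add: tail_weight_def ennreal_mult[symmetric] mult_ac)
        then show ?thesis by simp
      next
        case False
        then have "y \<le> R" unfolding y_def using R by (intro real_le_lsqrt) (use J in auto)
        have Rp: "R\<^sup>2 = R powr 2" using R by (simp add: powr_numeral)
        have p2: "R powr (2 * a - 1) * (J / R\<^sup>2)\<^sup>2 = J\<^sup>2 * R powr (- (4 - 2 * a) - 1)"
        proof -
          have "R powr (- (4 - 2 * a) - 1) = R powr (2 * a - 1) / R powr 4"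
            by (subst powr_diff[symmetric]) (simp add: algebra_simps)
          also have "R powr 4 = (R\<^sup>2)\<^sup>2" using R by (simp add: powr_numeral)
          finally show ?thesis by (simp add: power_divide)
        qed
        have p3: "R powr (2 * a - 1) * (4 / R\<^sup>2) = 4 * R powr (- (2 - 2 * a) - 1)"
        proof -
          have "R powr (- (2 - 2 * a) - 1) = R powr (2 * a - 1) / R powr 2"
            by (subst powr_diff[symmetric]) (simp add: algebra_simps)
          then show ?thesis by (simp add: Rp)
        qed
        have "2 * a * R powr (2 * a - 1) * tail_weight R J A B =
          2 * a * 72 * A * (R powr (2 * a - 1) * (J / R\<^sup>2)\<^sup>2) + 2 * a * B * (R powr (2 * a - 1) * (4 / R\<^sup>2))"
          using False by (simp add: tail_weight_def algebra_simps)
        also have "\<dots> = ?c2 * R powr (- (4 - 2 * a) - 1) + ?c3 * R powr (- (2 - 2 * a) - 1)"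
          unfolding p2 p3 by simp
        finally have "ennreal (2 * a * R powr (2 * a - 1) * tail_weight R J A B) * indicator {1..} R = ennreal ?c2 * ?I2 R + ennreal ?c3 * ?I3 R"
          using R \<open>y \<le> R\<close> a A B by (simp add: ennreal_mult[symmetric])
        then show ?thesis by simp
      qed
    qed simp
  qed
  also have "\<dots> = ennreal ?c1 * (\<integral>\<^sup>+R. ?I1 R \<partial>lborel) + (ennreal ?c2 * (\<integral>\<^sup>+R. ?I2 R \<partial>lborel) + ennreal ?c3 * (\<integral>\<^sup>+R. ?I3 R \<partial>lborel))"
    by (simp add: nn_integral_add nn_integral_cmult)
  also have "\<dots> \<le> ennreal ?c1 * ennreal (y powr (2 * a) / (2 * a)) +
      (ennreal ?c2 * ennreal (y powr (- (4 - 2 * a)) / (4 - 2 * a)) + ennreal ?c3 * ennreal (y powr (- (2 - 2 * a)) / (2 - 2 * a)))"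
    using a y yp
    by (intro add_mono mult_left_mono nn_integral_powr_Icc order_eq_refl[OF nn_integral_powr_atLeast]) auto
  also have "\<dots> = ennreal (?c1 * (y powr (2 * a) / (2 * a)) +
      (?c2 * (y powr (- (4 - 2 * a)) / (4 - 2 * a)) + ?c3 * (y powr (- (2 - 2 * a)) / (2 - 2 * a))))"
    using a A B by (simp add: ennreal_mult[symmetric] ennreal_plus[symmetric] del: ennreal_plus)
  also have "?c1 * (y powr (2 * a) / (2 * a)) = 2 * (J powr a * A)"
    using a by (simp add: Jy powr_powr)
  also have "?c2 * (y powr (- (4 - 2 * a)) / (4 - 2 * a)) = 144 * a / (4 - 2 * a) * (J powr a * A)"
  proof -
    have "J\<^sup>2 * y powr (- (4 - 2 * a)) = y powr (4 + - (4 - 2 * a))"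
      unfolding powr_add Jy using yp by (simp add: powr_numeral)
    also have "\<dots> = J powr a" by (simp add: Jy powr_powr)
    finally show ?thesis by (simp add: field_simps)
  qed
  also have "?c3 * (y powr (- (2 - 2 * a)) / (2 - 2 * a)) = 8 * a / (2 - 2 * a) * (J powr (a - 1) * B)"
  proof -
    have "y powr (- (2 - 2 * a)) = J powr (a - 1)"
      by (simp add: Jy powr_powr algebra_simps)
    then show ?thesis by simp
  qed
  \<comment> \<open>For \<open>a\<close> \<le> 1/2 the two fractions are at most 24 and 4; they are
    rounded up to 72 and 74 to end with one constant.\<close>
  also have "ennreal (2 * (J powr a * A) + (144 * a / (4 - 2 * a) * (J powr a * A) + 8 * a / (2 - 2 * a) * (J powr (a - 1) * B))) \<le>
      ennreal (2 * (J powr a * A) + (72 * (J powr a * A) + 74 * (J powr (a - 1) * B)))"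
    using a A B by (intro ennreal_leI add_mono mult_right_mono order_refl) (auto simp: field_simps)
  finally show ?thesis by (simp add: algebra_simps)
qed

text \<open>The layer-cake formula, started at 1 because the tail bound holds for radii
  \<open>R\<close> \<ge> 1; the summand 1 covers the smaller ones.\<close>

lemma powr_le_nn_integral:
  fixes a t :: real
  assumes "0 < a" "0 \<le> t"
  shows "ennreal (t powr a) \<le> 1 + (\<integral>\<^sup>+R. ennreal (a * R powr (a - 1)) * indicator {1..t} R \<partial>lborel)"
proof (cases "1 \<le> t")
  case True
  have "(\<integral>\<^sup>+R. ennreal (a * R powr (a - 1)) * indicator {1..t} R \<partial>lborel) = ennreal (t powr a - 1 powr a)"
    using True assms by (intro nn_integral_FTC_Icc) (auto intro!: derivative_eq_intros)
  moreover have "ennreal (t powr a) = 1 + ennreal (t powr a - 1 powr a)"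
    using True assms by (subst ennreal_1[symmetric], subst ennreal_plus[symmetric]) (auto simp: ge_one_powr_ge_zero)
  ultimately show ?thesis by simp
next
  case False
  then have "t powr a \<le> 1" using assms by (intro powr_le1) auto
  then have "ennreal (t powr a) \<le> 1" by (simp add: ennreal_le_1)
  then show ?thesis by (rule order_trans) simp
qed

text \<open>The layer-cake formula writes the weight as an integral over radii. The tail bound
  applies at each radius, and by Tonelli the integral over radii is then computed at fixed \<xi>.
  Since \<open>(s + 1)\<^sup>2\<close> \<le> \<open>2 * s\<^sup>2 + 2\<close>, the constant is 152 =
  2 (1 + 74) + 2.\<close>

lemma weighted_plancherel:
  fixes h :: "'a::euclidean_space \<Rightarrow> complex" and h' :: "'a \<Rightarrow> 'a \<Rightarrow> complex"
  assumes h: "integrable lborel h" and ch: "continuous_on UNIV h" and ch': "\<And>b. b \<in> Basis \<Longrightarrow> continuous_on UNIV (h' b)"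
    and der: "\<And>b. b \<in> Basis \<Longrightarrow> has_line_derivative h b (h' b)" and a: "0 < a" "a \<le> 1/2"
  shows "(\<integral>\<^sup>+x. ennreal (((norm x powr a + 1) * norm (\<integral>\<xi>. cis (x \<bullet> \<xi>) * h \<xi> \<partial>lborel))\<^sup>2) \<partial>lborel) \<le>
    ennreal (152 * (2 * pi) ^ DIM('a)) *
      (\<integral>\<^sup>+\<xi>. ennreal (bracket_sq \<xi> powr a * (norm (h \<xi>))\<^sup>2 + bracket_sq \<xi> powr (a - 1) * (\<Sum>b\<in>Basis. (norm (h' b \<xi>))\<^sup>2)) \<partial>lborel)"
    (is "_ \<le> _ * (\<integral>\<^sup>+\<xi>. ennreal (?E \<xi>) \<partial>lborel)")
proof -
  have [measurable]: "h \<in> borel_measurable borel" using h by simp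
  have [measurable]: "h' b \<in> borel_measurable borel" if "b \<in> Basis" for b
    using ch'[OF that] by (rule borel_measurable_continuous_onI)
  define N where "N \<xi> = (\<Sum>b\<in>Basis. (norm (h' b \<xi>))\<^sup>2)" for \<xi>
  have [measurable]: "N \<in> borel_measurable borel" unfolding N_def[abs_def] by measurable
  have N0: "0 \<le> N \<xi>" for \<xi> by (simp add: N_def sum_nonneg)
  define g where "g x = ennreal ((norm (\<integral>\<xi>. cis (x \<bullet> \<xi>) * h \<xi> \<partial>lborel))\<^sup>2)" for x
  define P where "P = ennreal ((2 * pi) ^ DIM('a))"
  have [measurable]: "(\<lambda>x. \<integral>\<xi>. cis (x \<bullet> \<xi>) * h \<xi> \<partial>lborel) \<in> borel_measurable borel"
    by (rule measurable_integral_cis[OF h])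
  have [measurable]: "g \<in> borel_measurable borel"
    unfolding g_def[abs_def] by measurable
  define w where "w R = ennreal (2 * a * R powr (2 * a - 1))" for R
  have [measurable]: "w \<in> borel_measurable borel" unfolding w_def[abs_def] by measurable
  have g_int: "(\<integral>\<^sup>+x. g x \<partial>lborel) \<le> P * (\<integral>\<^sup>+\<xi>. ennreal (?E \<xi>) \<partial>lborel)"
  proof -
    have "(\<integral>\<^sup>+x. g x \<partial>lborel) \<le> P * (\<integral>\<^sup>+\<xi>. ennreal ((norm (h \<xi>))\<^sup>2) \<partial>lborel)"
      unfolding g_def P_def by (rule plancherel_le[OF h])
    also have "\<dots> \<le> P * (\<integral>\<^sup>+\<xi>. ennreal (?E \<xi>) \<partial>lborel)"
    proof (intro mult_left_mono nn_integral_mono ennreal_leI)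
      fix \<xi>
      have "1 * (norm (h \<xi>))\<^sup>2 \<le> bracket_sq \<xi> powr a * (norm (h \<xi>))\<^sup>2"
        using a by (intro mult_right_mono ge_one_powr_ge_zero) auto
      moreover have "0 \<le> bracket_sq \<xi> powr (a - 1) * N \<xi>" using N0 by simp
      ultimately show "(norm (h \<xi>))\<^sup>2 \<le> ?E \<xi>" by (simp add: N_def)
    qed simp
    finally show ?thesis .
  qed
  have "(\<integral>\<^sup>+x. ennreal (norm x powr (2 * a)) * g x \<partial>lborel) \<le>
      (\<integral>\<^sup>+x. g x + (\<integral>\<^sup>+R. w R * indicator {1..} R * (g x * indicator {x. R \<le> norm x} x) \<partial>lborel) \<partial>lborel)"
  proof (rule nn_integral_mono)
    fix x :: 'a
    have "ennreal (norm x powr (2 * a)) * g x \<le>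
        (1 + (\<integral>\<^sup>+R. ennreal (2 * a * R powr (2 * a - 1)) * indicator {1..norm x} R \<partial>lborel)) * g x"
      using a by (intro mult_right_mono powr_le_nn_integral) auto
    also have "\<dots> = g x + (\<integral>\<^sup>+R. w R * indicator {1..norm x} R * g x \<partial>lborel)"
      by (simp add: distrib_right nn_integral_multc w_def)
    also have "(\<integral>\<^sup>+R. w R * indicator {1..norm x} R * g x \<partial>lborel) =
       (\<integral>\<^sup>+R. w R * indicator {1..} R * (g x * indicator {x. R \<le> norm x} x) \<partial>lborel)"
      by (intro nn_integral_cong) (auto simp: indicator_def)
    finally show "ennreal (norm x powr (2 * a)) * g x \<le>
        g x + (\<integral>\<^sup>+R. w R * indicator {1..} R * (g x * indicator {x. R \<le> norm x} x) \<partial>lborel)" .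
  qed
  also have "\<dots> = (\<integral>\<^sup>+x. g x \<partial>lborel) +
      (\<integral>\<^sup>+x. \<integral>\<^sup>+R. w R * indicator {1..} R * (g x * indicator {x. R \<le> norm x} x) \<partial>lborel \<partial>lborel)"
    by (rule nn_integral_add) measurable
  also have "(\<integral>\<^sup>+x. \<integral>\<^sup>+R. w R * indicator {1..} R * (g x * indicator {x. R \<le> norm x} x) \<partial>lborel \<partial>lborel) =
      (\<integral>\<^sup>+R. \<integral>\<^sup>+x. w R * indicator {1..} R * (g x * indicator {x. R \<le> norm x} x) \<partial>lborel \<partial>lborel)"
    by (rule lborel_pair.Fubini') measurable
  also have "\<dots> = (\<integral>\<^sup>+R. w R * indicator {1..} R * (\<integral>\<^sup>+x. g x * indicator {x. R \<le> norm x} x \<partial>lborel) \<partial>lborel)"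
    by (intro nn_integral_cong nn_integral_cmult) measurable
  also have "\<dots> \<le> (\<integral>\<^sup>+R. w R * indicator {1..} R * (P * (\<integral>\<^sup>+\<xi>. ennreal (tail_weight R (bracket_sq \<xi>) ((norm (h \<xi>))\<^sup>2) (N \<xi>)) \<partial>lborel)) \<partial>lborel)"
  proof (rule nn_integral_mono)
    fix R
    show "w R * indicator {1..} R * (\<integral>\<^sup>+x. g x * indicator {x. R \<le> norm x} x \<partial>lborel) \<le>
        w R * indicator {1..} R * (P * (\<integral>\<^sup>+\<xi>. ennreal (tail_weight R (bracket_sq \<xi>) ((norm (h \<xi>))\<^sup>2) (N \<xi>)) \<partial>lborel))"
      using tail_bound[OF h ch ch' der, of R] unfolding g_def P_def N_def
      by (cases "1 \<le> R") (auto intro!: mult_left_mono)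
  qed
  also have "\<dots> = P * (\<integral>\<^sup>+R. \<integral>\<^sup>+\<xi>. ennreal (2 * a * R powr (2 * a - 1) * tail_weight R (bracket_sq \<xi>) ((norm (h \<xi>))\<^sup>2) (N \<xi>)) * indicator {1..} R \<partial>lborel \<partial>lborel)"
  proof -
    have "(\<integral>\<^sup>+R. w R * indicator {1..} R * (P * (\<integral>\<^sup>+\<xi>. ennreal (tail_weight R (bracket_sq \<xi>) ((norm (h \<xi>))\<^sup>2) (N \<xi>)) \<partial>lborel)) \<partial>lborel) =
      (\<integral>\<^sup>+R. P * (\<integral>\<^sup>+\<xi>. w R * indicator {1..} R * ennreal (tail_weight R (bracket_sq \<xi>) ((norm (h \<xi>))\<^sup>2) (N \<xi>)) \<partial>lborel) \<partial>lborel)"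
      by (intro nn_integral_cong, subst nn_integral_cmult) (auto simp: mult_ac tail_weight_def)
    also have "\<dots> = P * (\<integral>\<^sup>+R. (\<integral>\<^sup>+\<xi>. w R * indicator {1..} R * ennreal (tail_weight R (bracket_sq \<xi>) ((norm (h \<xi>))\<^sup>2) (N \<xi>)) \<partial>lborel) \<partial>lborel)"
      by (rule nn_integral_cmult) (simp add: tail_weight_def)
    also have "\<dots> = P * (\<integral>\<^sup>+R. \<integral>\<^sup>+\<xi>. ennreal (2 * a * R powr (2 * a - 1) * tail_weight R (bracket_sq \<xi>) ((norm (h \<xi>))\<^sup>2) (N \<xi>)) * indicator {1..} R \<partial>lborel \<partial>lborel)"
      using a by (intro arg_cong[where f = "(*) P"] nn_integral_cong)
        (simp add: w_def ennreal_mult tail_weight_nonneg N0 mult_ac)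
    finally show ?thesis .
  qed
  also have "(\<integral>\<^sup>+R. \<integral>\<^sup>+\<xi>. ennreal (2 * a * R powr (2 * a - 1) * tail_weight R (bracket_sq \<xi>) ((norm (h \<xi>))\<^sup>2) (N \<xi>)) * indicator {1..} R \<partial>lborel \<partial>lborel) =
     (\<integral>\<^sup>+\<xi>. \<integral>\<^sup>+R. ennreal (2 * a * R powr (2 * a - 1) * tail_weight R (bracket_sq \<xi>) ((norm (h \<xi>))\<^sup>2) (N \<xi>)) * indicator {1..} R \<partial>lborel \<partial>lborel)"
    unfolding tail_weight_def by (rule lborel_pair.Fubini') measurable
  also have "\<dots> \<le> (\<integral>\<^sup>+\<xi>. ennreal (74 * ?E \<xi>) \<partial>lborel)"
    by (intro nn_integral_mono order_trans[OF nn_integral_tail_weight]) (use a N0 in \<open>auto simp: N_def\<close>)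
  also have "\<dots> = 74 * (\<integral>\<^sup>+\<xi>. ennreal (?E \<xi>) \<partial>lborel)"
    using N0 by (subst nn_integral_cmult[symmetric]) (auto simp: ennreal_mult N_def[symmetric])
  finally have main: "(\<integral>\<^sup>+x. ennreal (norm x powr (2 * a)) * g x \<partial>lborel) \<le> (\<integral>\<^sup>+x. g x \<partial>lborel) + P * (74 * (\<integral>\<^sup>+\<xi>. ennreal (?E \<xi>) \<partial>lborel))"
    by (simp add: mult_left_mono)
  have "(\<integral>\<^sup>+x. ennreal (((norm x powr a + 1) * norm (\<integral>\<xi>. cis (x \<bullet> \<xi>) * h \<xi> \<partial>lborel))\<^sup>2) \<partial>lborel) \<le>
      (\<integral>\<^sup>+x. 2 * (ennreal (norm x powr (2 * a)) * g x) + 2 * g x \<partial>lborel)"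
  proof (rule nn_integral_mono)
    fix x :: 'a
    let ?G = "norm (\<integral>\<xi>. cis (x \<bullet> \<xi>) * h \<xi> \<partial>lborel)"
    have "(norm x powr a + 1)\<^sup>2 \<le> 2 * (norm x powr a)\<^sup>2 + 2"
      using sum_squares_bound[of "norm x powr a" 1] by (simp add: power2_sum)
    also have "(norm x powr a)\<^sup>2 = norm x powr (2 * a)"
      by (simp add: power2_eq_square powr_add[symmetric])
    finally have "((norm x powr a + 1) * ?G)\<^sup>2 \<le> (2 * norm x powr (2 * a) + 2) * ?G\<^sup>2"
      by (simp add: power_mult_distrib mult_right_mono)
    then have "ennreal (((norm x powr a + 1) * ?G)\<^sup>2) \<le> ennreal (2 * (norm x powr (2 * a) * ?G\<^sup>2) + 2 * ?G\<^sup>2)"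
      by (intro ennreal_leI) (simp add: algebra_simps)
    also have "\<dots> = 2 * (ennreal (norm x powr (2 * a)) * g x) + 2 * g x"
      by (simp add: g_def ennreal_mult)
    finally show "ennreal (((norm x powr a + 1) * ?G)\<^sup>2) \<le> 2 * (ennreal (norm x powr (2 * a)) * g x) + 2 * g x" .
  qed
  also have "\<dots> = 2 * (\<integral>\<^sup>+x. ennreal (norm x powr (2 * a)) * g x \<partial>lborel) + 2 * (\<integral>\<^sup>+x. g x \<partial>lborel)"
    by (simp add: nn_integral_add nn_integral_cmult)
  also have "\<dots> \<le> 2 * (P * (\<integral>\<^sup>+\<xi>. ennreal (?E \<xi>) \<partial>lborel) + P * (74 * (\<integral>\<^sup>+\<xi>. ennreal (?E \<xi>) \<partial>lborel))) + 2 * (P * (\<integral>\<^sup>+\<xi>. ennreal (?E \<xi>) \<partial>lborel))"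
    by (intro add_mono mult_left_mono g_int order_trans[OF main] order_refl) auto
  also have "\<dots> = 152 * (P * (\<integral>\<^sup>+\<xi>. ennreal (?E \<xi>) \<partial>lborel))"
  proof -
    have "2 * (p + 74 * p) + 2 * p = 152 * p" for p :: ennreal
      by (simp add: distrib_left mult.assoc[symmetric] flip: distrib_right)
    then show ?thesis by (simp add: mult.left_commute[of P])
  qed
  finally show ?thesis by (simp add: P_def ennreal_mult mult.assoc)
qed

section \<open>Local smoothing\<close>

text \<open>Lebesgue measure is determined by its values on boxes, and an involution of the basis
  maps boxes to boxes with the same side lengths.\<close>

lemma distr_lborel_permute_Basis:
  fixes T :: "'a::euclidean_space \<Rightarrow> 'a"
  assumes T [measurable]: "T \<in> borel_measurable borel"
    and \<pi>: "\<And>c. c \<in> Basis \<Longrightarrow> \<pi> c \<in> Basis" "\<And>c. c \<in> Basis \<Longrightarrow> \<pi> (\<pi> c) = c"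
    and Tc: "\<And>z c. c \<in> Basis \<Longrightarrow> T z \<bullet> c = z \<bullet> \<pi> c"
  shows "distr lborel borel T = lborel"
proof (rule lborel_eqI[symmetric])
  fix l u :: 'a
  assume lu: "\<And>b. b \<in> Basis \<Longrightarrow> l \<bullet> b \<le> u \<bullet> b"
  have "T -` box l u = box (T l) (T u)"
  proof (rule set_eqI)
    fix z
    have "z \<in> T -` box l u \<longleftrightarrow> (\<forall>c\<in>Basis. l \<bullet> c < z \<bullet> \<pi> c \<and> z \<bullet> \<pi> c < u \<bullet> c)"
      by (simp add: mem_box Tc)
    also have "\<dots> \<longleftrightarrow> (\<forall>c\<in>Basis. l \<bullet> \<pi> c < z \<bullet> c \<and> z \<bullet> c < u \<bullet> \<pi> c)"
      using \<pi> by (metis (no_types, lifting))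
    also have "\<dots> \<longleftrightarrow> z \<in> box (T l) (T u)"
      by (simp add: mem_box Tc)
    finally show "z \<in> T -` box l u \<longleftrightarrow> z \<in> box (T l) (T u)" .
  qed
  then have "emeasure (distr lborel borel T) (box l u) = emeasure lborel (box (T l) (T u))"
    by (simp add: emeasure_distr)
  also have "\<dots> = ennreal (\<Prod>c\<in>Basis. (T u - T l) \<bullet> c)"
    by (rule emeasure_lborel_box) (simp add: Tc \<pi> lu)
  also have "(\<Prod>c\<in>Basis. (T u - T l) \<bullet> c) = (\<Prod>c\<in>Basis. (u - l) \<bullet> c)"
    by (rule prod.reindex_bij_witness[of _ \<pi> \<pi>]) (auto simp: Tc \<pi> inner_diff_left)
  finally show "emeasure (distr lborel borel T) (box l u) = ennreal (\<Prod>c\<in>Basis. (u - l) \<bullet> c)" .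
qed simp

text \<open>Exchanging time with the coordinate \<open>x\<^sub>b\<close> makes the frozen variable the first component, and the
  Plancherel inequality on the same type applies to the second one.\<close>

definition swap_coord :: "'a::euclidean_space \<Rightarrow> real \<times> 'a \<Rightarrow> real \<times> 'a" where
  "swap_coord b z = (snd z \<bullet> b, snd z + (fst z - snd z \<bullet> b) *\<^sub>R b)"

lemma swap_coord_measurable [measurable]: "swap_coord b \<in> borel_measurable borel"
  unfolding swap_coord_def[abs_def] by (intro borel_measurable_continuous_onI continuous_intros)

lemma distr_lborel_swap_coord:
  fixes b :: "'a::euclidean_space"
  assumes b: "b \<in> Basis"
  shows "distr lborel borel (swap_coord b) = lborel"
proof (rule distr_lborel_permute_Basis)
  let ?\<pi> = "\<lambda>c::real \<times> 'a. if c = (1, 0) then (0, b) else if c = (0, b) then (1, 0) else c"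
  have b0: "b \<noteq> 0" using b by auto
  show "?\<pi> c \<in> Basis" if "c \<in> Basis" for c using that b by (auto simp: Basis_prod_def)
  show "?\<pi> (?\<pi> c) = c" if "c \<in> Basis" for c using b0 by auto
  show "swap_coord b z \<bullet> c = z \<bullet> ?\<pi> c" if "c \<in> Basis" for z c
    using that b b0 by (cases z) (auto simp: Basis_prod_def swap_coord_def inner_add_left inner_Basis)
qed simp

lemma nn_integral_swap_coord:
  fixes f :: "real \<times> 'a::euclidean_space \<Rightarrow> ennreal"
  assumes b: "b \<in> Basis" and [measurable]: "f \<in> borel_measurable borel"
  shows "(\<integral>\<^sup>+z. f (swap_coord b z) \<partial>lborel) = (\<integral>\<^sup>+z. f z \<partial>lborel)"
  by (subst (2) distr_lborel_swap_coord[OF b, symmetric]) (simp add: nn_integral_distr)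

text \<open>Tonelli in one coordinate of an abstract Euclidean space. A dummy variable in
  \<open>{0..1}\<close> is added, an interval of length 1, and exchanged with the coordinate along
  \<open>b\<close>. Afterwards the dummy sits in the \<open>b\<close>-slot of \<open>y\<close>, and
  the true coordinate \<open>a\<close> can be integrated by itself.\<close>

lemma nn_integral_lborel_line:
  fixes f :: "'a::euclidean_space \<Rightarrow> ennreal"
  assumes b: "b \<in> Basis" and f [measurable]: "f \<in> borel_measurable borel"
  shows "(\<integral>\<^sup>+x. f x \<partial>lborel) =
    (\<integral>\<^sup>+y. indicator {0..1} (y \<bullet> b) * (\<integral>\<^sup>+a. f (y + (a - y \<bullet> b) *\<^sub>R b) \<partial>lborel) \<partial>lborel)"
proof -
  let ?g = "\<lambda>z::real \<times> 'a. indicator {0..1} (fst z) * f (snd z)"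
  have g: "?g \<in> borel_measurable (lborel \<Otimes>\<^sub>M lborel)" by measurable
  then have gb: "?g \<in> borel_measurable borel" by (simp add: lborel_prod)
  have gs: "(\<lambda>z. ?g (swap_coord b z)) \<in> borel_measurable (lborel \<Otimes>\<^sub>M lborel)"
    using measurable_compose[OF swap_coord_measurable gb] by (simp add: lborel_prod)
  have "(\<integral>\<^sup>+x. f x \<partial>lborel) = (\<integral>\<^sup>+a. indicator {0..1} (a::real) * (\<integral>\<^sup>+x. f x \<partial>lborel) \<partial>lborel)"
    by (simp add: nn_integral_multc)
  also have "\<dots> = (\<integral>\<^sup>+a. \<integral>\<^sup>+x. ?g (a, x) \<partial>lborel \<partial>lborel)"
    by (simp add: nn_integral_cmult)
  also have "\<dots> = (\<integral>\<^sup>+z. ?g z \<partial>lborel)"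
    by (subst lborel.nn_integral_fst[OF g]) (simp add: lborel_prod)
  also have "\<dots> = (\<integral>\<^sup>+z. ?g (swap_coord b z) \<partial>lborel)"
    by (rule nn_integral_swap_coord[OF b gb, symmetric])
  also have "\<dots> = (\<integral>\<^sup>+y. \<integral>\<^sup>+a. ?g (swap_coord b (a, y)) \<partial>lborel \<partial>lborel)"
    using lborel_pair.nn_integral_snd[OF gs] by (simp add: lborel_prod)
  also have "\<dots> = (\<integral>\<^sup>+y. indicator {0..1} (y \<bullet> b) * (\<integral>\<^sup>+a. f (y + (a - y \<bullet> b) *\<^sub>R b) \<partial>lborel) \<partial>lborel)"
    by (simp add: swap_coord_def nn_integral_cmult)
  finally show ?thesis .
qed

text \<open>The substitution \<open>s = a\<^sup>2\<close> is made on each half-line; with its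
  Jacobian \<open>2 * a\<close> each half contributes at most half of the right side. Only arguments
  of \<open>f\<close> up to \<open>- k\<close> are reached, hence an inequality.\<close>

lemma nn_integral_square_substitution_le:
  fixes f :: "real \<Rightarrow> ennreal"
  assumes [measurable]: "f \<in> borel_measurable borel"
  shows "(\<integral>\<^sup>+a. ennreal \<bar>a\<bar> * f (- a\<^sup>2 - k) \<partial>lborel) \<le> (\<integral>\<^sup>+s. f s \<partial>lborel)"
proof -
  let ?F = "\<lambda>s. f (- s - k)"
  let ?h = "\<lambda>a. ennreal a * ?F (a\<^sup>2) * indicator {0..} a"
  have F: "(\<integral>\<^sup>+s. ?F s \<partial>lborel) = (\<integral>\<^sup>+s. f s \<partial>lborel)"
    using nn_integral_real_affine[of f "- 1" "- k"] by (simp add: algebra_simps)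
  have half: "2 * (\<integral>\<^sup>+a. ?h a \<partial>lborel) \<le> (\<integral>\<^sup>+s. f s \<partial>lborel)"
  proof -
    have "(\<integral>\<^sup>+a. 2 * ?h a \<partial>lborel) \<le> (\<integral>\<^sup>+s. f s \<partial>lborel)"
    proof (rule nn_integral_limit_le)
      let ?u = "\<lambda>n a. ?F (a\<^sup>2) * ennreal (2 * a) * indicator {0..real (Suc n)} a"
      show "?u n \<in> borel_measurable lborel" for n by measurable
      show "(\<lambda>n. ?u n a) \<longlonglongrightarrow> 2 * ?h a" for a
      proof (rule tendsto_eventually)
        obtain N where N: "a \<le> real N" using real_arch_simple by blast
        have "?u n a = 2 * ?h a" if "N \<le> n" for n
          using N that by (cases "0 \<le> a") (auto simp: ennreal_mult mult_ac)
        then show "\<forall>\<^sub>F n in sequentially. ?u n a = 2 * ?h a"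
          by (auto simp: eventually_sequentially)
      qed
      show "(\<integral>\<^sup>+a. ?u n a \<partial>lborel) \<le> (\<integral>\<^sup>+s. f s \<partial>lborel)" for n
      proof -
        have eq: "(\<integral>\<^sup>+s. ?F s * indicator {0\<^sup>2..(real (Suc n))\<^sup>2} s \<partial>lborel) = (\<integral>\<^sup>+a. ?u n a \<partial>lborel)"
          by (rule nn_integral_substitution_aux[where g = "\<lambda>x. x\<^sup>2" and g' = "\<lambda>x. 2 * x" and a = 0 and b = "real (Suc n)"])
             (auto intro!: derivative_eq_intros continuous_intros)
        have le: "(\<integral>\<^sup>+s. ?F s * indicator {0\<^sup>2..(real (Suc n))\<^sup>2} s \<partial>lborel) \<le> (\<integral>\<^sup>+s. ?F s \<partial>lborel)"
          by (intro nn_integral_mono) (auto simp: indicator_def)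
        show ?thesis using le unfolding eq F .
      qed
    qed
    then show ?thesis by (subst (asm) nn_integral_cmult) auto
  qed
  have neg: "(\<integral>\<^sup>+a. ?h (- a) \<partial>lborel) = (\<integral>\<^sup>+a. ?h a \<partial>lborel)"
    using nn_integral_real_affine[of ?h "- 1" 0] by simp
  have "(\<integral>\<^sup>+a. ennreal \<bar>a\<bar> * f (- a\<^sup>2 - k) \<partial>lborel) \<le> (\<integral>\<^sup>+a. ?h a + ?h (- a) \<partial>lborel)"
    by (intro nn_integral_mono) (auto simp: indicator_def abs_if)
  also have "\<dots> = 2 * (\<integral>\<^sup>+a. ?h a \<partial>lborel)"
    by (subst nn_integral_add, measurable) (simp only: neg mult_2)
  finally show ?thesis using half by (rule order_trans)
qed

text \<open>The argument of \<open>f\<close> is \<xi> with its \<open>b\<close>-coordinate replaced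
  by \<open>- (norm \<xi>)\<^sup>2\<close>. On a line parallel to \<open>b\<close> this coordinate
  is \<open>- a\<^sup>2 - k\<close>, where \<open>k\<close> is the squared norm of the other
  coordinates.\<close>

lemma nn_integral_parabola_substitution_le:
  fixes f :: "'a::euclidean_space \<Rightarrow> ennreal"
  assumes b: "b \<in> Basis" and [measurable]: "f \<in> borel_measurable borel"
  shows "(\<integral>\<^sup>+\<xi>. ennreal \<bar>\<xi> \<bullet> b\<bar> * f (\<xi> - ((norm \<xi>)\<^sup>2 + \<xi> \<bullet> b) *\<^sub>R b) \<partial>lborel) \<le> (\<integral>\<^sup>+\<xi>. f \<xi> \<partial>lborel)"
proof -
  have bb: "b \<bullet> b = 1" using b by (simp add: inner_Basis)
  have line: "ennreal \<bar>\<xi> \<bullet> b\<bar> * f (\<xi> - ((norm \<xi>)\<^sup>2 + \<xi> \<bullet> b) *\<^sub>R b) =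
      ennreal \<bar>a\<bar> * (\<lambda>s. f (y + (s - y \<bullet> b) *\<^sub>R b)) (- a\<^sup>2 - ((norm y)\<^sup>2 - (y \<bullet> b)\<^sup>2))"
    if \<xi>: "\<xi> = y + (a - y \<bullet> b) *\<^sub>R b" for a y \<xi>
  proof -
    have 1: "\<xi> \<bullet> b = a" by (simp add: \<xi> inner_add_left bb)
    have 2: "(norm \<xi>)\<^sup>2 = a\<^sup>2 + ((norm y)\<^sup>2 - (y \<bullet> b)\<^sup>2)"
      unfolding power2_norm_eq_inner \<xi>
      by (simp add: inner_add_left inner_add_right bb inner_commute[of b y] power2_eq_square algebra_simps)
    show ?thesis unfolding 1 2 by (simp add: \<xi> algebra_simps)
  qed
  have "(\<integral>\<^sup>+\<xi>. ennreal \<bar>\<xi> \<bullet> b\<bar> * f (\<xi> - ((norm \<xi>)\<^sup>2 + \<xi> \<bullet> b) *\<^sub>R b) \<partial>lborel) =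
    (\<integral>\<^sup>+y. indicator {0..1} (y \<bullet> b) * (\<integral>\<^sup>+a. ennreal \<bar>a\<bar> * (\<lambda>s. f (y + (s - y \<bullet> b) *\<^sub>R b)) (- a\<^sup>2 - ((norm y)\<^sup>2 - (y \<bullet> b)\<^sup>2)) \<partial>lborel) \<partial>lborel)"
    by (subst nn_integral_lborel_line[OF b]) (measurable, simp only: line[OF refl])
  also have "\<dots> \<le> (\<integral>\<^sup>+y. indicator {0..1} (y \<bullet> b) * (\<integral>\<^sup>+s. f (y + (s - y \<bullet> b) *\<^sub>R b) \<partial>lborel) \<partial>lborel)"
    by (intro nn_integral_mono mult_left_mono nn_integral_square_substitution_le) auto
  also have "\<dots> = (\<integral>\<^sup>+\<xi>. f \<xi> \<partial>lborel)"
    by (rule nn_integral_lborel_line[OF b, symmetric]) measurable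
  finally show ?thesis .
qed

text \<open>Conjugation reverses the sign of the phase. For a non-integrable \<open>h\<close> the
  left side is 0 by the default value of the integral, so measurability is all that has to be
  checked for the slices in the application.\<close>

lemma plancherel_neg_le:
  fixes h :: "'a::euclidean_space \<Rightarrow> complex"
  assumes [measurable]: "h \<in> borel_measurable borel"
  shows "(\<integral>\<^sup>+x. ennreal ((norm (\<integral>\<xi>. cis (- (x \<bullet> \<xi>)) * h \<xi> \<partial>lborel))\<^sup>2) \<partial>lborel)
    \<le> ennreal ((2 * pi) ^ DIM('a)) * (\<integral>\<^sup>+\<xi>. ennreal ((norm (h \<xi>))\<^sup>2) \<partial>lborel)"
proof (cases "integrable lborel h")
  case True
  have "norm (\<integral>\<xi>. cis (- (x \<bullet> \<xi>)) * h \<xi> \<partial>lborel) = norm (\<integral>\<xi>. cis (x \<bullet> \<xi>) * cnj (h \<xi>) \<partial>lborel)" for x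
  proof -
    have "(\<integral>\<xi>. cis (x \<bullet> \<xi>) * cnj (h \<xi>) \<partial>lborel) = (\<integral>\<xi>. cnj (cis (- (x \<bullet> \<xi>)) * h \<xi>) \<partial>lborel)"
      by (simp add: cis_cnj)
    also have "\<dots> = cnj (\<integral>\<xi>. cis (- (x \<bullet> \<xi>)) * h \<xi> \<partial>lborel)"
      by (rule Bochner_Integration.integral_cnj)
    finally show ?thesis by simp
  qed
  then show ?thesis
    using plancherel_le[OF integrable_cnj[OF True]] by simp
next
  case False
  then show ?thesis using integral_cis_mult_eq_0[of h "- _"] by simp
qed

section \<open>The Fourier transform restricted to the paraboloid\<close>

text \<open>The operator A of the overview. With \<open>z = (t, x)\<close> the phase joins the
  multiplier of the Schroedinger group to the spatial transform, so a single space-time integral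
  replaces an iterated one.\<close>

definition paraboloid_fourier :: "(real \<times> 'a::euclidean_space \<Rightarrow> complex) \<Rightarrow> 'a \<Rightarrow> complex" where
  "paraboloid_fourier F \<xi> = (\<integral>z. cis (fst z * (norm \<xi>)\<^sup>2 - snd z \<bullet> \<xi>) * F z \<partial>lborel)"

lemma paraboloid_phase_measurable [measurable]:
  "(\<lambda>z. cis (fst z * (norm \<xi>)\<^sup>2 - snd z \<bullet> \<xi>)) \<in> borel_measurable borel"
  by (intro borel_measurable_continuous_onI continuous_intros)

lemma paraboloid_fourier_integrable:
  assumes "integrable lborel F"
  shows "integrable lborel (\<lambda>z. cis (fst z * (norm \<xi>)\<^sup>2 - snd z \<bullet> \<xi>) * F z)"
  by (rule Bochner_Integration.integrable_bound[OF assms])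
     (use assms in \<open>auto simp: norm_mult\<close>)

lemma continuous_on_paraboloid_fourier:
  fixes F :: "real \<times> 'a::euclidean_space \<Rightarrow> complex"
  assumes F: "integrable lborel F"
  shows "continuous_on UNIV (paraboloid_fourier F)"
proof -
  have [measurable]: "F \<in> borel_measurable borel" using F by simp
  have "(\<lambda>n. paraboloid_fourier F (x n)) \<longlonglongrightarrow> paraboloid_fourier F l" if x: "x \<longlonglongrightarrow> l" for x :: "nat \<Rightarrow> 'a" and l
    unfolding paraboloid_fourier_def
  proof (rule integral_dominated_convergence)
    show "integrable lborel (\<lambda>z. norm (F z))" using F by simp
    show "AE z in lborel. (\<lambda>n. cis (fst z * (norm (x n))\<^sup>2 - snd z \<bullet> x n) * F z) \<longlonglongrightarrow> cis (fst z * (norm l)\<^sup>2 - snd z \<bullet> l) * F z"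
    proof (intro AE_I2 tendsto_mult tendsto_const)
      fix z :: "real \<times> 'a"
      have "(\<lambda>n. fst z * (norm (x n))\<^sup>2 - snd z \<bullet> x n) \<longlonglongrightarrow> fst z * (norm l)\<^sup>2 - snd z \<bullet> l"
        by (intro tendsto_intros x)
      moreover have "continuous_on UNIV cis" by (intro continuous_intros)
      ultimately show "(\<lambda>n. cis (fst z * (norm (x n))\<^sup>2 - snd z \<bullet> x n)) \<longlonglongrightarrow> cis (fst z * (norm l)\<^sup>2 - snd z \<bullet> l)"
        using continuous_on_tendsto_compose[of UNIV cis] by auto
    qed
  qed (auto simp: norm_mult)
  then show ?thesis
    by (auto simp: continuous_on_sequentially o_def)
qed

lemma paraboloid_fourier_measurable:
  "integrable lborel F \<Longrightarrow> paraboloid_fourier F \<in> borel_measurable borel"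
  by (intro borel_measurable_continuous_onI continuous_on_paraboloid_fourier)

lemma paraboloid_fourier_le: "ennreal (norm (paraboloid_fourier F \<xi>)) \<le> (\<integral>\<^sup>+z. ennreal (norm (F z)) \<partial>lborel)"
  unfolding paraboloid_fourier_def
  by (rule order_trans[OF ennreal_norm_integral_le]) (simp add: norm_mult)

lemma local_smoothing_direction:
  fixes F :: "real \<times> 'a::euclidean_space \<Rightarrow> complex"
  assumes b: "b \<in> Basis" and F: "integrable lborel F" and L: "0 \<le> L"
    and supp: "\<And>z. L < \<bar>snd z \<bullet> b\<bar> \<Longrightarrow> F z = 0"
  shows "(\<integral>\<^sup>+\<xi>. ennreal \<bar>\<xi> \<bullet> b\<bar> * ennreal ((norm (paraboloid_fourier F \<xi>))\<^sup>2) \<partial>lborel) \<le>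
    ennreal (2 * L * (2 * pi) ^ DIM('a)) * (\<integral>\<^sup>+z. ennreal ((norm (F z))\<^sup>2) \<partial>lborel)"
proof -
  have bb: "b \<bullet> b = 1" using b by (simp add: inner_Basis)
  have [measurable]: "F \<in> borel_measurable borel" using F by simp
  define G where "G a y = F (swap_coord b (a, y))" for a y
  define E where "E a \<eta> = (\<integral>y. cis (- (\<eta> \<bullet> y)) * G a y \<partial>lborel)" for a \<eta>
  define N where "N a \<eta> = ennreal ((norm (E a \<eta>))\<^sup>2)" for a \<eta>
  define \<Psi> where "\<Psi> \<xi> = \<xi> - ((norm \<xi>)\<^sup>2 + \<xi> \<bullet> b) *\<^sub>R b" for \<xi> :: 'a
  have [measurable]: "\<Psi> \<in> borel_measurable borel" unfolding \<Psi>_def[abs_def] by measurable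
  have swap_meas: "(\<lambda>z. f (swap_coord b z)) \<in> borel_measurable (lborel \<Otimes>\<^sub>M lborel)"
    if "f \<in> borel_measurable borel" for f :: "real \<times> 'a \<Rightarrow> complex"
    using measurable_compose[OF swap_coord_measurable that] by (simp add: lborel_prod)
  have G_meas: "(\<lambda>z. G (fst z) (snd z)) \<in> borel_measurable (lborel \<Otimes>\<^sub>M lborel)"
    using swap_meas[of F] by (simp add: G_def)
  then have [measurable]: "(\<lambda>z. G (fst z) (snd z)) \<in> borel_measurable (borel \<Otimes>\<^sub>M borel)"
    by (simp cong: measurable_cong_sets)
  have [measurable]: "G a \<in> borel_measurable borel" for a
    using measurable_compose[OF measurable_Pair1' G_meas, of a] by simp
  have [measurable]: "(\<lambda>x. G (fst (fst x)) (snd x)) \<in> borel_measurable ((borel \<Otimes>\<^sub>M borel) \<Otimes>\<^sub>M borel)"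
    using measurable_compose[OF _ G_meas, of "\<lambda>x. (fst (fst x), snd x)" "(borel \<Otimes>\<^sub>M borel) \<Otimes>\<^sub>M borel"] by simp
  have E_meas: "(\<lambda>p. E (fst p) (snd p)) \<in> borel_measurable (lborel \<Otimes>\<^sub>M lborel)"
    unfolding E_def by (rule lborel.borel_measurable_lebesgue_integral) measurable
  then have [measurable]: "(\<lambda>p. E (fst p) (snd p)) \<in> borel_measurable (borel \<Otimes>\<^sub>M borel)"
    by (simp cong: measurable_cong_sets)
  have rep: "paraboloid_fourier F \<xi> = (\<integral>a. cis (- (a * (\<xi> \<bullet> b))) * E a (\<Psi> \<xi>) \<partial>lborel)" for \<xi>
  proof -
    let ?f = "\<lambda>z. cis (fst z * (norm \<xi>)\<^sup>2 - snd z \<bullet> \<xi>) * F z"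
    have f: "integrable lborel ?f" by (rule paraboloid_fourier_integrable[OF F])
    then have fm [measurable]: "?f \<in> borel_measurable borel" by simp
    have eq: "?f (swap_coord b (a, y)) = cis (- (a * (\<xi> \<bullet> b))) * (cis (- (\<Psi> \<xi> \<bullet> y)) * G a y)" for a y
    proof -
      have "fst (swap_coord b (a, y)) * (norm \<xi>)\<^sup>2 - snd (swap_coord b (a, y)) \<bullet> \<xi> = - (a * (\<xi> \<bullet> b)) + - (\<Psi> \<xi> \<bullet> y)"
        by (simp add: swap_coord_def \<Psi>_def inner_add_left inner_diff_left inner_commute[of b] inner_commute[of y \<xi>] algebra_simps)
      then show ?thesis by (simp only: cis_mult[symmetric] G_def mult.assoc)
    qed
    have "integrable (distr lborel borel (swap_coord b)) ?f"
      using f by (simp add: distr_lborel_swap_coord[OF b])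
    then have "integrable lborel (\<lambda>z. ?f (swap_coord b z))"
      by (subst (asm) integrable_distr_eq) auto
    then have i: "integrable (lborel \<Otimes>\<^sub>M lborel) (\<lambda>z. ?f (swap_coord b z))"
      by (simp only: lborel_prod)
    have "paraboloid_fourier F \<xi> = (\<integral>z. ?f z \<partial>distr lborel borel (swap_coord b))"
      by (simp add: distr_lborel_swap_coord[OF b] paraboloid_fourier_def)
    also have "\<dots> = (\<integral>z. ?f (swap_coord b z) \<partial>(lborel \<Otimes>\<^sub>M lborel))"
      by (subst integral_distr) (auto simp: lborel_prod)
    also have "\<dots> = (\<integral>a. \<integral>y. ?f (swap_coord b (a, y)) \<partial>lborel \<partial>lborel)"
      by (rule lborel_pair.integral_fst'[OF i, symmetric])
    also have "\<dots> = (\<integral>a. cis (- (a * (\<xi> \<bullet> b))) * E a (\<Psi> \<xi>) \<partial>lborel)"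
      unfolding eq by (simp add: E_def)
    finally show ?thesis .
  qed
  have E0: "E a \<eta> = 0" if "L < \<bar>a\<bar>" for a \<eta>
  proof -
    have "snd (swap_coord b (a, y)) \<bullet> b = a" for y
      by (simp add: swap_coord_def inner_add_left bb)
    then have "G a y = 0" for y
      unfolding G_def using that by (intro supp) simp
    then show ?thesis by (simp add: E_def)
  qed
  \<comment> \<open>Cauchy-Schwarz in \<open>a\<close> alone: the phase in \<open>a\<close> has norm
    1 and drops out, so that \<xi> remains only through \<open>\<Psi> \<xi>\<close>.\<close>
  have cs: "ennreal ((norm (paraboloid_fourier F \<xi>))\<^sup>2) \<le> ennreal (2 * L) * (\<integral>\<^sup>+a. N a (\<Psi> \<xi>) \<partial>lborel)" for \<xi>
  proof -
    have [measurable]: "(\<lambda>a. E a (\<Psi> \<xi>)) \<in> borel_measurable borel"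
      using measurable_compose[OF measurable_Pair2' E_meas, of "\<Psi> \<xi>"] by simp
    have "ennreal (norm (paraboloid_fourier F \<xi>)) \<le> (\<integral>\<^sup>+a. ennreal (norm (cis (- (a * (\<xi> \<bullet> b))) * E a (\<Psi> \<xi>))) \<partial>lborel)"
      unfolding rep by (rule ennreal_norm_integral_le)
    also have "\<dots> = (\<integral>\<^sup>+a. indicator {-L..L} a * ennreal (norm (E a (\<Psi> \<xi>))) \<partial>lborel)"
      by (intro nn_integral_cong) (auto simp: norm_mult indicator_def E0 abs_le_iff not_le)
    finally have "(ennreal (norm (paraboloid_fourier F \<xi>)))\<^sup>2 \<le> (\<integral>\<^sup>+a. indicator {-L..L} a * ennreal (norm (E a (\<Psi> \<xi>))) \<partial>lborel)\<^sup>2"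
      by (rule power_mono) simp
    also have "\<dots> \<le> (\<integral>\<^sup>+a. (indicator {-L..L} a)\<^sup>2 \<partial>lborel) * (\<integral>\<^sup>+a. (ennreal (norm (E a (\<Psi> \<xi>))))\<^sup>2 \<partial>lborel)"
      by (rule Cauchy_Schwarz_nn_integral) measurable
    also have "(\<integral>\<^sup>+a. (indicator {-L..L} a)\<^sup>2 \<partial>lborel) = (\<integral>\<^sup>+a. indicator {-L..L} a \<partial>lborel)"
      by (intro nn_integral_cong) (simp add: indicator_def)
    also have "\<dots> = ennreal (2 * L)" using L by simp
    finally show ?thesis by (simp add: ennreal_power N_def)
  qed
  have N_meas [measurable]: "(\<lambda>p. N (fst p) (snd p)) \<in> borel_measurable (borel \<Otimes>\<^sub>M borel)"
    unfolding N_def by measurable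
  have NPsi [measurable]: "(\<lambda>p. N (fst p) (\<Psi> (snd p))) \<in> borel_measurable (borel \<Otimes>\<^sub>M borel)"
    using measurable_compose[OF _ N_meas, of "\<lambda>p. (fst p, \<Psi> (snd p))" "borel \<Otimes>\<^sub>M borel"] by simp
  have NPsi' [measurable]: "(\<lambda>p. N (snd p) (\<Psi> (fst p))) \<in> borel_measurable (borel \<Otimes>\<^sub>M borel)"
    using measurable_compose[OF _ N_meas, of "\<lambda>p. (snd p, \<Psi> (fst p))" "borel \<Otimes>\<^sub>M borel"] by simp
  have Na [measurable]: "N a \<in> borel_measurable borel" for a
    using measurable_compose[OF measurable_Pair1' N_meas, of a] by simp
  have Nx [measurable]: "(\<lambda>a. N a \<eta>) \<in> borel_measurable borel" for \<eta>
    using measurable_compose[OF measurable_Pair2' N_meas, of \<eta>] by simp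
  have "(\<integral>\<^sup>+\<xi>. ennreal \<bar>\<xi> \<bullet> b\<bar> * ennreal ((norm (paraboloid_fourier F \<xi>))\<^sup>2) \<partial>lborel) \<le>
      (\<integral>\<^sup>+\<xi>. ennreal \<bar>\<xi> \<bullet> b\<bar> * (ennreal (2 * L) * (\<integral>\<^sup>+a. N a (\<Psi> \<xi>) \<partial>lborel)) \<partial>lborel)"
    by (intro nn_integral_mono mult_left_mono cs) auto
  also have "\<dots> = (\<integral>\<^sup>+\<xi>. ennreal (2 * L) * (\<integral>\<^sup>+a. ennreal \<bar>\<xi> \<bullet> b\<bar> * N a (\<Psi> \<xi>) \<partial>lborel) \<partial>lborel)"
    by (intro nn_integral_cong, subst nn_integral_cmult, measurable, simp add: mult_ac)
  also have "\<dots> = ennreal (2 * L) * (\<integral>\<^sup>+\<xi>. \<integral>\<^sup>+a. ennreal \<bar>\<xi> \<bullet> b\<bar> * N a (\<Psi> \<xi>) \<partial>lborel \<partial>lborel)"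
    by (rule nn_integral_cmult) measurable
  also have "(\<integral>\<^sup>+\<xi>. \<integral>\<^sup>+a. ennreal \<bar>\<xi> \<bullet> b\<bar> * N a (\<Psi> \<xi>) \<partial>lborel \<partial>lborel) =
      (\<integral>\<^sup>+a. \<integral>\<^sup>+\<xi>. ennreal \<bar>\<xi> \<bullet> b\<bar> * N a (\<Psi> \<xi>) \<partial>lborel \<partial>lborel)"
    by (rule lborel_pair.Fubini') measurable
  also have "\<dots> \<le> (\<integral>\<^sup>+a. \<integral>\<^sup>+\<eta>. N a \<eta> \<partial>lborel \<partial>lborel)"
    unfolding \<Psi>_def by (intro nn_integral_mono nn_integral_parabola_substitution_le b) measurable
  also have "\<dots> \<le> (\<integral>\<^sup>+a. ennreal ((2 * pi) ^ DIM('a)) * (\<integral>\<^sup>+y. ennreal ((norm (G a y))\<^sup>2) \<partial>lborel) \<partial>lborel)"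
    unfolding N_def E_def by (intro nn_integral_mono plancherel_neg_le) measurable
  also have "\<dots> = ennreal ((2 * pi) ^ DIM('a)) * (\<integral>\<^sup>+a. \<integral>\<^sup>+y. ennreal ((norm (G a y))\<^sup>2) \<partial>lborel \<partial>lborel)"
    by (rule nn_integral_cmult) measurable
  also have "(\<integral>\<^sup>+a. \<integral>\<^sup>+y. ennreal ((norm (G a y))\<^sup>2) \<partial>lborel \<partial>lborel) =
      (\<integral>\<^sup>+z. ennreal ((norm (G (fst z) (snd z)))\<^sup>2) \<partial>(lborel \<Otimes>\<^sub>M lborel))"
    by (subst lborel.nn_integral_fst[symmetric]) auto
  also have "\<dots> = (\<integral>\<^sup>+z. ennreal ((norm (F (swap_coord b z)))\<^sup>2) \<partial>lborel)"
    by (simp add: G_def lborel_prod)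
  also have "\<dots> = (\<integral>\<^sup>+z. ennreal ((norm (F z))\<^sup>2) \<partial>lborel)"
    by (rule nn_integral_swap_coord[OF b]) measurable
  finally show ?thesis
    using L by (simp add: ennreal_mult mult.assoc mult_left_mono)
qed

lemma nn_integral_sq_le_support:
  fixes F :: "'a::euclidean_space \<Rightarrow> complex"
  assumes [measurable]: "F \<in> borel_measurable borel" and supp: "\<And>z. L < norm z \<Longrightarrow> F z = 0"
  shows "(\<integral>\<^sup>+z. ennreal (norm (F z)) \<partial>lborel)\<^sup>2 \<le> emeasure lborel (cball (0::'a) L) * (\<integral>\<^sup>+z. ennreal ((norm (F z))\<^sup>2) \<partial>lborel)"
proof -
  have "(\<integral>\<^sup>+z. ennreal (norm (F z)) \<partial>lborel)\<^sup>2 = (\<integral>\<^sup>+z. indicator (cball 0 L) z * ennreal (norm (F z)) \<partial>lborel)\<^sup>2"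
    by (intro arg_cong[where f = "\<lambda>x. x\<^sup>2"] nn_integral_cong) (auto simp: indicator_def supp)
  also have "\<dots> \<le> (\<integral>\<^sup>+z. (indicator (cball 0 L) z)\<^sup>2 \<partial>(lborel :: 'a measure)) * (\<integral>\<^sup>+z. (ennreal (norm (F z)))\<^sup>2 \<partial>lborel)"
    by (rule Cauchy_Schwarz_nn_integral) (auto intro!: borel_measurable_indicator)
  also have "(\<integral>\<^sup>+z. (indicator (cball 0 L) z)\<^sup>2 \<partial>(lborel :: 'a measure)) = emeasure lborel (cball (0::'a) L)"
  proof -
    have "(\<lambda>z. (indicator (cball 0 L) z)\<^sup>2) = (indicator (cball (0::'a) L) :: 'a \<Rightarrow> ennreal)"
      by (auto simp: indicator_def fun_eq_iff)
    then show ?thesis by simp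
  qed
  finally show ?thesis by (simp add: ennreal_power)
qed

text \<open>The directional weights degenerate for small \<xi>, so the unit ball is handled by the
  pointwise bound of A F, with Cauchy-Schwarz on the support of F. Outside it the bracket is at most
  \<open>2 * norm \<xi>\<close>, hence at most twice the sum of the directional weights. The
  constant is fixed before \<open>F\<close>.\<close>

lemma local_smoothing:
  assumes L: "0 \<le> L"
  obtains C where "0 \<le> C" and
    "\<And>F :: real \<times> 'a::euclidean_space \<Rightarrow> complex. integrable lborel F \<Longrightarrow> (\<And>z. L < norm z \<Longrightarrow> F z = 0) \<Longrightarrow>
      (\<integral>\<^sup>+\<xi>. ennreal (bracket_sq \<xi> powr (1/2)) * ennreal ((norm (paraboloid_fourier F \<xi>))\<^sup>2) \<partial>lborel) \<le>
      ennreal C * (\<integral>\<^sup>+z. ennreal ((norm (F z))\<^sup>2) \<partial>lborel)"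
proof
  define v1 where "v1 = measure lborel (cball (0::'a) 1)"
  define vL where "vL = measure lborel (cball (0::real \<times> 'a) L)"
  have v: "emeasure lborel (cball (0::'a) 1) = ennreal v1" "emeasure lborel (cball (0::real \<times> 'a) L) = ennreal vL"
    unfolding v1_def vL_def by (intro emeasure_eq_ennreal_measure; use emeasure_bounded_finite[OF bounded_cball] in \<open>auto simp: top_unique less_top\<close>)+
  have v0: "0 \<le> v1" "0 \<le> vL" by (simp_all add: v1_def vL_def)
  define K where "K = 2 * L * (2 * pi) ^ DIM('a)"
  have K0: "0 \<le> K" using L by (simp add: K_def)
  show "0 \<le> 2 * (v1 * vL) + 2 * (real DIM('a) * K)" using v0 K0 by simp
  fix F :: "real \<times> 'a \<Rightarrow> complex"
  assume F: "integrable lborel F" and supp: "\<And>z. L < norm z \<Longrightarrow> F z = 0"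
  have [measurable]: "F \<in> borel_measurable borel" using F by simp
  have [measurable]: "paraboloid_fourier F \<in> borel_measurable borel" by (rule paraboloid_fourier_measurable[OF F])
  let ?A = "\<lambda>\<xi>. ennreal ((norm (paraboloid_fourier F \<xi>))\<^sup>2)"
  let ?I = "\<integral>\<^sup>+z. ennreal ((norm (F z))\<^sup>2) \<partial>lborel"
  have A: "?A \<xi> \<le> ennreal vL * ?I" for \<xi>
  proof -
    have "?A \<xi> = (ennreal (norm (paraboloid_fourier F \<xi>)))\<^sup>2" by (simp add: ennreal_power)
    also have "\<dots> \<le> (\<integral>\<^sup>+z. ennreal (norm (F z)) \<partial>lborel)\<^sup>2"
      by (intro power_mono paraboloid_fourier_le) simp
    also have "\<dots> \<le> ennreal vL * ?I"
      unfolding v(2)[symmetric] by (intro nn_integral_sq_le_support supp) auto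
    finally show ?thesis .
  qed
  have "(\<integral>\<^sup>+\<xi>. ennreal (bracket_sq \<xi> powr (1/2)) * ?A \<xi> \<partial>lborel) \<le>
     (\<integral>\<^sup>+\<xi>. 2 * (ennreal vL * ?I * indicator (cball 0 1) \<xi>) + 2 * (\<Sum>b\<in>Basis. ennreal \<bar>\<xi> \<bullet> b\<bar> * ?A \<xi>) \<partial>lborel)"
  proof (rule nn_integral_mono)
    fix \<xi> :: 'a
    show "ennreal (bracket_sq \<xi> powr (1/2)) * ?A \<xi> \<le>
      2 * (ennreal vL * ?I * indicator (cball 0 1) \<xi>) + 2 * (\<Sum>b\<in>Basis. ennreal \<bar>\<xi> \<bullet> b\<bar> * ?A \<xi>)"
    proof (cases "norm \<xi> \<le> 1")
      case True
      have "bracket_sq \<xi> powr (1/2) \<le> 2"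
        using True power_le_one[of "norm \<xi>" 2]
        by (simp add: powr_half_sqrt less_imp_le bracket_sq_def real_le_lsqrt)
      then have "ennreal (bracket_sq \<xi> powr (1/2)) * ?A \<xi> \<le> ennreal 2 * (ennreal vL * ?I)"
        by (intro mult_mono A ennreal_leI) auto
      also have "\<dots> \<le> 2 * (ennreal vL * ?I * indicator (cball 0 1) \<xi>) + 2 * (\<Sum>b\<in>Basis. ennreal \<bar>\<xi> \<bullet> b\<bar> * ?A \<xi>)"
        using True by simp
      finally show ?thesis .
    next
      case False
      have "bracket_sq \<xi> \<le> (2 * norm \<xi>)\<^sup>2"
      proof -
        have "1 \<le> (norm \<xi>)\<^sup>2" using False by (intro one_le_power) simp
        then show ?thesis by (simp add: bracket_sq_def power_mult_distrib)
      qed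
      then have "bracket_sq \<xi> powr (1/2) \<le> 2 * norm \<xi>"
        by (simp add: powr_half_sqrt less_imp_le real_le_lsqrt)
      also have "\<dots> \<le> 2 * (\<Sum>b\<in>Basis. \<bar>\<xi> \<bullet> b\<bar>)"
        using norm_le_l1[of \<xi>] by simp
      finally have "ennreal (bracket_sq \<xi> powr (1/2)) * ?A \<xi> \<le> ennreal (2 * (\<Sum>b\<in>Basis. \<bar>\<xi> \<bullet> b\<bar>)) * ?A \<xi>"
        by (intro mult_right_mono ennreal_leI) auto
      also have "\<dots> = 2 * (\<Sum>b\<in>Basis. ennreal \<bar>\<xi> \<bullet> b\<bar> * ?A \<xi>)"
        by (simp add: ennreal_mult sum_nonneg sum_distrib_right[symmetric] mult.assoc)
      also have "\<dots> \<le> 2 * (ennreal vL * ?I * indicator (cball 0 1) \<xi>) + 2 * (\<Sum>b\<in>Basis. ennreal \<bar>\<xi> \<bullet> b\<bar> * ?A \<xi>)"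
        by simp
      finally show ?thesis .
    qed
  qed
  also have "\<dots> = 2 * (ennreal vL * ?I * ennreal v1) + 2 * (\<Sum>b\<in>Basis. \<integral>\<^sup>+\<xi>. ennreal \<bar>\<xi> \<bullet> b\<bar> * ?A \<xi> \<partial>lborel)"
  proof -
    have [measurable]: "cball (0::'a) 1 \<in> sets borel" by simp
    show ?thesis
      by (subst nn_integral_add, measurable)
        (simp add: nn_integral_cmult nn_integral_sum nn_integral_cmult_indicator v del: sum_ennreal)
  qed
  also have "\<dots> \<le> 2 * (ennreal vL * ?I * ennreal v1) + 2 * (\<Sum>b\<in>(Basis::'a set). ennreal K * ?I)"
    unfolding K_def
  proof (intro add_mono mult_left_mono sum_mono local_smoothing_direction F L order_refl)
    fix b :: 'a and z :: "real \<times> 'a"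
    assume "b \<in> Basis" "L < \<bar>snd z \<bullet> b\<bar>"
    moreover have "\<bar>snd z \<bullet> b\<bar> \<le> norm z"
      using Basis_le_norm[OF \<open>b \<in> Basis\<close>, of "snd z"] norm_snd_le[of "snd z" "fst z"] by simp
    ultimately show "F z = 0" by (intro supp) simp
  qed auto
  also have "\<dots> = ennreal (2 * (v1 * vL) + 2 * (real DIM('a) * K)) * ?I"
    using v0 K0 by (simp add: ennreal_mult ennreal_of_nat_eq_real_of_nat[symmetric] distrib_right distrib_left mult_ac)
  finally show "(\<integral>\<^sup>+\<xi>. ennreal (bracket_sq \<xi> powr (1/2)) * ?A \<xi> \<partial>lborel) \<le>
      ennreal (2 * (v1 * vL) + 2 * (real DIM('a) * K)) * ?I" .
qed

section \<open>Interpolation with the \<open>L\<^sup>1\<close> bound\<close>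

lemma paraboloid_fourier_add:
  assumes "integrable lborel F" "integrable lborel G"
  shows "paraboloid_fourier (\<lambda>z. F z + G z) \<xi> = paraboloid_fourier F \<xi> + paraboloid_fourier G \<xi>"
  unfolding paraboloid_fourier_def
  using paraboloid_fourier_integrable[OF assms(1), of \<xi>] paraboloid_fourier_integrable[OF assms(2), of \<xi>]
  by (simp add: distrib_left)

text \<open>The exponent \<open>1 - p\<close> is not positive and \<open>2 - p\<close> is not
  negative, so the two powers are monotone in the required directions. A bound on the integral of
  the \<open>p\<close>-th power thus controls the L^1 norm above height \<open>c\<close> and the L^2
  norm below it.\<close>

lemma level_set_bounds:
  fixes y p c :: real
  assumes "0 < c" "0 \<le> y" "1 \<le> p" "p \<le> 2"
  shows "c < y \<Longrightarrow> y \<le> c powr (1 - p) * y powr p"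
    and "y \<le> c \<Longrightarrow> y\<^sup>2 \<le> c powr (2 - p) * y powr p"
proof -
  assume y: "c < y"
  have "y = y powr (1 - p) * y powr p"
    using assms y by (simp add: powr_add[symmetric])
  also have "\<dots> \<le> c powr (1 - p) * y powr p"
    using assms y by (intro mult_right_mono powr_mono2') auto
  finally show "y \<le> c powr (1 - p) * y powr p" .
next
  assume y: "y \<le> c"
  show "y\<^sup>2 \<le> c powr (2 - p) * y powr p"
  proof (cases "y = 0")
    case False
    then have "y\<^sup>2 = y powr (2 - p) * y powr p"
      using assms by (simp add: powr_add[symmetric] powr_numeral)
    also have "\<dots> \<le> c powr (2 - p) * y powr p"
      using assms y by (intro mult_right_mono powr_mono2) auto
    finally show ?thesis .
  qed simp
qed

text \<open>The high values of \<phi> are estimated by L^1, uniformly on the shell, and pay its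
  volume, about \<rho>^d; the low values gain 1/\<rho> from local smoothing. The exponent
  \<open>e\<close> is the one that interpolation between these two bounds predicts. In
  \<open>K\<close>, the factor \<open>4 powr \<sigma>\<close> comes from the outer edge of the shell
  and \<open>2 ^ DIM('a)\<close> from the enclosing ball of radius \<open>2 * \<rho>\<close>. The
  bound \<open>B\<close> makes the two pieces integrable and does not enter
  \<open>K\<close>.\<close>

lemma restriction_dyadic_piece:
  fixes m \<phi> :: "real \<times> 'a::euclidean_space \<Rightarrow> complex"
  assumes m [measurable]: "m \<in> borel_measurable borel" and mM: "\<And>z. norm (m z) \<le> M" and L: "0 \<le> L"
    and msupp: "\<And>z. L < norm z \<Longrightarrow> m z = 0"
    and p: "1 < p" "p \<le> 2" and \<sigma>: "0 \<le> \<sigma>" and C: "0 \<le> C"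
    and smoothing: "\<And>F :: real \<times> 'a \<Rightarrow> complex. integrable lborel F \<Longrightarrow> (\<And>z. L < norm z \<Longrightarrow> F z = 0) \<Longrightarrow>
      (\<integral>\<^sup>+\<xi>. ennreal (bracket_sq \<xi> powr (1/2)) * ennreal ((norm (paraboloid_fourier F \<xi>))\<^sup>2) \<partial>lborel) \<le>
      ennreal C * (\<integral>\<^sup>+z. ennreal ((norm (F z))\<^sup>2) \<partial>lborel)"
    and \<phi> [measurable]: "\<phi> \<in> borel_measurable borel" and bdd: "\<And>z. norm (\<phi> z) \<le> B"
    and N: "0 < N" "(\<integral>\<^sup>+z. ennreal (norm (\<phi> z) powr p) \<partial>lborel) = ennreal (N powr p)" and \<rho>: "1 \<le> \<rho>"
  defines "e \<equiv> 2 * \<sigma> + real DIM('a) - 2 * (real DIM('a) + 1) * (1 - 1 / p)"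
    and "K \<equiv> 2 * 4 powr \<sigma> * (M\<^sup>2 * unit_ball_vol (real DIM('a)) * 2 ^ DIM('a) + C * M\<^sup>2)"
  shows "(\<integral>\<^sup>+\<xi>. ennreal (bracket_sq \<xi> powr \<sigma>) * ennreal ((norm (paraboloid_fourier (\<lambda>z. m z * \<phi> z) \<xi>))\<^sup>2) *
      indicator {\<xi>. \<rho>\<^sup>2 \<le> bracket_sq \<xi> \<and> bracket_sq \<xi> < 4 * \<rho>\<^sup>2} \<xi> \<partial>lborel) \<le> ennreal (K * N\<^sup>2 * \<rho> powr e)"
proof -
  define d where "d = real DIM('a)"
  \<comment> \<open>The cutting height balances the two contributions, which then both have the exponent \<open>e\<close>.\<close>
  define lam where "lam = N * \<rho> powr ((d + 1) / p)"
  have lam: "0 < lam" using N \<rho> by (simp add: lam_def)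
  have M0: "0 \<le> M" using order_trans[OF norm_ge_zero mM] .
  \<comment> \<open>The splitting is by the values of \<phi> and not of the product, so that the
    heights are measured by \<open>N\<close>; the factor \<open>m\<close> keeps both pieces
    supported in the ball of radius \<open>L\<close>.\<close>
  define F1 where "F1 z = m z * (if lam < norm (\<phi> z) then \<phi> z else 0)" for z
  define F2 where "F2 z = m z * (if lam < norm (\<phi> z) then 0 else \<phi> z)" for z
  let ?D = "{\<xi>::'a. \<rho>\<^sup>2 \<le> bracket_sq \<xi> \<and> bracket_sq \<xi> < 4 * \<rho>\<^sup>2}"
  have [measurable]: "?D \<in> sets borel" by measurable
  have [measurable]: "F1 \<in> borel_measurable borel" "F2 \<in> borel_measurable borel"
    unfolding F1_def[abs_def] F2_def[abs_def] by measurable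
  have B0: "0 \<le> B" using order_trans[OF norm_ge_zero bdd] .
  have i1: "integrable lborel F1" and i2: "integrable lborel F2"
    by (rule integrable_bounded_support[where C="M * B" and L=L];
        use M0 B0 mM bdd in \<open>auto simp: F1_def F2_def norm_mult msupp intro!: mult_mono\<close>)+
  have [measurable]: "paraboloid_fourier F1 \<in> borel_measurable borel" "paraboloid_fourier F2 \<in> borel_measurable borel"
    by (intro paraboloid_fourier_measurable i1 i2)+
  have F12: "(\<lambda>z. m z * \<phi> z) = (\<lambda>z. F1 z + F2 z)" by (auto simp: F1_def F2_def)
  let ?A1 = "\<lambda>\<xi>. ennreal ((norm (paraboloid_fourier F1 \<xi>))\<^sup>2)"
  let ?A2 = "\<lambda>\<xi>. ennreal ((norm (paraboloid_fourier F2 \<xi>))\<^sup>2)"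
  have one: "?A1 \<xi> \<le> ennreal (M\<^sup>2 * (lam powr (1 - p) * N powr p)\<^sup>2)" for \<xi>
  proof -
    have "ennreal (norm (paraboloid_fourier F1 \<xi>)) \<le> (\<integral>\<^sup>+z. ennreal (norm (F1 z)) \<partial>lborel)"
      by (rule paraboloid_fourier_le)
    also have "\<dots> \<le> (\<integral>\<^sup>+z. ennreal (M * lam powr (1 - p)) * ennreal (norm (\<phi> z) powr p) \<partial>lborel)"
    proof (rule nn_integral_mono)
      fix z
      have "norm (F1 z) \<le> M * (lam powr (1 - p) * norm (\<phi> z) powr p)"
        unfolding F1_def norm_mult using level_set_bounds(1)[OF lam norm_ge_zero[of "\<phi> z"]] p mM[of z] M0
        by (intro mult_mono) auto
      then show "ennreal (norm (F1 z)) \<le> ennreal (M * lam powr (1 - p)) * ennreal (norm (\<phi> z) powr p)"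
        using M0 by (simp add: ennreal_mult[symmetric] mult.assoc ennreal_leI)
    qed
    also have "\<dots> = ennreal (M * lam powr (1 - p)) * ennreal (N powr p)"
      by (simp add: nn_integral_cmult N)
    finally have "norm (paraboloid_fourier F1 \<xi>) \<le> M * lam powr (1 - p) * N powr p"
      using M0 by (simp add: ennreal_mult[symmetric])
    then have "(norm (paraboloid_fourier F1 \<xi>))\<^sup>2 \<le> (M * lam powr (1 - p) * N powr p)\<^sup>2"
      by (intro power_mono) auto
    then show ?thesis by (intro ennreal_leI) (simp add: power_mult_distrib mult.assoc)
  qed
  have two: "(\<integral>\<^sup>+z. ennreal ((norm (F2 z))\<^sup>2) \<partial>lborel) \<le> ennreal (M\<^sup>2 * (lam powr (2 - p) * N powr p))"
  proof -
    have "(\<integral>\<^sup>+z. ennreal ((norm (F2 z))\<^sup>2) \<partial>lborel) \<le> (\<integral>\<^sup>+z. ennreal (M\<^sup>2 * lam powr (2 - p)) * ennreal (norm (\<phi> z) powr p) \<partial>lborel)"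
    proof (rule nn_integral_mono)
      fix z
      have "(norm (F2 z))\<^sup>2 \<le> M\<^sup>2 * (lam powr (2 - p) * norm (\<phi> z) powr p)"
        unfolding F2_def norm_mult power_mult_distrib
        using level_set_bounds(2)[OF lam norm_ge_zero[of "\<phi> z"]] p mM[of z] M0
        by (intro mult_mono power_mono) auto
      then show "ennreal ((norm (F2 z))\<^sup>2) \<le> ennreal (M\<^sup>2 * lam powr (2 - p)) * ennreal (norm (\<phi> z) powr p)"
        by (simp add: ennreal_mult[symmetric] mult.assoc ennreal_leI)
    qed
    also have "\<dots> = ennreal (M\<^sup>2 * (lam powr (2 - p) * N powr p))"
      by (simp add: nn_integral_cmult N ennreal_mult mult.assoc)
    finally show ?thesis .
  qed
  have A2_int: "(\<integral>\<^sup>+\<xi>. ?A2 \<xi> * indicator ?D \<xi> \<partial>lborel) \<le> ennreal (1 / \<rho> * (C * (M\<^sup>2 * (lam powr (2 - p) * N powr p))))"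
  proof -
    have "(\<integral>\<^sup>+\<xi>. ?A2 \<xi> * indicator ?D \<xi> \<partial>lborel) \<le> (\<integral>\<^sup>+\<xi>. ennreal (1 / \<rho>) * (ennreal (bracket_sq \<xi> powr (1/2)) * ?A2 \<xi>) \<partial>lborel)"
    proof (rule nn_integral_mono)
      fix \<xi> :: 'a
      show "?A2 \<xi> * indicator ?D \<xi> \<le> ennreal (1 / \<rho>) * (ennreal (bracket_sq \<xi> powr (1/2)) * ?A2 \<xi>)"
      proof (cases "\<xi> \<in> ?D")
        case True
        then have "\<rho> \<le> bracket_sq \<xi> powr (1/2)"
          by (simp add: powr_half_sqrt less_imp_le real_le_rsqrt)
        then have "1 \<le> 1 / \<rho> * bracket_sq \<xi> powr (1/2)" using \<rho> by (simp add: field_simps)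
        then have "1 * ?A2 \<xi> \<le> ennreal (1 / \<rho> * bracket_sq \<xi> powr (1/2)) * ?A2 \<xi>"
          by (intro mult_right_mono) (auto dest: ennreal_leI)
        then show ?thesis using True \<rho> by (simp add: ennreal_mult mult.assoc del: times_divide_eq_left)
      qed simp
    qed
    also have "\<dots> = ennreal (1 / \<rho>) * (\<integral>\<^sup>+\<xi>. ennreal (bracket_sq \<xi> powr (1/2)) * ?A2 \<xi> \<partial>lborel)"
      by (rule nn_integral_cmult) measurable
    also have "\<dots> \<le> ennreal (1 / \<rho>) * (ennreal C * ennreal (M\<^sup>2 * (lam powr (2 - p) * N powr p)))"
      by (intro mult_left_mono order_trans[OF smoothing[OF i2]] mult_left_mono two) (auto simp: F2_def msupp)
    also have "\<dots> = ennreal (1 / \<rho> * (C * (M\<^sup>2 * (lam powr (2 - p) * N powr p))))"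
      using C \<rho> by (simp add: ennreal_mult del: times_divide_eq_left)
    finally show ?thesis .
  qed
  define V where "V = unit_ball_vol d * (2 * \<rho>) ^ DIM('a)"
  have V0: "0 \<le> V" using \<rho> by (simp add: V_def d_def)
  have A1_int: "(\<integral>\<^sup>+\<xi>. ?A1 \<xi> * indicator ?D \<xi> \<partial>lborel) \<le> ennreal (M\<^sup>2 * (lam powr (1 - p) * N powr p)\<^sup>2 * V)"
  proof -
    have "?D \<subseteq> cball 0 (2 * \<rho>)"
    proof
      fix \<xi> assume "\<xi> \<in> ?D"
      then have "(norm \<xi>)\<^sup>2 \<le> (2 * \<rho>)\<^sup>2" by (simp add: bracket_sq_def power_mult_distrib)
      then show "\<xi> \<in> cball 0 (2 * \<rho>)" using power2_le_imp_le[of "norm \<xi>" "2 * \<rho>"] \<rho> by simp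
    qed
    then have "emeasure lborel ?D \<le> emeasure lborel (cball (0::'a) (2 * \<rho>))"
      by (rule emeasure_mono) simp
    also have "\<dots> = ennreal V" using \<rho> by (subst emeasure_cball) (auto simp: V_def d_def)
    finally have D: "emeasure lborel ?D \<le> ennreal V" .
    have "(\<integral>\<^sup>+\<xi>. ?A1 \<xi> * indicator ?D \<xi> \<partial>lborel) \<le> (\<integral>\<^sup>+\<xi>. ennreal (M\<^sup>2 * (lam powr (1 - p) * N powr p)\<^sup>2) * indicator ?D \<xi> \<partial>lborel)"
      by (intro nn_integral_mono mult_right_mono one) simp
    also have "\<dots> = ennreal (M\<^sup>2 * (lam powr (1 - p) * N powr p)\<^sup>2) * emeasure lborel ?D"
      by (rule nn_integral_cmult_indicator) simp
    also have "\<dots> \<le> ennreal (M\<^sup>2 * (lam powr (1 - p) * N powr p)\<^sup>2) * ennreal V"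
      by (intro mult_left_mono D) simp
    also have "\<dots> = ennreal (M\<^sup>2 * (lam powr (1 - p) * N powr p)\<^sup>2 * V)"
      using V0 by (simp add: ennreal_mult)
    finally show ?thesis .
  qed
  have "(\<integral>\<^sup>+\<xi>. ennreal (bracket_sq \<xi> powr \<sigma>) * ennreal ((norm (paraboloid_fourier (\<lambda>z. m z * \<phi> z) \<xi>))\<^sup>2) * indicator ?D \<xi> \<partial>lborel) \<le>
     (\<integral>\<^sup>+\<xi>. ennreal (2 * (4 * \<rho>\<^sup>2) powr \<sigma>) * (?A1 \<xi> * indicator ?D \<xi> + ?A2 \<xi> * indicator ?D \<xi>) \<partial>lborel)"
  proof (rule nn_integral_mono)
    fix \<xi> :: 'a
    show "ennreal (bracket_sq \<xi> powr \<sigma>) * ennreal ((norm (paraboloid_fourier (\<lambda>z. m z * \<phi> z) \<xi>))\<^sup>2) * indicator ?D \<xi> \<le>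
      ennreal (2 * (4 * \<rho>\<^sup>2) powr \<sigma>) * (?A1 \<xi> * indicator ?D \<xi> + ?A2 \<xi> * indicator ?D \<xi>)"
    proof (cases "\<xi> \<in> ?D")
      case True
      have "(norm (paraboloid_fourier (\<lambda>z. m z * \<phi> z) \<xi>))\<^sup>2 \<le>
          2 * (norm (paraboloid_fourier F1 \<xi>))\<^sup>2 + 2 * (norm (paraboloid_fourier F2 \<xi>))\<^sup>2"
        unfolding F12 paraboloid_fourier_add[OF i1 i2] by (rule norm_add_sq_le)
      moreover have "bracket_sq \<xi> powr \<sigma> \<le> (4 * \<rho>\<^sup>2) powr \<sigma>"
        using True \<sigma> by (intro powr_mono2) (auto simp: less_imp_le)
      ultimately have "bracket_sq \<xi> powr \<sigma> * (norm (paraboloid_fourier (\<lambda>z. m z * \<phi> z) \<xi>))\<^sup>2 \<le>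
          (4 * \<rho>\<^sup>2) powr \<sigma> * (2 * (norm (paraboloid_fourier F1 \<xi>))\<^sup>2 + 2 * (norm (paraboloid_fourier F2 \<xi>))\<^sup>2)"
        by (intro mult_mono) auto
      then have "ennreal (bracket_sq \<xi> powr \<sigma> * (norm (paraboloid_fourier (\<lambda>z. m z * \<phi> z) \<xi>))\<^sup>2) \<le>
          ennreal (2 * (4 * \<rho>\<^sup>2) powr \<sigma> * ((norm (paraboloid_fourier F1 \<xi>))\<^sup>2 + (norm (paraboloid_fourier F2 \<xi>))\<^sup>2))"
        by (intro ennreal_leI) (simp add: algebra_simps)
      then show ?thesis using True by (simp add: ennreal_mult)
    qed simp
  qed
  also have "\<dots> = ennreal (2 * (4 * \<rho>\<^sup>2) powr \<sigma>) * ((\<integral>\<^sup>+\<xi>. ?A1 \<xi> * indicator ?D \<xi> \<partial>lborel) + (\<integral>\<^sup>+\<xi>. ?A2 \<xi> * indicator ?D \<xi> \<partial>lborel))"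
    by (subst nn_integral_cmult, measurable, subst nn_integral_add, measurable)
  also have "\<dots> \<le> ennreal (2 * (4 * \<rho>\<^sup>2) powr \<sigma>) * (ennreal (M\<^sup>2 * (lam powr (1 - p) * N powr p)\<^sup>2 * V) +
      ennreal (1 / \<rho> * (C * (M\<^sup>2 * (lam powr (2 - p) * N powr p)))))"
    by (intro mult_left_mono add_mono A1_int A2_int) simp
  also have "\<dots> = ennreal (2 * (4 * \<rho>\<^sup>2) powr \<sigma> * (M\<^sup>2 * (lam powr (1 - p) * N powr p)\<^sup>2 * V +
      1 / \<rho> * (C * (M\<^sup>2 * (lam powr (2 - p) * N powr p)))))"
    using V0 C \<rho> by (simp add: ennreal_mult[symmetric] ennreal_plus[symmetric] del: ennreal_plus)
  also have "2 * (4 * \<rho>\<^sup>2) powr \<sigma> * (M\<^sup>2 * (lam powr (1 - p) * N powr p)\<^sup>2 * V +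
      1 / \<rho> * (C * (M\<^sup>2 * (lam powr (2 - p) * N powr p)))) = K * N\<^sup>2 * \<rho> powr e"
  proof -
    have r: "0 < \<rho>" using \<rho> by simp
    have ex1: "(\<rho> powr (2 * \<sigma>)) * ((\<rho> powr ((d + 1) / p * (1 - p)))\<^sup>2 * \<rho> powr d) = \<rho> powr e"
    proof -
      have "(\<rho> powr y)\<^sup>2 = \<rho> powr (2 * y)" for y
        by (simp add: power2_eq_square powr_add[symmetric])
      then have "(\<rho> powr ((d + 1) / p * (1 - p)))\<^sup>2 = \<rho> powr (2 * ((d + 1) / p * (1 - p)))" .
      moreover have "2 * \<sigma> + (2 * ((d + 1) / p * (1 - p)) + d) = e"
        using p by (simp add: e_def d_def field_simps)
      ultimately show ?thesis by (simp add: powr_add[symmetric])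
    qed
    have ex2: "\<rho> powr (2 * \<sigma>) * (\<rho> powr (- 1) * \<rho> powr ((d + 1) / p * (2 - p))) = \<rho> powr e"
    proof -
      have "2 * \<sigma> + (- 1 + (d + 1) / p * (2 - p)) = e"
        using p by (simp add: e_def d_def field_simps)
      then show ?thesis by (simp only: powr_add[symmetric])
    qed
    have l1: "lam powr (1 - p) * N powr p = N * \<rho> powr ((d + 1) / p * (1 - p))"
    proof -
      have "lam powr (1 - p) = N powr (1 - p) * \<rho> powr ((d + 1) / p * (1 - p))"
        using N r by (simp add: lam_def powr_mult powr_powr)
      moreover have "N powr (1 - p) * N powr p = N" using N by (simp add: powr_add[symmetric])
      ultimately show ?thesis by (simp add: mult_ac)
    qed
    have l2: "lam powr (2 - p) * N powr p = N\<^sup>2 * \<rho> powr ((d + 1) / p * (2 - p))"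
    proof -
      have "lam powr (2 - p) = N powr (2 - p) * \<rho> powr ((d + 1) / p * (2 - p))"
        using N r by (simp add: lam_def powr_mult powr_powr)
      moreover have "N powr (2 - p) * N powr p = N\<^sup>2" using N by (simp add: powr_add[symmetric] powr_numeral)
      ultimately show ?thesis by (simp add: mult_ac)
    qed
    have s: "(4 * \<rho>\<^sup>2) powr \<sigma> = 4 powr \<sigma> * \<rho> powr (2 * \<sigma>)"
      using r by (simp add: powr_mult powr_powr flip: powr_numeral)
    have v: "V = unit_ball_vol d * 2 ^ DIM('a) * \<rho> powr d"
      using r by (simp add: V_def d_def power_mult_distrib powr_realpow)
    have ri: "1 / \<rho> = \<rho> powr (- 1)" using r by (simp add: powr_minus_divide)
    have "2 * (4 * \<rho>\<^sup>2) powr \<sigma> * (M\<^sup>2 * (lam powr (1 - p) * N powr p)\<^sup>2 * V + 1 / \<rho> * (C * (M\<^sup>2 * (lam powr (2 - p) * N powr p)))) =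
      2 * 4 powr \<sigma> * (M\<^sup>2 * unit_ball_vol d * 2 ^ DIM('a) * N\<^sup>2 * (\<rho> powr (2 * \<sigma>) * ((\<rho> powr ((d + 1) / p * (1 - p)))\<^sup>2 * \<rho> powr d)) +
        C * M\<^sup>2 * N\<^sup>2 * (\<rho> powr (2 * \<sigma>) * (\<rho> powr (- 1) * \<rho> powr ((d + 1) / p * (2 - p)))))"
      unfolding l1 l2 s v ri by (simp add: power_mult_distrib algebra_simps)
    also have "\<dots> = K * N\<^sup>2 * \<rho> powr e"
      unfolding ex1 ex2 by (simp add: K_def d_def algebra_simps)
    finally show ?thesis .
  qed
  finally show ?thesis .
qed

lemma suminf_geometric_powr_le:
  fixes e K :: real
  assumes "e < 0" "0 \<le> K"
  shows "(\<Sum>j. ennreal (K * (2 ^ j) powr e)) = ennreal (K / (1 - 2 powr e))"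
proof -
  have lt: "norm ((2::real) powr e) < 1" using assms powr_less_mono2_neg[of e 1 2] by simp
  have "(2 ^ j) powr e = (2 powr e) ^ j" for j :: nat
    by (simp add: powr_powr powr_realpow[symmetric] mult.commute)
  moreover have "(\<lambda>j. K * (2 powr e) ^ j) sums (K * (1 / (1 - 2 powr e)))"
    using geometric_sums[OF lt] by (rule sums_mult)
  ultimately have "(\<lambda>j. K * (2 ^ j) powr e) sums (K / (1 - 2 powr e))" by simp
  then show ?thesis
    using assms by (intro suminf_ennreal_eq) auto
qed

text \<open>The least \<open>n\<close> with \<open>J < 4 ^ n\<close> is not 0 because
  \<open>J\<close> \<ge> 1; its predecessor is the required index.\<close>

lemma ex_dyadic:
  fixes J :: real
  assumes "1 \<le> J"
  shows "\<exists>j::nat. (2 ^ j)\<^sup>2 \<le> J \<and> J < 4 * (2 ^ j)\<^sup>2"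
proof -
  obtain n where n: "J < 4 ^ n" using real_arch_pow[of 4 J] by auto
  define k where "k = (LEAST n. J < 4 ^ n)"
  have k: "J < 4 ^ k" unfolding k_def by (rule LeastI[of _ n]) (rule n)
  then have "k \<noteq> 0" using assms by (cases k) auto
  then obtain j where j: "k = Suc j" by (cases k) auto
  have "\<not> J < 4 ^ j" using not_less_Least[of j "\<lambda>n. J < 4 ^ n"] j unfolding k_def by simp
  moreover have "((2::real) ^ j)\<^sup>2 = 4 ^ j" by (simp only: power2_eq_square power_mult_distrib[symmetric]) simp
  ultimately show ?thesis using k j by (intro exI[of _ j]) simp
qed

text \<open>For \<open>p = 2\<close> and \<sigma> = 1/2 the dyadic exponent is 0 and the sum over
  the shells would diverge, so \<open>p = 2\<close> with \<sigma> \<le> 1/2 is read off from local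
  smoothing; otherwise the shells are summed. The constant is placed before both \<phi> and its
  bound \<open>B\<close>.\<close>

lemma restriction_estimate:
  fixes m :: "real \<times> 'a::euclidean_space \<Rightarrow> complex"
  assumes m [measurable]: "m \<in> borel_measurable borel" and mM: "\<And>z. norm (m z) \<le> M" and L: "0 \<le> L"
    and msupp: "\<And>z. L < norm z \<Longrightarrow> m z = 0"
    and p: "1 < p" "p \<le> 2" and \<sigma>: "0 \<le> \<sigma>"
    and exponents: "p = 2 \<and> \<sigma> \<le> 1/2 \<or> 2 * \<sigma> + real DIM('a) - 2 * (real DIM('a) + 1) * (1 - 1 / p) < 0"
  shows "\<exists>C\<ge>0. \<forall>\<phi> B. \<phi> \<in> borel_measurable borel \<longrightarrow> (\<forall>z. norm (\<phi> z) \<le> B) \<longrightarrow>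
      (\<integral>\<^sup>+z. ennreal (norm (\<phi> z) powr p) \<partial>lborel) \<noteq> \<infinity> \<longrightarrow>
      (\<integral>\<^sup>+\<xi>. ennreal (bracket_sq \<xi> powr \<sigma>) * ennreal ((norm (paraboloid_fourier (\<lambda>z. m z * \<phi> z) \<xi>))\<^sup>2) \<partial>lborel) \<le>
      ennreal (C * (enn2real (\<integral>\<^sup>+z. ennreal (norm (\<phi> z) powr p) \<partial>lborel) powr (1 / p))\<^sup>2)"
proof -
  have M0: "0 \<le> M" using order_trans[OF norm_ge_zero mM] .
  obtain C where C: "0 \<le> C" and smoothing: "\<And>F :: real \<times> 'a \<Rightarrow> complex. integrable lborel F \<Longrightarrow> (\<And>z. L < norm z \<Longrightarrow> F z = 0) \<Longrightarrow>
      (\<integral>\<^sup>+\<xi>. ennreal (bracket_sq \<xi> powr (1/2)) * ennreal ((norm (paraboloid_fourier F \<xi>))\<^sup>2) \<partial>lborel) \<le>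
      ennreal C * (\<integral>\<^sup>+z. ennreal ((norm (F z))\<^sup>2) \<partial>lborel)"
    using local_smoothing[OF L] by blast
  have int: "integrable lborel (\<lambda>z. m z * \<phi> z)"
    if "\<phi> \<in> borel_measurable borel" "\<And>z. norm (\<phi> z) \<le> B" for \<phi> B
    using order_trans[OF norm_ge_zero that(2)] M0 that mM
    by (intro integrable_bounded_support[where C="M * B" and L=L]) (auto simp: norm_mult msupp intro!: mult_mono)
  show ?thesis
  proof (cases "p = 2 \<and> \<sigma> \<le> 1/2")
    case True
    show ?thesis
    proof (intro exI[of _ "C * M\<^sup>2"] conjI allI impI)
      show "0 \<le> C * M\<^sup>2" using C by simp
      fix \<phi> :: "real \<times> 'a \<Rightarrow> complex" and B
      assume \<phi> [measurable]: "\<phi> \<in> borel_measurable borel" and bdd': "\<forall>z. norm (\<phi> z) \<le> B"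
        and fin: "(\<integral>\<^sup>+z. ennreal (norm (\<phi> z) powr p) \<partial>lborel) \<noteq> \<infinity>"
      have bdd: "norm (\<phi> z) \<le> B" for z using bdd' by blast
      define I where "I = (\<integral>\<^sup>+z. ennreal (norm (\<phi> z) powr p) \<partial>lborel)"
      have sq: "norm (\<phi> z) powr p = (norm (\<phi> z))\<^sup>2" for z using True by (simp add: powr_numeral)
      have "(\<integral>\<^sup>+\<xi>. ennreal (bracket_sq \<xi> powr \<sigma>) * ennreal ((norm (paraboloid_fourier (\<lambda>z. m z * \<phi> z) \<xi>))\<^sup>2) \<partial>lborel) \<le>
        (\<integral>\<^sup>+\<xi>. ennreal (bracket_sq \<xi> powr (1/2)) * ennreal ((norm (paraboloid_fourier (\<lambda>z. m z * \<phi> z) \<xi>))\<^sup>2) \<partial>lborel)"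
        using True by (intro nn_integral_mono mult_right_mono ennreal_leI powr_mono) auto
      also have "\<dots> \<le> ennreal C * (\<integral>\<^sup>+z. ennreal ((norm (m z * \<phi> z))\<^sup>2) \<partial>lborel)"
        by (rule smoothing[OF int[OF \<phi> bdd]]) (simp add: msupp)
      also have "\<dots> \<le> ennreal C * (\<integral>\<^sup>+z. ennreal (M\<^sup>2) * ennreal (norm (\<phi> z) powr p) \<partial>lborel)"
        unfolding sq
        by (intro mult_left_mono nn_integral_mono)
           (auto simp: norm_mult power_mult_distrib ennreal_mult[symmetric] intro!: ennreal_leI mult_right_mono power_mono mM)
      also have "\<dots> = ennreal C * (ennreal (M\<^sup>2) * I)"
        by (simp add: nn_integral_cmult I_def)
      also have "I = ennreal (enn2real I)" using fin by (simp add: I_def top.not_eq_extremum)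
      also have "enn2real I = (enn2real I powr (1 / p))\<^sup>2"
        using True by (simp add: powr_half_sqrt)
      finally show "(\<integral>\<^sup>+\<xi>. ennreal (bracket_sq \<xi> powr \<sigma>) * ennreal ((norm (paraboloid_fourier (\<lambda>z. m z * \<phi> z) \<xi>))\<^sup>2) \<partial>lborel)
        \<le> ennreal (C * M\<^sup>2 * (enn2real (\<integral>\<^sup>+z. ennreal (norm (\<phi> z) powr p) \<partial>lborel) powr (1 / p))\<^sup>2)"
        using C by (simp add: ennreal_mult mult.assoc I_def)
    qed
  next
    case False
    define e where "e = 2 * \<sigma> + real DIM('a) - 2 * (real DIM('a) + 1) * (1 - 1 / p)"
    have e: "e < 0" unfolding e_def using exponents False by blast
    define K where "K = 2 * 4 powr \<sigma> * (M\<^sup>2 * unit_ball_vol (real DIM('a)) * 2 ^ DIM('a) + C * M\<^sup>2)"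
    have K0: "0 \<le> K" using C by (simp add: K_def)
    have lt: "(2::real) powr e < 1" using e powr_less_mono2_neg[of e 1 2] by simp
    show ?thesis
    proof (intro exI[of _ "K / (1 - 2 powr e)"] conjI allI impI)
      show "0 \<le> K / (1 - 2 powr e)" using K0 lt by simp
      fix \<phi> :: "real \<times> 'a \<Rightarrow> complex" and B
      assume \<phi> [measurable]: "\<phi> \<in> borel_measurable borel" and bdd': "\<forall>z. norm (\<phi> z) \<le> B"
        and fin: "(\<integral>\<^sup>+z. ennreal (norm (\<phi> z) powr p) \<partial>lborel) \<noteq> \<infinity>"
      have bdd: "norm (\<phi> z) \<le> B" for z using bdd' by blast
      define I where "I = (\<integral>\<^sup>+z. ennreal (norm (\<phi> z) powr p) \<partial>lborel)"
      define N where "N = enn2real I powr (1 / p)"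
      let ?A = "\<lambda>\<xi>. ennreal (bracket_sq \<xi> powr \<sigma>) * ennreal ((norm (paraboloid_fourier (\<lambda>z. m z * \<phi> z) \<xi>))\<^sup>2)"
      have [measurable]: "paraboloid_fourier (\<lambda>z. m z * \<phi> z) \<in> borel_measurable borel"
        by (rule paraboloid_fourier_measurable[OF int[OF \<phi> bdd]])
      have I: "I = ennreal (enn2real I)" using fin by (simp add: I_def top.not_eq_extremum)
      have "(\<integral>\<^sup>+\<xi>. ?A \<xi> \<partial>lborel) \<le> ennreal (K / (1 - 2 powr e) * N\<^sup>2)"
      \<comment> \<open>The cutting height is a multiple of the norm \<open>N\<close> and has to be
        positive, so a \<phi> that vanishes almost everywhere is treated apart.\<close>
      proof (cases "I = 0")
        case True
        then have ae: "AE z in lborel. norm (\<phi> z) powr p = 0"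
          unfolding I_def by (subst (asm) nn_integral_0_iff_AE) auto
        have "(\<integral>\<^sup>+z. ennreal (norm (m z * \<phi> z)) \<partial>lborel) = 0"
          by (subst nn_integral_0_iff_AE) (use ae in auto)
        then have "norm (paraboloid_fourier (\<lambda>z. m z * \<phi> z) \<xi>) = 0" for \<xi>
          using paraboloid_fourier_le[of "\<lambda>z. m z * \<phi> z" \<xi>] by simp
        then show ?thesis by simp
      next
        case False
        then have Ipos: "0 < enn2real I" using I by (metis enn2real_nonneg ennreal_0 less_eq_real_def)
        then have N: "0 < N" by (simp add: N_def)
        have NI: "(\<integral>\<^sup>+z. ennreal (norm (\<phi> z) powr p) \<partial>lborel) = ennreal (N powr p)"
          using p I Ipos by (simp add: N_def powr_powr I_def[symmetric])
        let ?D = "\<lambda>j::nat. {\<xi>::'a. (2 ^ j)\<^sup>2 \<le> bracket_sq \<xi> \<and> bracket_sq \<xi> < 4 * (2 ^ j)\<^sup>2}"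
        have "(\<integral>\<^sup>+\<xi>. ?A \<xi> \<partial>lborel) \<le> (\<integral>\<^sup>+\<xi>. (\<Sum>j. ?A \<xi> * indicator (?D j) \<xi>) \<partial>lborel)"
        proof (rule nn_integral_mono)
          fix \<xi> :: 'a
          obtain j where "\<xi> \<in> ?D j" using ex_dyadic[of "bracket_sq \<xi>"] by auto
          then have "?A \<xi> = (\<Sum>i\<in>{j}. ?A \<xi> * indicator (?D i) \<xi>)" by simp
          also have "\<dots> \<le> (\<Sum>j. ?A \<xi> * indicator (?D j) \<xi>)"
            by (rule sum_le_suminf) auto
          finally show "?A \<xi> \<le> (\<Sum>j. ?A \<xi> * indicator (?D j) \<xi>)" .
        qed
        also have "\<dots> = (\<Sum>j. \<integral>\<^sup>+\<xi>. ?A \<xi> * indicator (?D j) \<xi> \<partial>lborel)"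
          by (rule nn_integral_suminf) measurable
        also have "\<dots> \<le> (\<Sum>j. ennreal (K * N\<^sup>2 * (2 ^ j) powr e))"
          unfolding K_def e_def
          by (intro suminf_le restriction_dyadic_piece[OF m mM L msupp p \<sigma> C smoothing \<phi> bdd N NI]) auto
        also have "\<dots> = ennreal (K * N\<^sup>2 / (1 - 2 powr e))"
          using K0 by (intro suminf_geometric_powr_le e) simp
        finally show ?thesis by simp
      qed
      then show "(\<integral>\<^sup>+\<xi>. ?A \<xi> \<partial>lborel) \<le>
        ennreal (K / (1 - 2 powr e) * (enn2real (\<integral>\<^sup>+z. ennreal (norm (\<phi> z) powr p) \<partial>lborel) powr (1 / p))\<^sup>2)"
        by (simp add: N_def I_def)
    qed
  qed
qed

section \<open>Regularity and decay of the restricted Fourier transform\<close>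

lemma norm_cis_diff_le: "norm (cis (a + s) - cis a) \<le> \<bar>s\<bar>"
  using has_line_derivative_lipschitz[OF has_line_derivative_cis[of "1::real" "1::real"], of 1 a s]
  by (simp add: norm_mult)

text \<open>The phase has derivative
  \<open>2 * fst z * (\<xi> \<bullet> b) - snd z \<bullet> b\<close> along \<open>b\<close>, and its
  factors in \<open>z\<close> are absorbed by the amplitude. They are at most \<open>L\<close> on
  the support, which provides the majorant for differentiation under the integral sign.\<close>

lemma has_line_derivative_paraboloid_fourier:
  fixes F :: "real \<times> 'a::euclidean_space \<Rightarrow> complex"
  assumes F: "integrable lborel F" and supp: "\<And>z. L < norm z \<Longrightarrow> F z = 0" and b: "b \<in> Basis"
  shows "has_line_derivative (paraboloid_fourier F) b
    (\<lambda>\<xi>. \<i> * (2 * of_real (\<xi> \<bullet> b) * paraboloid_fourier (\<lambda>z. of_real (fst z) * F z) \<xi> -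
        paraboloid_fourier (\<lambda>z. of_real (snd z \<bullet> b) * F z) \<xi>))"
proof (rule has_line_derivativeI)
  fix \<xi>
  have [measurable]: "F \<in> borel_measurable borel" using F by simp
  have bb: "b \<bullet> b = 1" using b by (simp add: inner_Basis)
  define \<theta> where "\<theta> z \<eta> = fst z * (norm \<eta>)\<^sup>2 - snd z \<bullet> \<eta>" for z and \<eta> :: 'a
  define \<omega> where "\<omega> z = 2 * fst z * (\<xi> \<bullet> b) - snd z \<bullet> b" for z
  \<comment> \<open>The phase is quadratic along the line: \<open>\<omega> z\<close> is its slope at
    \<open>s = 0\<close>, and the remainder \<open>s\<^sup>2 * fst z\<close> disappears in the
    limit.\<close>
  have \<theta>: "\<theta> z (\<xi> + s *\<^sub>R b) = \<theta> z \<xi> + (s * \<omega> z + s\<^sup>2 * fst z)" for z s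
    unfolding \<theta>_def \<omega>_def power2_norm_eq_inner
    by (simp add: inner_add_left inner_add_right inner_commute[of b \<xi>] bb power2_eq_square algebra_simps)
  have [measurable]: "(\<lambda>z. cis (\<theta> z \<eta>)) \<in> borel_measurable borel" for \<eta>
    unfolding \<theta>_def by (rule paraboloid_phase_measurable)
  have [measurable]: "\<omega> \<in> borel_measurable borel"
    unfolding \<omega>_def[abs_def] by (intro borel_measurable_continuous_onI continuous_intros)
  have [measurable]: "(\<lambda>z::real \<times> 'a. complex_of_real (fst z)) \<in> borel_measurable borel"
    "(\<lambda>z::real \<times> 'a. complex_of_real (snd z \<bullet> b)) \<in> borel_measurable borel"
    by (intro borel_measurable_continuous_onI continuous_intros)+
  have zL: "norm (c * F z) \<le> L * norm (F z)" if "norm c \<le> norm z" for c :: complex and z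
    using that supp[of z] by (cases "L < norm z") (auto simp: norm_mult intro!: mult_right_mono)
  have fst_le: "\<bar>fst z\<bar> \<le> norm z" for z :: "real \<times> 'a"
    by (metis norm_fst_le prod.collapse real_norm_def)
  have snd_le: "\<bar>snd z \<bullet> b\<bar> \<le> norm z" for z :: "real \<times> 'a"
    by (metis Basis_le_norm[OF b] norm_snd_le order_trans prod.collapse)
  have iL: "integrable lborel (\<lambda>z. L * norm (F z))" using F by simp
  have i1: "integrable lborel (\<lambda>z. of_real (fst z) * F z)"
    by (rule Bochner_Integration.integrable_bound[OF iL])
       (measurable, rule AE_I2, rule order_trans[OF zL], simp_all add: fst_le)
  have i2: "integrable lborel (\<lambda>z. of_real (snd z \<bullet> b) * F z)"
    by (rule Bochner_Integration.integrable_bound[OF iL])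
       (measurable, rule AE_I2, rule order_trans[OF zL], simp_all add: snd_le)
  have D: "(\<integral>z. \<i> * of_real (\<omega> z) * cis (\<theta> z \<xi>) * F z \<partial>lborel) =
     \<i> * (2 * of_real (\<xi> \<bullet> b) * paraboloid_fourier (\<lambda>z. of_real (fst z) * F z) \<xi> - paraboloid_fourier (\<lambda>z. of_real (snd z \<bullet> b) * F z) \<xi>)"
  proof -
    have "(\<integral>z. \<i> * of_real (\<omega> z) * cis (\<theta> z \<xi>) * F z \<partial>lborel) =
      (\<integral>z. \<i> * (2 * of_real (\<xi> \<bullet> b) * (cis (\<theta> z \<xi>) * (of_real (fst z) * F z)) - cis (\<theta> z \<xi>) * (of_real (snd z \<bullet> b) * F z)) \<partial>lborel)"
      by (intro Bochner_Integration.integral_cong) (auto simp: \<omega>_def algebra_simps)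
    also have "\<dots> = \<i> * (2 * of_real (\<xi> \<bullet> b) * paraboloid_fourier (\<lambda>z. of_real (fst z) * F z) \<xi> - paraboloid_fourier (\<lambda>z. of_real (snd z \<bullet> b) * F z) \<xi>)"
      using paraboloid_fourier_integrable[OF i1, of \<xi>] paraboloid_fourier_integrable[OF i2, of \<xi>]
      unfolding paraboloid_fourier_def \<theta>_def by (simp add: integral_diff)
    finally show ?thesis .
  qed
  have "((\<lambda>s. (paraboloid_fourier F (\<xi> + s *\<^sub>R b) - paraboloid_fourier F \<xi>) /\<^sub>R s) \<longlongrightarrow>
      (\<integral>z. \<i> * of_real (\<omega> z) * cis (\<theta> z \<xi>) * F z \<partial>lborel)) (at 0)"
    unfolding tendsto_at_iff_sequentially
  proof (intro allI impI)
    fix s :: "nat \<Rightarrow> real" assume s: "\<forall>n. s n \<in> UNIV - {0}" and s0: "s \<longlonglongrightarrow> 0"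
    \<comment> \<open>A null sequence is bounded; \<open>S\<close> controls the quadratic remainder
      of the phase in the majorant.\<close>
    obtain S where S: "\<And>n. \<bar>s n\<bar> \<le> S"
      using convergent_imp_Bseq[OF convergentI[OF s0]] unfolding Bseq_def by auto
    let ?q = "\<lambda>n z. ((cis (\<theta> z (\<xi> + s n *\<^sub>R b)) - cis (\<theta> z \<xi>)) /\<^sub>R s n) * F z"
    have "(\<lambda>n. \<integral>z. ?q n z \<partial>lborel) \<longlonglongrightarrow> (\<integral>z. \<i> * of_real (\<omega> z) * cis (\<theta> z \<xi>) * F z \<partial>lborel)"
    proof (rule integral_dominated_convergence)
      show "integrable lborel (\<lambda>z. (2 * L * \<bar>\<xi> \<bullet> b\<bar> + L + S * L) * norm (F z))" using F by simp
      show "AE z in lborel. (\<lambda>n. ?q n z) \<longlonglongrightarrow> \<i> * of_real (\<omega> z) * cis (\<theta> z \<xi>) * F z"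
      proof (intro AE_I2 tendsto_mult tendsto_const)
        fix z :: "real \<times> 'a"
        have "((\<lambda>u. cis (\<theta> z \<xi> + (u * \<omega> z + u\<^sup>2 * fst z))) has_derivative (\<lambda>u. (u * \<omega> z) *\<^sub>R (\<i> * cis (\<theta> z \<xi> + (0 * \<omega> z + 0\<^sup>2 * fst z))))) (at 0)"
          by (auto intro!: derivative_eq_intros)
        then have "((\<lambda>u. cis (\<theta> z (\<xi> + u *\<^sub>R b))) has_vector_derivative \<i> * of_real (\<omega> z) * cis (\<theta> z \<xi>)) (at 0)"
          unfolding has_vector_derivative_def \<theta> by (simp add: scaleR_conv_of_real mult_ac)
        then have "((\<lambda>u. (cis (\<theta> z (\<xi> + u *\<^sub>R b)) - cis (\<theta> z \<xi>)) /\<^sub>R u) \<longlongrightarrow> \<i> * of_real (\<omega> z) * cis (\<theta> z \<xi>)) (at 0)"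
          unfolding has_vector_derivative_at_quotient by simp
        moreover have "filterlim s (at 0) sequentially"
          using s s0 by (simp add: filterlim_at)
        ultimately show "(\<lambda>n. (cis (\<theta> z (\<xi> + s n *\<^sub>R b)) - cis (\<theta> z \<xi>)) /\<^sub>R s n) \<longlonglongrightarrow> \<i> * of_real (\<omega> z) * cis (\<theta> z \<xi>)"
          by (rule filterlim_compose)
      qed
      show "AE z in lborel. norm (?q n z) \<le> (2 * L * \<bar>\<xi> \<bullet> b\<bar> + L + S * L) * norm (F z)" for n
      proof (rule AE_I2)
        fix z :: "real \<times> 'a"
        show "norm (?q n z) \<le> (2 * L * \<bar>\<xi> \<bullet> b\<bar> + L + S * L) * norm (F z)"
        proof (cases "L < norm z")
          case True
          then show ?thesis by (simp add: supp)
        next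
          case False
          have "\<bar>s n * \<omega> z + (s n)\<^sup>2 * fst z\<bar> = \<bar>s n\<bar> * \<bar>\<omega> z + s n * fst z\<bar>"
            by (simp add: abs_mult[symmetric] power2_eq_square algebra_simps)
          then have "norm ((cis (\<theta> z (\<xi> + s n *\<^sub>R b)) - cis (\<theta> z \<xi>)) /\<^sub>R s n) \<le> \<bar>s n\<bar> * \<bar>\<omega> z + s n * fst z\<bar> / \<bar>s n\<bar>"
            using norm_cis_diff_le[of "\<theta> z \<xi>" "s n * \<omega> z + (s n)\<^sup>2 * fst z"]
            by (simp add: \<theta> divide_inverse mult.commute mult_left_mono)
          also have "\<dots> \<le> \<bar>\<omega> z + s n * fst z\<bar>" by simp
          also have "\<dots> \<le> 2 * (\<bar>fst z\<bar> * \<bar>\<xi> \<bullet> b\<bar>) + \<bar>snd z \<bullet> b\<bar> + \<bar>s n\<bar> * \<bar>fst z\<bar>"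
            unfolding \<omega>_def by (simp add: abs_mult[symmetric])
          also have "\<dots> \<le> 2 * (L * \<bar>\<xi> \<bullet> b\<bar>) + L + S * L"
            using False fst_le[of z] snd_le[of z] S[of n] by (intro add_mono mult_mono mult_left_mono mult_right_mono) auto
          finally show ?thesis
            unfolding norm_mult by (intro mult_right_mono) auto
        qed
      qed
    qed (measurable)
    moreover have "(\<integral>z. ?q n z \<partial>lborel) = (paraboloid_fourier F (\<xi> + s n *\<^sub>R b) - paraboloid_fourier F \<xi>) /\<^sub>R s n" for n
    proof -
      have "(\<integral>z. ?q n z \<partial>lborel) = (\<integral>z. (cis (\<theta> z (\<xi> + s n *\<^sub>R b)) * F z - cis (\<theta> z \<xi>) * F z) /\<^sub>R s n \<partial>lborel)"
        by (intro Bochner_Integration.integral_cong) (auto simp: algebra_simps)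
      also have "\<dots> = (\<integral>z. cis (\<theta> z (\<xi> + s n *\<^sub>R b)) * F z - cis (\<theta> z \<xi>) * F z \<partial>lborel) /\<^sub>R s n"
        by (rule integral_scaleR_right)
      also have "(\<integral>z. cis (\<theta> z (\<xi> + s n *\<^sub>R b)) * F z - cis (\<theta> z \<xi>) * F z \<partial>lborel) = paraboloid_fourier F (\<xi> + s n *\<^sub>R b) - paraboloid_fourier F \<xi>"
        unfolding paraboloid_fourier_def \<theta>_def
        by (rule Bochner_Integration.integral_diff[OF paraboloid_fourier_integrable[OF F] paraboloid_fourier_integrable[OF F]])
      finally show ?thesis .
    qed
    ultimately show "((\<lambda>s. (paraboloid_fourier F (\<xi> + s *\<^sub>R b) - paraboloid_fourier F \<xi>) /\<^sub>R s) \<circ> s) \<longlonglongrightarrow>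
        (\<integral>z. \<i> * of_real (\<omega> z) * cis (\<theta> z \<xi>) * F z \<partial>lborel)"
      by (simp only: o_def)
  qed
  then show "((\<lambda>s. paraboloid_fourier F (\<xi> + s *\<^sub>R b)) has_vector_derivative
    \<i> * (2 * of_real (\<xi> \<bullet> b) * paraboloid_fourier (\<lambda>z. of_real (fst z) * F z) \<xi> - paraboloid_fourier (\<lambda>z. of_real (snd z \<bullet> b) * F z) \<xi>)) (at 0)"
    unfolding has_vector_derivative_at_quotient D by simp
qed

section \<open>Smooth functions and their time slices\<close>

lemma iter_partial_append: "iter_partial (bs @ cs) f = iter_partial bs (iter_partial cs f)"
  by (induction bs) auto

lemma smooth_partial: "smooth f \<Longrightarrow> b \<in> Basis \<Longrightarrow> smooth (iter_partial [b] f)"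
  unfolding smooth_def by (metis (no_types, lifting) Un_subset_iff empty_subsetI insert_subset iter_partial_append list.set set_append)

lemma smooth_differentiable: "smooth f \<Longrightarrow> f differentiable (at x)"
  unfolding smooth_def by (metis empty_set empty_subsetI iter_partial.simps(1))

lemma smooth_continuous_on: "smooth f \<Longrightarrow> continuous_on A f"
  by (meson continuous_at_imp_continuous_on differentiable_imp_continuous_within smooth_differentiable)

lemma partial_vanishes_outside:
  assumes supp: "\<And>z. L < norm z \<Longrightarrow> f z = 0" and z: "L < norm z"
  shows "iter_partial [b] f z = 0"
proof -
  have op: "open {z. L < norm z}" by (intro open_Collect_less continuous_intros)
  have "((\<lambda>_. 0) has_derivative (\<lambda>_. 0)) (at z)" by (rule has_derivative_const)
  then have "(f has_derivative (\<lambda>_. 0)) (at z)"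
    by (rule has_derivative_transform_within_open[OF _ op]) (use z supp in \<open>simp_all only: mem_Collect_eq\<close>)
  then have "frechet_derivative f (at z) = (\<lambda>_. 0)"
    by (rule frechet_derivative_at[symmetric])
  then show ?thesis by simp
qed

lemma has_line_derivative_slice:
  fixes f :: "real \<times> 'a::euclidean_space \<Rightarrow> complex"
  assumes "smooth f"
  shows "has_line_derivative (\<lambda>x. f (t, x)) b (\<lambda>x. iter_partial [(0, b)] f (t, x))"
proof (rule has_line_derivativeI)
  fix x
  have f: "(f has_derivative frechet_derivative f (at (t, x))) (at (t, x + 0 *\<^sub>R b))"
    using smooth_differentiable[OF assms, of "(t, x)"] by (simp add: frechet_derivative_works)
  have "((\<lambda>s. f (t, x + s *\<^sub>R b)) has_derivative (\<lambda>s. frechet_derivative f (at (t, x)) (0, s *\<^sub>R b))) (at 0)"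
    by (rule has_derivative_compose[where f = "\<lambda>s. (t, x + s *\<^sub>R b)" and g = f, OF _ f]) (auto intro!: derivative_eq_intros)
  moreover have "frechet_derivative f (at (t, x)) (0, s *\<^sub>R b) = s *\<^sub>R frechet_derivative f (at (t, x)) (0, b)" for s
    using linear_cmul[OF has_derivative_linear[OF f], of s "(0, b)"] by simp
  ultimately show "((\<lambda>s. f (t, x + s *\<^sub>R b)) has_vector_derivative iter_partial [(0, b)] f (t, x)) (at 0)"
    by (simp add: has_vector_derivative_def)
qed

lemma fourier_eq_cis: "fourier f \<xi> = (\<integral>x. cis (- (x \<bullet> \<xi>)) * f x \<partial>lborel)"
  by (simp add: fourier_def cis_conv_exp)

lemma norm_le_of_snd: "L < norm x \<Longrightarrow> L < norm (t, x)"
  using norm_snd_le[of x t] by simp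

text \<open>Continuity bounds the product on the ball that carries \<open>f\<close>. The bound is
  taken over space-time and is therefore uniform in \<open>t\<close>.\<close>

lemma
  fixes f g :: "real \<times> 'a::euclidean_space \<Rightarrow> complex"
  assumes f: "smooth f" and g: "smooth g" and supp: "\<And>z. L < norm z \<Longrightarrow> f z = 0"
  shows slice_product_bounded: "\<exists>B\<ge>0. \<forall>z. norm (f z * g z) \<le> B"
    and slice_product_measurable: "(\<lambda>x. f (t, x) * g (t, x)) \<in> borel_measurable borel"
    and slice_product_integrable: "integrable lborel (\<lambda>x. f (t, x) * g (t, x))"
    and product_integrable: "integrable lborel (\<lambda>z. f z * g z)"
proof -
  have cont: "continuous_on UNIV (\<lambda>z. f z * g z)"
    by (intro continuous_intros smooth_continuous_on f g)
  obtain B where B: "0 \<le> B" "\<And>z. norm z \<le> L \<Longrightarrow> norm (f z * g z) \<le> B"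
    using bounded_on_cball[OF cont, of L] by metis
  have 1: "norm (f z * g z) \<le> B" for z
    using B supp[of z] by (cases "norm z \<le> L") auto
  then show "\<exists>B\<ge>0. \<forall>z. norm (f z * g z) \<le> B" using B(1) by blast
  show 2: "(\<lambda>x. f (t, x) * g (t, x)) \<in> borel_measurable borel"
    by (intro borel_measurable_continuous_onI continuous_on_compose2[OF cont] continuous_intros) auto
  show "integrable lborel (\<lambda>x. f (t, x) * g (t, x))"
    by (rule integrable_bounded_support[OF 2 1, of L]) (simp add: supp norm_le_of_snd)
  show "integrable lborel (\<lambda>z. f z * g z)"
    by (rule integrable_bounded_support[OF borel_measurable_continuous_onI[OF cont] 1, of L]) (simp add: supp)
qed

text \<open>Multiplication by a frequency coordinate becomes a derivative of the product, and the
  Leibniz rule yields two products of the same kind; hence the induction generalises over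
  \<open>f\<close> and \<open>g\<close>. Partial derivatives in the direction \<open>(0, b)\<close>
  are taken in space-time, which keeps the bounds uniform in \<open>t\<close>.\<close>

lemma fourier_slice_decay:
  fixes f g :: "real \<times> 'a::euclidean_space \<Rightarrow> complex"
  assumes "smooth f" "smooth g" "\<And>z. L < norm z \<Longrightarrow> f z = 0" and b: "b \<in> Basis"
  shows "\<exists>C\<ge>0. \<forall>t \<xi>. \<bar>\<xi> \<bullet> b\<bar> ^ n * norm (fourier (\<lambda>x. f (t, x) * g (t, x)) \<xi>) \<le> C"
  using assms(1-3)
proof (induction n arbitrary: f g)
  case 0
  obtain B where B: "0 \<le> B" "\<And>z. norm (f z * g z) \<le> B"
    using slice_product_bounded[OF 0] by blast
  let ?v = "measure lborel (cball (0::'a) L)"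
  have "norm (fourier (\<lambda>x. f (t, x) * g (t, x)) \<xi>) \<le> B * ?v" for t \<xi>
  proof -
    have "norm (fourier (\<lambda>x. f (t, x) * g (t, x)) \<xi>) \<le> (\<integral>x. norm (f (t, x) * g (t, x)) \<partial>lborel)"
      unfolding fourier_eq_cis by (rule order_trans[OF integral_norm_bound]) (simp add: norm_mult)
    also have "\<dots> \<le> (\<integral>x. B * indicator (cball (0::'a) L) x \<partial>lborel)"
    proof (rule Bochner_Integration.integral_mono)
      show "integrable lborel (\<lambda>x::'a. B * indicator (cball 0 L) x)"
        by (intro integrable_mult_right integrable_real_indicator emeasure_bounded_finite bounded_cball) auto
      show "norm (f (t, x) * g (t, x)) \<le> B * indicator (cball 0 L) x" for x
        using B(2)[of "(t, x)"] 0(3)[OF norm_le_of_snd[of L x t]] by (auto simp: indicator_def)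
    qed (use slice_product_integrable[OF 0] in simp)
    also have "\<dots> = B * ?v" by simp
    finally show ?thesis .
  qed
  then show ?case using B(1) by (intro exI[of _ "B * ?v"]) auto
next
  case (Suc n)
  let ?b = "(0, b) :: real \<times> 'a"
  have bB: "?b \<in> Basis" using b by (simp add: Basis_prod_def)
  let ?f' = "iter_partial [?b] f" and ?g' = "iter_partial [?b] g"
  have f': "smooth ?f'" and g': "smooth ?g'" by (intro smooth_partial Suc.prems bB)+
  have supp': "L < norm z \<Longrightarrow> ?f' z = 0" for z
    by (rule partial_vanishes_outside[OF Suc.prems(3)])
  obtain C1 where C1: "0 \<le> C1" "\<And>t \<xi>. \<bar>\<xi> \<bullet> b\<bar> ^ n * norm (fourier (\<lambda>x. f (t, x) * ?g' (t, x)) \<xi>) \<le> C1"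
    using Suc.IH[OF Suc.prems(1) g' Suc.prems(3)] by blast
  obtain C2 where C2: "0 \<le> C2" "\<And>t \<xi>. \<bar>\<xi> \<bullet> b\<bar> ^ n * norm (fourier (\<lambda>x. ?f' (t, x) * g (t, x)) \<xi>) \<le> C2"
    using Suc.IH[OF f' Suc.prems(2) supp'] by blast
  obtain B0 where B0: "0 \<le> B0" "\<And>z. norm (f z * g z) \<le> B0"
    using slice_product_bounded[OF Suc.prems] by blast
  obtain B1 where B1: "0 \<le> B1" "\<And>z. norm (f z * ?g' z) \<le> B1"
    using slice_product_bounded[OF Suc.prems(1) g' Suc.prems(3)] by blast
  obtain B2 where B2: "0 \<le> B2" "\<And>z. norm (?f' z * g z) \<le> B2"
    using slice_product_bounded[OF f' Suc.prems(2) supp'] by blast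
  have "\<bar>\<xi> \<bullet> b\<bar> ^ Suc n * norm (fourier (\<lambda>x. f (t, x) * g (t, x)) \<xi>) \<le> C1 + C2" for t \<xi>
  proof -
    \<comment> \<open>Taking -\<xi> as the outer variable of the integration by parts formula
      matches the negative sign of the phase in \<open>fourier\<close>.\<close>
    have "of_real (- \<xi> \<bullet> b) * (\<integral>x. cis (- \<xi> \<bullet> x) * (f (t, x) * g (t, x)) \<partial>lborel) =
        \<i> * (\<integral>x. cis (- \<xi> \<bullet> x) * (f (t, x) * ?g' (t, x) + ?f' (t, x) * g (t, x)) \<partial>lborel)"
    proof (rule mult_fourier_line_derivative[where R = L and B = B0 and B' = "B1 + B2"])
      show "has_line_derivative (\<lambda>x. f (t, x) * g (t, x)) b (\<lambda>x. f (t, x) * ?g' (t, x) + ?f' (t, x) * g (t, x))"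
        by (intro has_line_derivative_mult has_line_derivative_slice Suc.prems)
      show "norm (f (t, x) * ?g' (t, x) + ?f' (t, x) * g (t, x)) \<le> B1 + B2" for x
        by (intro order_trans[OF norm_triangle_ineq] add_mono B1(2) B2(2))
      show "(\<lambda>x. f (t, x) * ?g' (t, x) + ?f' (t, x) * g (t, x)) \<in> borel_measurable borel"
        by (intro borel_measurable_add slice_product_measurable[OF Suc.prems(1) g' Suc.prems(3)] slice_product_measurable[OF f' Suc.prems(2) supp'])
    qed (auto simp: B0(2) slice_product_measurable[OF Suc.prems] norm_le_of_snd Suc.prems(3) supp' simp del: iter_partial.simps)
    also have "(\<integral>x. cis (- \<xi> \<bullet> x) * (f (t, x) * ?g' (t, x) + ?f' (t, x) * g (t, x)) \<partial>lborel) =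
        (\<integral>x. cis (- \<xi> \<bullet> x) * (f (t, x) * ?g' (t, x)) \<partial>lborel) + (\<integral>x. cis (- \<xi> \<bullet> x) * (?f' (t, x) * g (t, x)) \<partial>lborel)"
      unfolding distrib_left by (intro Bochner_Integration.integral_add integrable_cis_mult slice_product_integrable[OF Suc.prems(1) g' Suc.prems(3)] slice_product_integrable[OF f' Suc.prems(2) supp'])
    finally have "of_real (- \<xi> \<bullet> b) * fourier (\<lambda>x. f (t, x) * g (t, x)) \<xi> =
       \<i> * (fourier (\<lambda>x. f (t, x) * ?g' (t, x)) \<xi> + fourier (\<lambda>x. ?f' (t, x) * g (t, x)) \<xi>)"
      unfolding fourier_eq_cis by (simp only: inner_minus_left inner_commute[of \<xi>])
    then have "norm (of_real (- \<xi> \<bullet> b) * fourier (\<lambda>x. f (t, x) * g (t, x)) \<xi>) =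
       norm (\<i> * (fourier (\<lambda>x. f (t, x) * ?g' (t, x)) \<xi> + fourier (\<lambda>x. ?f' (t, x) * g (t, x)) \<xi>))"
      by (rule arg_cong)
    then have "\<bar>\<xi> \<bullet> b\<bar> * norm (fourier (\<lambda>x. f (t, x) * g (t, x)) \<xi>) =
       norm (fourier (\<lambda>x. f (t, x) * ?g' (t, x)) \<xi> + fourier (\<lambda>x. ?f' (t, x) * g (t, x)) \<xi>)"
      by (simp only: norm_mult norm_of_real norm_ii mult_1 inner_minus_left abs_minus_cancel)
    then have "\<bar>\<xi> \<bullet> b\<bar> * norm (fourier (\<lambda>x. f (t, x) * g (t, x)) \<xi>) \<le>
       norm (fourier (\<lambda>x. f (t, x) * ?g' (t, x)) \<xi>) + norm (fourier (\<lambda>x. ?f' (t, x) * g (t, x)) \<xi>)"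
      by (rule ord_eq_le_trans[OF _ norm_triangle_ineq])
    then have "\<bar>\<xi> \<bullet> b\<bar> ^ n * (\<bar>\<xi> \<bullet> b\<bar> * norm (fourier (\<lambda>x. f (t, x) * g (t, x)) \<xi>)) \<le>
       \<bar>\<xi> \<bullet> b\<bar> ^ n * (norm (fourier (\<lambda>x. f (t, x) * ?g' (t, x)) \<xi>) + norm (fourier (\<lambda>x. ?f' (t, x) * g (t, x)) \<xi>))"
      by (rule mult_left_mono) simp
    also have "\<dots> \<le> C1 + C2"
      unfolding distrib_left by (intro add_mono C1 C2)
    finally show ?thesis by (simp add: mult_ac)
  qed
  then show ?case using C1(1) C2(1) by (intro exI[of _ "C1 + C2"]) auto
qed

section \<open>An integrable majorant in frequency\<close>

text \<open>A product of one-dimensional integrable functions is chosen instead of a negative power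
  of the bracket, because its integrability follows from the product formula over the
  coordinates.\<close>

definition product_weight :: "'a::euclidean_space \<Rightarrow> real" where
  "product_weight \<xi> = (\<Prod>b\<in>Basis. inverse (1 + (\<xi> \<bullet> b)\<^sup>2))"

lemma product_weight_pos: "0 < product_weight \<xi>"
  unfolding product_weight_def by (intro prod_pos) (auto intro: add_pos_nonneg)

lemma integrable_product_weight: "integrable lborel (product_weight :: 'a::euclidean_space \<Rightarrow> real)"
proof -
  have "integrable lborel (\<lambda>x::real. inverse (1 + x\<^sup>2))"
    using integrable_inverse_1_plus_square by (simp add: set_integrable_def)
  then have "integrable lborel (\<lambda>x::real. complex_of_real (inverse (1 + x\<^sup>2)))"
    by (rule integrable_of_real)
  then have "integrable lborel (\<lambda>x::'a. \<Prod>b\<in>Basis. complex_of_real (inverse (1 + (x \<bullet> b)\<^sup>2)))"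
    by (rule integrable_lborel_prod_Basis)
  then have "integrable lborel (\<lambda>x::'a. Re (\<Prod>b\<in>Basis. complex_of_real (inverse (1 + (x \<bullet> b)\<^sup>2))))"
    by (rule integrable_Re)
  then show ?thesis by (simp add: product_weight_def[abs_def] flip: of_real_prod del: of_real_inverse of_real_add of_real_power)
qed

text \<open>The largest coordinate \<open>c\<close> dominates every factor of the product. Replacing
  it by the sum over all coordinates removes the dependence of \<open>c\<close> on \<xi> and leaves
  the terms that coordinatewise decay controls.\<close>

lemma inverse_product_weight_le:
  "1 / product_weight (\<xi>::'a::euclidean_space) \<le> (\<Sum>b\<in>Basis. 2 ^ DIM('a) * (1 + \<bar>\<xi> \<bullet> b\<bar> ^ (2 * DIM('a))))"
proof -
  define d where "d = DIM('a)"
  obtain c :: 'a where c: "c \<in> Basis" "\<And>b. b \<in> Basis \<Longrightarrow> \<bar>\<xi> \<bullet> b\<bar> \<le> \<bar>\<xi> \<bullet> c\<bar>"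
  proof -
    have "Max ((\<lambda>b. \<bar>\<xi> \<bullet> b\<bar>) ` Basis) \<in> (\<lambda>b. \<bar>\<xi> \<bullet> b\<bar>) ` Basis" by (intro Max_in) auto
    then obtain c where c: "Max ((\<lambda>b. \<bar>\<xi> \<bullet> b\<bar>) ` Basis) = \<bar>\<xi> \<bullet> c\<bar>" "c \<in> Basis"
      by (rule imageE)
    have "\<bar>\<xi> \<bullet> b\<bar> \<le> \<bar>\<xi> \<bullet> c\<bar>" if "b \<in> Basis" for b
      unfolding c(1)[symmetric] using that by (intro Max_ge) auto
    then show ?thesis using c(2) by (rule that[rotated])
  qed
  have "1 / product_weight \<xi> = (\<Prod>b\<in>Basis. 1 + (\<xi> \<bullet> b)\<^sup>2)"
  proof -
    have "inverse (1 + (\<xi> \<bullet> b)\<^sup>2) * (1 + (\<xi> \<bullet> b)\<^sup>2) = 1" for b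
      by (rule left_inverse) (simp add: add_nonneg_eq_0_iff)
    then have "product_weight \<xi> * (\<Prod>b\<in>Basis. 1 + (\<xi> \<bullet> b)\<^sup>2) = 1"
      unfolding product_weight_def prod.distrib[symmetric] by simp
    then show ?thesis using product_weight_pos[of \<xi>] by (simp add: field_simps)
  qed
  also have "\<dots> \<le> (\<Prod>b\<in>(Basis::'a set). 1 + (\<xi> \<bullet> c)\<^sup>2)"
    using c(2) by (intro prod_mono) (auto simp: abs_le_square_iff)
  also have "\<dots> = (1 + (\<xi> \<bullet> c)\<^sup>2) ^ d" by (simp add: d_def)
  also have "\<dots> \<le> 2 ^ d * (1 + \<bar>\<xi> \<bullet> c\<bar> ^ (2 * d))"
  proof (cases "\<bar>\<xi> \<bullet> c\<bar> \<le> 1")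
    case True
    then have "(\<xi> \<bullet> c)\<^sup>2 \<le> 1" by (simp add: abs_square_le_1)
    then have "(1 + (\<xi> \<bullet> c)\<^sup>2) ^ d \<le> 2 ^ d" by (intro power_mono) auto
    also have "\<dots> \<le> 2 ^ d * (1 + \<bar>\<xi> \<bullet> c\<bar> ^ (2 * d))" by simp
    finally show ?thesis .
  next
    case False
    then have "1 \<le> \<bar>\<xi> \<bullet> c\<bar>\<^sup>2" by (intro one_le_power) simp
    then have "(1 + (\<xi> \<bullet> c)\<^sup>2) ^ d \<le> (2 * \<bar>\<xi> \<bullet> c\<bar>\<^sup>2) ^ d" by (intro power_mono) auto
    also have "\<dots> = 2 ^ d * \<bar>\<xi> \<bullet> c\<bar> ^ (2 * d)" by (simp only: power_mult_distrib power_mult)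
    also have "\<dots> \<le> 2 ^ d * (1 + \<bar>\<xi> \<bullet> c\<bar> ^ (2 * d))" by simp
    finally show ?thesis .
  qed
  also have "\<dots> \<le> (\<Sum>b\<in>Basis. 2 ^ d * (1 + \<bar>\<xi> \<bullet> b\<bar> ^ (2 * d)))"
    by (rule member_le_sum[OF c(1), of "\<lambda>b. 2 ^ d * (1 + \<bar>\<xi> \<bullet> b\<bar> ^ (2 * d))"]) auto
  finally show ?thesis by (simp add: d_def)
qed

text \<open>For each coordinate, decay of the orders 0 and \<open>2 * DIM('a)\<close> is combined;
  the constants are then summed over the basis.\<close>

lemma fourier_slice_le_product_weight:
  fixes f g :: "real \<times> 'a::euclidean_space \<Rightarrow> complex"
  assumes f: "smooth f" and g: "smooth g" and supp: "\<And>z. L < norm z \<Longrightarrow> f z = 0"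
  shows "\<exists>C. \<forall>t \<xi>. norm (fourier (\<lambda>x. f (t, x) * g (t, x)) \<xi>) \<le> C * product_weight \<xi>"
proof -
  let ?d = "DIM('a)"
  have ex: "\<forall>b\<in>(Basis::'a set). \<exists>C\<ge>0. \<forall>t \<xi>. 2 ^ ?d * (1 + \<bar>\<xi> \<bullet> b\<bar> ^ (2 * ?d)) * norm (fourier (\<lambda>x. f (t, x) * g (t, x)) \<xi>) \<le> C"
  proof
    fix b :: 'a assume b: "b \<in> Basis"
    obtain C1 where "0 \<le> C1 \<and> (\<forall>t \<xi>. \<bar>\<xi> \<bullet> b\<bar> ^ (2 * ?d) * norm (fourier (\<lambda>x. f (t, x) * g (t, x)) \<xi>) \<le> C1)"
      using fourier_slice_decay[OF f g supp b, where n = "2 * ?d"] by (rule exE)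
    then have C1: "0 \<le> C1" "\<bar>\<xi> \<bullet> b\<bar> ^ (2 * ?d) * norm (fourier (\<lambda>x. f (t, x) * g (t, x)) \<xi>) \<le> C1" for t \<xi>
      by simp_all
    obtain C0 where "0 \<le> C0 \<and> (\<forall>t \<xi>. \<bar>\<xi> \<bullet> b\<bar> ^ 0 * norm (fourier (\<lambda>x. f (t, x) * g (t, x)) \<xi>) \<le> C0)"
      using fourier_slice_decay[OF f g supp b, where n = 0] by (rule exE)
    then have C0: "0 \<le> C0" "\<bar>\<xi> \<bullet> b\<bar> ^ 0 * norm (fourier (\<lambda>x. f (t, x) * g (t, x)) \<xi>) \<le> C0" for t \<xi>
      by simp_all
    have "2 ^ ?d * (1 + \<bar>\<xi> \<bullet> b\<bar> ^ (2 * ?d)) * norm (fourier (\<lambda>x. f (t, x) * g (t, x)) \<xi>) \<le> 2 ^ ?d * (C0 + C1)" for t \<xi>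
      using add_mono[OF C0(2)[of \<xi> t] C1(2)[of \<xi> t]] by (simp add: distrib_right mult.assoc)
    then show "\<exists>C\<ge>0. \<forall>t \<xi>. 2 ^ ?d * (1 + \<bar>\<xi> \<bullet> b\<bar> ^ (2 * ?d)) * norm (fourier (\<lambda>x. f (t, x) * g (t, x)) \<xi>) \<le> C"
      using C0(1) C1(1) by (intro exI[of _ "2 ^ ?d * (C0 + C1)"]) auto
  qed
  obtain C where "\<forall>b\<in>(Basis::'a set). 0 \<le> C b \<and>
      (\<forall>t \<xi>. 2 ^ ?d * (1 + \<bar>\<xi> \<bullet> b\<bar> ^ (2 * ?d)) * norm (fourier (\<lambda>x. f (t, x) * g (t, x)) \<xi>) \<le> C b)"
    using bchoice[OF ex] by (rule exE)
  then have C: "\<And>b. b \<in> (Basis::'a set) \<Longrightarrow> 0 \<le> C b"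
    "\<And>b t \<xi>. b \<in> Basis \<Longrightarrow> 2 ^ ?d * (1 + \<bar>\<xi> \<bullet> b\<bar> ^ (2 * ?d)) * norm (fourier (\<lambda>x. f (t, x) * g (t, x)) \<xi>) \<le> C b"
    by simp_all
  show ?thesis
  proof (intro exI[of _ "sum C Basis"] allI)
    fix t and \<xi> :: 'a
    have "1 / product_weight \<xi> * norm (fourier (\<lambda>x. f (t, x) * g (t, x)) \<xi>) \<le>
        (\<Sum>b\<in>Basis. 2 ^ ?d * (1 + \<bar>\<xi> \<bullet> b\<bar> ^ (2 * ?d))) * norm (fourier (\<lambda>x. f (t, x) * g (t, x)) \<xi>)"
      by (intro mult_right_mono inverse_product_weight_le) simp
    also have "\<dots> \<le> sum C Basis"
      unfolding sum_distrib_right by (intro sum_mono C)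
    finally show "norm (fourier (\<lambda>x. f (t, x) * g (t, x)) \<xi>) \<le> sum C Basis * product_weight \<xi>"
      using product_weight_pos[of \<xi>] by (simp add: field_simps)
  qed
qed

section \<open>The Schroedinger integral as an inverse Fourier transform\<close>

lemma measurable_slice_fourier:
  fixes F :: "real \<times> 'a::euclidean_space \<Rightarrow> complex"
  assumes F: "F \<in> borel_measurable borel"
  shows "(\<lambda>p. fourier (\<lambda>x. F (fst p, x)) (snd p)) \<in> borel_measurable (lborel \<Otimes>\<^sub>M (lborel :: 'a measure))"
proof -
  have F': "F \<in> borel_measurable (borel \<Otimes>\<^sub>M borel)" using F by (simp add: borel_prod)
  have [measurable]: "(\<lambda>q. F (fst (fst q), snd q)) \<in> borel_measurable ((borel \<Otimes>\<^sub>M (borel :: 'a measure)) \<Otimes>\<^sub>M borel)"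
    using measurable_compose[OF _ F', of "\<lambda>q. (fst (fst q), snd q)" "(borel \<Otimes>\<^sub>M borel) \<Otimes>\<^sub>M borel"] by simp
  show ?thesis
    unfolding fourier_eq_cis by (rule lborel.borel_measurable_lebesgue_integral) measurable
qed

text \<open>\<open>Q t\<close> is the spatial transform of the slice at time \<open>t\<close> after
  the evolution. It is dominated by the indicator of \<open>{-L..L}\<close> in time times
  \<open>product_weight\<close> in frequency, so the two integrals may be exchanged; integrating
  \<open>Q\<close> over time gives \<open>paraboloid_fourier F\<close>.\<close>

lemma
  fixes F :: "real \<times> 'a::euclidean_space \<Rightarrow> complex"
  assumes F: "integrable lborel F" and supp: "\<And>z. L < norm z \<Longrightarrow> F z = 0"
    and C: "\<And>t \<xi>. norm (fourier (\<lambda>x. F (t, x)) \<xi>) \<le> C * product_weight \<xi>"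
  shows schroedinger_integral_eq: "schroedinger_integral F x =
      of_real (1 / (2 * pi) ^ DIM('a)) * (\<integral>\<xi>. cis (x \<bullet> \<xi>) * paraboloid_fourier F \<xi> \<partial>lborel)"
    and integrable_paraboloid_fourier: "integrable lborel (paraboloid_fourier F)"
proof -
  have Fm: "F \<in> borel_measurable borel" using F by simp
  define Q where "Q t \<xi> = cis (t * (norm \<xi>)\<^sup>2) * fourier (\<lambda>x. F (t, x)) \<xi>" for t \<xi>
  have [measurable]: "(\<lambda>p. fourier (\<lambda>x. F (fst p, x)) (snd p)) \<in> borel_measurable (borel \<Otimes>\<^sub>M (borel :: 'a measure))"
    using measurable_slice_fourier[OF Fm] by (simp cong: measurable_cong_sets)
  have Q_meas [measurable]: "(\<lambda>p. Q (fst p) (snd p)) \<in> borel_measurable (borel \<Otimes>\<^sub>M (borel :: 'a measure))"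
    unfolding Q_def by measurable
  have Q_le: "norm (Q t \<xi>) \<le> C * indicator {-L..L} t * product_weight \<xi>" for t \<xi>
  proof (cases "\<bar>t\<bar> \<le> L")
    case True
    then show ?thesis using C[of t \<xi>] by (simp add: Q_def norm_mult abs_le_iff)
  next
    case False
    have "F (t, x) = 0" for x
      using False norm_fst_le[of t x] by (intro supp) simp
    then show ?thesis using False by (auto simp: Q_def fourier_def indicator_def abs_le_iff)
  qed
  have ind: "integrable lborel (\<lambda>t. C * indicator {-L..L} t :: real)"
    by (intro integrable_mult_right integrable_real_indicator) (auto simp: emeasure_lborel_Icc_eq)
  \<comment> \<open>The general factor \<open>c\<close> of norm at most 1 covers both uses: the
    constant 1 for integrability and the character for the exchange.\<close>
  have Qi: "integrable (lborel \<Otimes>\<^sub>M (lborel :: 'a measure)) (\<lambda>(t, \<xi>). c t \<xi> * Q t \<xi>)"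
    if [measurable]: "(\<lambda>p. c (fst p) (snd p)) \<in> borel_measurable (borel \<Otimes>\<^sub>M (borel :: 'a measure))"
      and c: "\<And>t \<xi>. norm (c t \<xi>) \<le> 1" for c
  proof (rule integrable_lborel_pair_bound[OF ind integrable_product_weight])
    show "(\<lambda>(t, \<xi>). c t \<xi> * Q t \<xi>) \<in> borel_measurable (lborel \<Otimes>\<^sub>M (lborel :: 'a measure))"
      unfolding split_beta' by measurable
    show "norm (case (t, \<xi>) of (t, \<xi>) \<Rightarrow> c t \<xi> * Q t \<xi>) \<le> C * indicator {-L..L} t * product_weight \<xi>" for t and \<xi> :: 'a
      using mult_mono[OF c[of t \<xi>] order_refl[of "norm (Q t \<xi>)"]] Q_le[of t \<xi>] by (simp add: norm_mult)
  qed
  have par: "paraboloid_fourier F \<xi> = (\<integral>t. Q t \<xi> \<partial>lborel)" for \<xi>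
  proof -
    have i: "integrable (lborel \<Otimes>\<^sub>M lborel) (\<lambda>z. cis (fst z * (norm \<xi>)\<^sup>2 - snd z \<bullet> \<xi>) * F z)"
      using paraboloid_fourier_integrable[OF F] by (simp only: lborel_prod)
    have "paraboloid_fourier F \<xi> = (\<integral>z. cis (fst z * (norm \<xi>)\<^sup>2 - snd z \<bullet> \<xi>) * F z \<partial>(lborel \<Otimes>\<^sub>M lborel))"
      by (simp only: paraboloid_fourier_def lborel_prod)
    also have "\<dots> = (\<integral>t. \<integral>x. cis (fst (t, x) * (norm \<xi>)\<^sup>2 - snd (t, x) \<bullet> \<xi>) * F (t, x) \<partial>lborel \<partial>lborel)"
      by (rule lborel_pair.integral_fst'[OF i, symmetric])
    also have "\<dots> = (\<integral>t. Q t \<xi> \<partial>lborel)"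
    proof (rule Bochner_Integration.integral_cong[OF refl])
      fix t
      have "cis (fst (t, x) * (norm \<xi>)\<^sup>2 - snd (t, x) \<bullet> \<xi>) * F (t, x) = cis (t * (norm \<xi>)\<^sup>2) * (cis (- (x \<bullet> \<xi>)) * F (t, x))" for x
        by (simp only: fst_conv snd_conv cis_mult mult.assoc[symmetric] diff_conv_add_uminus)
      then show "(\<integral>x. cis (fst (t, x) * (norm \<xi>)\<^sup>2 - snd (t, x) \<bullet> \<xi>) * F (t, x) \<partial>lborel) = Q t \<xi>"
        by (simp only: integral_mult_right_zero Q_def fourier_eq_cis)
    qed
    finally show ?thesis .
  qed
  have Q1: "integrable (lborel \<Otimes>\<^sub>M (lborel :: 'a measure)) (\<lambda>(t, \<xi>). Q t \<xi>)"
    using Qi[of "\<lambda>_ _. 1"] by simp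
  have "integrable lborel (\<lambda>\<xi>. \<integral>t. Q t \<xi> \<partial>lborel)"
    by (rule lborel_pair.integrable_snd[OF Q1])
  then show "integrable lborel (paraboloid_fourier F)" unfolding par[abs_def] .
  have Qx: "integrable (lborel \<Otimes>\<^sub>M (lborel :: 'a measure)) (\<lambda>(t, \<xi>). cis (x \<bullet> \<xi>) * Q t \<xi>)"
    by (rule Qi) auto
  have "schroedinger_integral F x = (\<integral>t. of_real (1 / (2 * pi) ^ DIM('a)) * (\<integral>\<xi>. cis (x \<bullet> \<xi>) * Q t \<xi> \<partial>lborel) \<partial>lborel)"
    by (simp add: schroedinger_integral_def schroedinger_def fourier_multiplier_def inverse_fourier_def Q_def cis_conv_exp)
  also have "\<dots> = of_real (1 / (2 * pi) ^ DIM('a)) * (\<integral>t. \<integral>\<xi>. cis (x \<bullet> \<xi>) * Q t \<xi> \<partial>lborel \<partial>lborel)"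
    by (rule integral_mult_right_zero)
  also have "(\<integral>t. \<integral>\<xi>. cis (x \<bullet> \<xi>) * Q t \<xi> \<partial>lborel \<partial>lborel) = (\<integral>\<xi>. \<integral>t. cis (x \<bullet> \<xi>) * Q t \<xi> \<partial>lborel \<partial>lborel)"
    by (rule lborel_pair.Fubini_integral[OF Qx, symmetric])
  also have "\<dots> = (\<integral>\<xi>. cis (x \<bullet> \<xi>) * paraboloid_fourier F \<xi> \<partial>lborel)"
    by (simp only: integral_mult_right_zero par)
  finally show "schroedinger_integral F x =
      of_real (1 / (2 * pi) ^ DIM('a)) * (\<integral>\<xi>. cis (x \<bullet> \<xi>) * paraboloid_fourier F \<xi> \<partial>lborel)" .
qed

text \<open>Inversion is applied to \<open>paraboloid_fourier F\<close>, which is continuous,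
  bounded and integrable. The hypothesis of inversion on the transform is the assumed integrability
  of \<open>schroedinger_integral F\<close>, as the two functions differ by a constant
  factor.\<close>

lemma fourier_schroedinger_integral:
  fixes F :: "real \<times> 'a::euclidean_space \<Rightarrow> complex"
  assumes F: "integrable lborel F" and supp: "\<And>z. L < norm z \<Longrightarrow> F z = 0"
    and C: "\<And>t \<xi>. norm (fourier (\<lambda>x. F (t, x)) \<xi>) \<le> C * product_weight \<xi>"
    and i: "integrable lborel (schroedinger_integral F)"
  shows "fourier (schroedinger_integral F) \<xi> = paraboloid_fourier F \<xi>"
proof -
  let ?c = "complex_of_real (1 / (2 * pi) ^ DIM('a))"
  let ?V = "\<lambda>x. \<integral>\<xi>. cis (x \<bullet> \<xi>) * paraboloid_fourier F \<xi> \<partial>lborel"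
  have eq: "schroedinger_integral F = (\<lambda>x. ?c * ?V x)"
    by (rule ext) (rule schroedinger_integral_eq[OF F supp C])
  have "integrable lborel (\<lambda>x. ?c * ?V x)" using i unfolding eq .
  then have "integrable lborel (\<lambda>x. of_real ((2 * pi) ^ DIM('a)) * (?c * ?V x))"
    by (rule integrable_mult_right)
  then have V: "integrable lborel ?V" by (simp add: mult.assoc[symmetric])
  have "norm (paraboloid_fourier F \<xi>) \<le> (\<integral>z. norm (F z) \<partial>lborel)" for \<xi>
    unfolding paraboloid_fourier_def by (rule order_trans[OF integral_norm_bound]) (simp add: norm_mult)
  from fourier_inversion[OF integrable_paraboloid_fourier[OF F supp C] continuous_on_paraboloid_fourier[OF F] V this]
  have inv: "(\<integral>x. cis (- (x \<bullet> \<xi>)) * ?V x \<partial>lborel) = of_real ((2 * pi) ^ DIM('a)) * paraboloid_fourier F \<xi>" .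
  have "fourier (schroedinger_integral F) \<xi> = (\<integral>x. ?c * (cis (- (x \<bullet> \<xi>)) * ?V x) \<partial>lborel)"
    unfolding fourier_eq_cis eq by (simp only: mult.left_commute)
  also have "\<dots> = ?c * (\<integral>x. cis (- (x \<bullet> \<xi>)) * ?V x \<partial>lborel)"
    by (rule integral_mult_right_zero)
  also have "\<dots> = paraboloid_fourier F \<xi>"
    unfolding inv by simp
  finally show ?thesis .
qed

text \<open>If the function is not integrable, \<^const>\<open>fourier\<close> returns \<open>0\<close>; this is why only an inequality is stated and
  integrability is never proved.\<close>

lemma norm_Lambda_schroedinger_integral_le:
  fixes F :: "real \<times> 'a::euclidean_space \<Rightarrow> complex"
  assumes F: "integrable lborel F" and supp: "\<And>z. L < norm z \<Longrightarrow> F z = 0"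
    and C: "\<And>t \<xi>. norm (fourier (\<lambda>x. F (t, x)) \<xi>) \<le> C * product_weight \<xi>"
  shows "norm (Lambda \<gamma> (schroedinger_integral F) x) \<le>
    norm (\<integral>\<xi>. cis (x \<bullet> \<xi>) * (of_real (bracket_sq \<xi> powr (\<gamma> / 2)) * paraboloid_fourier F \<xi>) \<partial>lborel)"
proof (cases "integrable lborel (schroedinger_integral F)")
  case True
  have "(1::real) \<le> (2 * pi) ^ DIM('a)" using pi_ge_two by (intro one_le_power) linarith
  then have "1 / (2 * pi) ^ DIM('a) \<le> 1" by simp
  moreover have "Lambda \<gamma> (schroedinger_integral F) x = of_real (1 / (2 * pi) ^ DIM('a)) *
      (\<integral>\<xi>. cis (x \<bullet> \<xi>) * (of_real (bracket_sq \<xi> powr (\<gamma> / 2)) * paraboloid_fourier F \<xi>) \<partial>lborel)"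
    by (simp add: Lambda_def fourier_multiplier_def inverse_fourier_def cis_conv_exp bracket_sq_def
        fourier_schroedinger_integral[OF F supp C True])
  ultimately show ?thesis
    by (simp only: norm_mult norm_of_real) (intro mult_left_le_one_le, auto)
next
  case False
  then have "fourier (schroedinger_integral F) \<xi> = 0" for \<xi>
    using integral_cis_mult_eq_0[of "schroedinger_integral F" "- \<xi>"] by (simp add: fourier_eq_cis inner_commute)
  then show ?thesis by (simp add: Lambda_def fourier_multiplier_def inverse_fourier_def)
qed

lemma has_line_derivative_bracket_powr:
  "has_line_derivative (\<lambda>\<xi>. bracket_sq \<xi> powr s) b (\<lambda>\<xi>. s * bracket_sq \<xi> powr (s - 1) * (2 * (\<xi> \<bullet> b)))"
  by (rule has_line_derivative_chain[OF has_line_derivative_bracket_sq, of "\<lambda>y. y powr s" "\<lambda>y. s * y powr (s - 1)"])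
     (rule has_real_derivative_powr, simp)

section \<open>The weighted estimate\<close>

lemma norm_sum3_sq_le:
  fixes x y z :: "'a::real_normed_vector"
  shows "(norm (x + y + z))\<^sup>2 \<le> 4 * (norm x)\<^sup>2 + 4 * (norm y)\<^sup>2 + 2 * (norm z)\<^sup>2"
  using norm_add_sq_le[of "x + y" z] norm_add_sq_le[of x y] by linarith

text \<open>Each derivative of the symbol \<open>bracket_sq \<xi> powr (\<gamma> / 2)\<close> gains a factor \<open>1 / |\<xi>|\<close>, while each
  derivative of the phase \<open>t |\<xi>|\<^sup>2 - x \<bullet> \<xi>\<close> on a bounded set loses a factor \<open>|\<xi>|\<close>.\<close>

lemma gradient_energy_le:
  fixes A At :: complex and Ab :: "'a::euclidean_space \<Rightarrow> complex" and \<xi> :: 'a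
  shows "bracket_sq \<xi> powr \<alpha> * (norm (of_real (bracket_sq \<xi> powr (\<gamma> / 2)) * A))\<^sup>2 + bracket_sq \<xi> powr (\<alpha> - 1) *
     (\<Sum>b\<in>Basis. (norm (of_real (bracket_sq \<xi> powr (\<gamma> / 2)) * (\<i> * (2 * of_real (\<xi> \<bullet> b) * At - Ab b)) +
        of_real (\<gamma> / 2 * bracket_sq \<xi> powr (\<gamma> / 2 - 1) * (2 * (\<xi> \<bullet> b))) * A))\<^sup>2) \<le>
    (17 + 2 * \<gamma>\<^sup>2) * (bracket_sq \<xi> powr (\<alpha> + \<gamma>) * ((norm A)\<^sup>2 + (norm At)\<^sup>2 + (\<Sum>b\<in>Basis. (norm (Ab b))\<^sup>2)))"
proof -
  define J where "J = bracket_sq \<xi>"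
  have J: "0 < J" "1 \<le> J" by (simp_all add: J_def)
  define S where "S = (\<Sum>b\<in>Basis. (norm (Ab b))\<^sup>2)"
  have S0: "0 \<le> S" by (simp add: S_def sum_nonneg)
  have xJ: "(norm \<xi>)\<^sup>2 \<le> J" by (simp add: J_def bracket_sq_def)
  have sq: "(J powr s)\<^sup>2 = J powr (2 * s)" for s
    by (simp add: power2_eq_square powr_add[symmetric])
  have summand: "(norm (of_real (J powr (\<gamma> / 2)) * (\<i> * (2 * of_real (\<xi> \<bullet> b) * At - Ab b)) +
        of_real (\<gamma> / 2 * J powr (\<gamma> / 2 - 1) * (2 * (\<xi> \<bullet> b))) * A))\<^sup>2 \<le>
      (16 * J powr \<gamma> * (norm At)\<^sup>2 + 2 * \<gamma>\<^sup>2 * J powr (\<gamma> - 2) * (norm A)\<^sup>2) * (\<xi> \<bullet> b)\<^sup>2 + 4 * J powr \<gamma> * (norm (Ab b))\<^sup>2" for b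
  proof -
    let ?x = "of_real (J powr (\<gamma> / 2)) * (\<i> * (2 * of_real (\<xi> \<bullet> b) * At))"
    let ?y = "of_real (J powr (\<gamma> / 2)) * (- \<i> * Ab b)"
    let ?z = "of_real (\<gamma> / 2 * J powr (\<gamma> / 2 - 1) * (2 * (\<xi> \<bullet> b))) * A"
    have "of_real (J powr (\<gamma> / 2)) * (\<i> * (2 * of_real (\<xi> \<bullet> b) * At - Ab b)) + ?z = ?x + ?y + ?z"
      by (simp add: algebra_simps)
    moreover have "(norm ?x)\<^sup>2 = 4 * J powr \<gamma> * (norm At)\<^sup>2 * (\<xi> \<bullet> b)\<^sup>2"
      by (simp add: norm_mult power_mult_distrib sq)
    moreover have "(norm ?y)\<^sup>2 = J powr \<gamma> * (norm (Ab b))\<^sup>2"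
      by (simp add: norm_mult power_mult_distrib sq)
    moreover have "(norm ?z)\<^sup>2 = \<gamma>\<^sup>2 * J powr (\<gamma> - 2) * (norm A)\<^sup>2 * (\<xi> \<bullet> b)\<^sup>2"
    proof -
      have "?z = of_real (\<gamma> * J powr (\<gamma> / 2 - 1) * (\<xi> \<bullet> b)) * A" by simp
      then have "(norm ?z)\<^sup>2 = (\<gamma> * J powr (\<gamma> / 2 - 1) * (\<xi> \<bullet> b))\<^sup>2 * (norm A)\<^sup>2"
        by (simp only: norm_mult norm_of_real power_mult_distrib power2_abs)
      moreover have "2 * (\<gamma> / 2 - 1) = \<gamma> - 2" by simp
      ultimately show ?thesis by (simp only: power_mult_distrib sq mult_ac)
    qed
    ultimately show ?thesis
      using norm_sum3_sq_le[of ?x ?y ?z] by (simp only: distrib_right mult.assoc mult.commute) (simp add: algebra_simps)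
  qed
  have "J powr (\<alpha> - 1) * (\<Sum>b\<in>Basis. (norm (of_real (J powr (\<gamma> / 2)) * (\<i> * (2 * of_real (\<xi> \<bullet> b) * At - Ab b)) +
        of_real (\<gamma> / 2 * J powr (\<gamma> / 2 - 1) * (2 * (\<xi> \<bullet> b))) * A))\<^sup>2) \<le>
     J powr (\<alpha> - 1) * (\<Sum>b\<in>Basis. (16 * J powr \<gamma> * (norm At)\<^sup>2 + 2 * \<gamma>\<^sup>2 * J powr (\<gamma> - 2) * (norm A)\<^sup>2) * (\<xi> \<bullet> b)\<^sup>2 + 4 * J powr \<gamma> * (norm (Ab b))\<^sup>2)"
    by (intro mult_left_mono sum_mono summand) simp
  also have "\<dots> = J powr (\<alpha> - 1) * ((16 * J powr \<gamma> * (norm At)\<^sup>2 + 2 * \<gamma>\<^sup>2 * J powr (\<gamma> - 2) * (norm A)\<^sup>2) * (norm \<xi>)\<^sup>2 + 4 * J powr \<gamma> * S)"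
    by (simp only: sum.distrib sum_distrib_left[symmetric] sum_inner_sq_Basis S_def)
  \<comment> \<open>The factor \<open>(norm \<xi>)\<^sup>2\<close> \<le> \<open>J\<close> produced
    by the phase restores \<open>J powr (\<alpha> - 1)\<close> to \<open>J powr \<alpha>\<close>:
    the gradient term ends with the same power as the term without derivative.\<close>
  also have "\<dots> \<le> J powr (\<alpha> - 1) * ((16 * J powr \<gamma> * (norm At)\<^sup>2 + 2 * \<gamma>\<^sup>2 * J powr (\<gamma> - 2) * (norm A)\<^sup>2) * J + 4 * J powr \<gamma> * S)"
    by (intro mult_left_mono add_right_mono xJ) auto
  also have "\<dots> = 16 * (J powr (\<alpha> - 1) * J powr \<gamma> * J) * (norm At)\<^sup>2 + 2 * \<gamma>\<^sup>2 * (J powr (\<alpha> - 1) * J powr (\<gamma> - 2) * J) * (norm A)\<^sup>2 + 4 * (J powr (\<alpha> - 1) * J powr \<gamma>) * S"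
    by (simp add: algebra_simps)
  also have "J powr (\<alpha> - 1) * J powr \<gamma> * J = J powr (\<alpha> + \<gamma>)"
  proof -
    have "J powr (\<alpha> - 1) * J powr \<gamma> * J powr 1 = J powr (\<alpha> - 1 + \<gamma> + 1)" by (simp only: powr_add)
    then show ?thesis using J by simp
  qed
  also have "J powr (\<alpha> - 1) * J powr (\<gamma> - 2) * J = J powr (\<alpha> + \<gamma> - 2)"
  proof -
    have "J powr (\<alpha> - 1) * J powr (\<gamma> - 2) * J powr 1 = J powr (\<alpha> - 1 + (\<gamma> - 2) + 1)" by (simp only: powr_add)
    then show ?thesis using J by (simp add: algebra_simps)
  qed
  also have "J powr (\<alpha> - 1) * J powr \<gamma> = J powr (\<alpha> + \<gamma> - 1)"
    by (simp add: powr_add[symmetric] algebra_simps)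
  also have "16 * J powr (\<alpha> + \<gamma>) * (norm At)\<^sup>2 + 2 * \<gamma>\<^sup>2 * J powr (\<alpha> + \<gamma> - 2) * (norm A)\<^sup>2 + 4 * J powr (\<alpha> + \<gamma> - 1) * S \<le>
      16 * J powr (\<alpha> + \<gamma>) * (norm At)\<^sup>2 + 2 * \<gamma>\<^sup>2 * J powr (\<alpha> + \<gamma>) * (norm A)\<^sup>2 + 4 * J powr (\<alpha> + \<gamma>) * S"
    using J S0 by (intro add_mono mult_right_mono mult_left_mono powr_mono) auto
  finally have grad: "J powr (\<alpha> - 1) * (\<Sum>b\<in>Basis. (norm (of_real (J powr (\<gamma> / 2)) * (\<i> * (2 * of_real (\<xi> \<bullet> b) * At - Ab b)) +
        of_real (\<gamma> / 2 * J powr (\<gamma> / 2 - 1) * (2 * (\<xi> \<bullet> b))) * A))\<^sup>2) \<le>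
      16 * J powr (\<alpha> + \<gamma>) * (norm At)\<^sup>2 + 2 * \<gamma>\<^sup>2 * J powr (\<alpha> + \<gamma>) * (norm A)\<^sup>2 + 4 * J powr (\<alpha> + \<gamma>) * S" .
  have zero: "J powr \<alpha> * (norm (of_real (J powr (\<gamma> / 2)) * A))\<^sup>2 = J powr (\<alpha> + \<gamma>) * (norm A)\<^sup>2"
    by (simp add: norm_mult power_mult_distrib sq powr_add)
  define X Y Z where "X = J powr (\<alpha> + \<gamma>) * (norm At)\<^sup>2" and "Y = J powr (\<alpha> + \<gamma>) * (norm A)\<^sup>2"
    and "Z = J powr (\<alpha> + \<gamma>) * S"
  have nonneg: "0 \<le> X" "0 \<le> Y" "0 \<le> Z" "0 \<le> \<gamma>\<^sup>2 * X" "0 \<le> \<gamma>\<^sup>2 * Z"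
    using S0 by (simp_all add: X_def Y_def Z_def)
  have "J powr \<alpha> * (norm (of_real (J powr (\<gamma> / 2)) * A))\<^sup>2 + (16 * J powr (\<alpha> + \<gamma>) * (norm At)\<^sup>2 + 2 * \<gamma>\<^sup>2 * J powr (\<alpha> + \<gamma>) * (norm A)\<^sup>2 + 4 * J powr (\<alpha> + \<gamma>) * S) =
      Y + 16 * X + 2 * (\<gamma>\<^sup>2 * Y) + 4 * Z"
    unfolding zero by (simp add: X_def Y_def Z_def)
  \<comment> \<open>The coefficients 1, 16 and 4 are all raised to 17, and the term with
    \<open>\<gamma>\<^sup>2\<close> is granted to all three quantities, so that one factor can be
    taken out.\<close>
  also have "\<dots> \<le> 17 * Y + 17 * X + 17 * Z + 2 * (\<gamma>\<^sup>2 * Y) + 2 * (\<gamma>\<^sup>2 * X) + 2 * (\<gamma>\<^sup>2 * Z)"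
    using nonneg by linarith
  also have "\<dots> = (17 + 2 * \<gamma>\<^sup>2) * (J powr (\<alpha> + \<gamma>) * ((norm A)\<^sup>2 + (norm At)\<^sup>2 + S))"
    by (simp add: X_def Y_def Z_def algebra_simps)
  finally have "J powr \<alpha> * (norm (of_real (J powr (\<gamma> / 2)) * A))\<^sup>2 + (16 * J powr (\<alpha> + \<gamma>) * (norm At)\<^sup>2 + 2 * \<gamma>\<^sup>2 * J powr (\<alpha> + \<gamma>) * (norm A)\<^sup>2 + 4 * J powr (\<alpha> + \<gamma>) * S) \<le>
     (17 + 2 * \<gamma>\<^sup>2) * (J powr (\<alpha> + \<gamma>) * ((norm A)\<^sup>2 + (norm At)\<^sup>2 + S))" .
  with grad show ?thesis unfolding J_def[symmetric] S_def[symmetric] by linarith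
qed

section \<open>Assembly of the estimate\<close>

lemma test_function_support:
  fixes f :: "'a::euclidean_space \<Rightarrow> complex"
  assumes "test_function f"
  obtains L where "0 \<le> L" "\<And>z. L < norm z \<Longrightarrow> f z = 0"
proof -
  have "bounded {x. f x \<noteq> 0}"
    using assms unfolding test_function_def by (meson bounded_subset closure_subset compact_imp_bounded)
  then obtain B where "\<forall>x\<in>{x. f x \<noteq> 0}. norm x \<le> B" unfolding bounded_iff by blast
  then show ?thesis by (intro that[of "max 0 B"]) force+
qed

text \<open>The finite bound excludes the infinite branch of \<open>Lp_norm\<close>; the rest is a
  square root.\<close>

lemma Lp_norm_2_le:
  assumes "(\<integral>\<^sup>+x. ennreal ((norm (f x))\<^sup>2) \<partial>lborel) \<le> ennreal (K\<^sup>2)" "0 \<le> K"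
  shows "Lp_norm 2 f \<le> ennreal K"
proof -
  define I where "I = (\<integral>\<^sup>+x. ennreal (norm (f x) powr 2) \<partial>lborel)"
  have I: "I \<le> ennreal (K\<^sup>2)" using assms(1) by (simp add: I_def powr_numeral)
  then have "enn2real I \<le> K\<^sup>2" by (metis enn2real_mono enn2real_ennreal ennreal_less_top zero_le_power2)
  then have "enn2real I powr (1/2) \<le> K"
    using assms(2) by (simp add: powr_half_sqrt real_le_lsqrt)
  moreover have "I \<noteq> \<infinity>" using I by (auto simp: top_unique)
  ultimately show ?thesis
    unfolding Lp_norm_def I_def[symmetric] Let_def by (simp add: ennreal_leI)
qed

lemma has_line_derivative_symbol_paraboloid_fourier:
  fixes F :: "real \<times> 'a::euclidean_space \<Rightarrow> complex"
  assumes F: "integrable lborel F" and supp: "\<And>z. L < norm z \<Longrightarrow> F z = 0" and b: "b \<in> Basis"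
  shows "has_line_derivative (\<lambda>\<xi>. of_real (bracket_sq \<xi> powr s) * paraboloid_fourier F \<xi>) b
    (\<lambda>\<xi>. of_real (bracket_sq \<xi> powr s) * (\<i> * (2 * of_real (\<xi> \<bullet> b) * paraboloid_fourier (\<lambda>z. of_real (fst z) * F z) \<xi> -
        paraboloid_fourier (\<lambda>z. of_real (snd z \<bullet> b) * F z) \<xi>)) +
      of_real (s * bracket_sq \<xi> powr (s - 1) * (2 * (\<xi> \<bullet> b))) * paraboloid_fourier F \<xi>)"
  by (rule has_line_derivative_mult[OF has_line_derivative_of_real[OF has_line_derivative_bracket_powr]
      has_line_derivative_paraboloid_fourier[OF F supp b]])

text \<open>Let \<open>h\<close> be the symbol times A F. The weighted Plancherel inequality reduces
  the left side to \<open>h\<close> and its gradient, and these to A applied to F and to its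
  products with t and the coordinates of x. Each such amplitude is \<phi> times a continuous
  multiple of \<open>chi\<close>, so the restriction estimate with \<sigma> = \<alpha> + \<gamma>
  treats them all. Strict positivity of the constant serves the case in which the norm of \<phi> is
  infinite.\<close>

lemma weighted_Lambda_estimate:
  fixes chi :: "real \<times> 'a::euclidean_space \<Rightarrow> complex" and \<alpha> \<gamma> p :: real
  assumes cutoff: "test_function chi" and alpha: "0 < \<alpha>" "\<alpha> \<le> 1/2" and p: "1 < p" "p \<le> 2"
    and \<sigma>: "0 \<le> \<alpha> + \<gamma>"
    and exponents: "p = 2 \<and> \<alpha> + \<gamma> \<le> 1/2 \<or>
      2 * (\<alpha> + \<gamma>) + real DIM('a) - 2 * (real DIM('a) + 1) * (1 - 1 / p) < 0"
  shows "\<exists>C>0. \<forall>\<phi> :: real \<times> 'a \<Rightarrow> complex. schwartz \<phi> \<longrightarrow>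
    (\<integral>\<^sup>+z. ennreal (norm (\<phi> z) powr p) \<partial>lborel) \<noteq> \<infinity> \<longrightarrow>
    Lp_norm 2 (\<lambda>x. of_real (norm x powr \<alpha> + 1) * Lambda \<gamma> (schroedinger_integral (\<lambda>z. chi z * \<phi> z)) x)
      \<le> ennreal (C * enn2real (\<integral>\<^sup>+z. ennreal (norm (\<phi> z) powr p) \<partial>lborel) powr (1 / p))"
proof -
  have chi: "smooth chi" using cutoff by (simp add: test_function_def)
  then have chi_cont: "continuous_on UNIV chi" by (rule smooth_continuous_on)
  obtain L where L: "0 \<le> L" and supp: "\<And>z. L < norm z \<Longrightarrow> chi z = 0"
    by (rule test_function_support[OF cutoff]) blast
  define I where "I \<phi> = (\<integral>\<^sup>+z. ennreal (norm (\<phi> z) powr p) \<partial>lborel)" for \<phi> :: "real \<times> 'a \<Rightarrow> complex"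
  define E where "E F = (\<integral>\<^sup>+\<xi>. ennreal (bracket_sq \<xi> powr (\<alpha> + \<gamma>)) * ennreal ((norm (paraboloid_fourier F \<xi>))\<^sup>2) \<partial>lborel)"
    for F :: "real \<times> 'a \<Rightarrow> complex"
  \<comment> \<open>The implication under the existential quantifier provides a constant for every
    \<open>k\<close>, continuous or not, so that the axiom of choice yields one function
    \<open>c\<close> of \<open>k\<close>, selected before \<phi>.\<close>
  have "\<exists>C. 0 \<le> C \<and> (continuous_on UNIV k \<longrightarrow> (\<forall>\<phi> B. \<phi> \<in> borel_measurable borel \<longrightarrow> (\<forall>z. norm (\<phi> z) \<le> B) \<longrightarrow>
      I \<phi> \<noteq> \<infinity> \<longrightarrow> E (\<lambda>z. k z * chi z * \<phi> z) \<le> ennreal (C * (enn2real (I \<phi>) powr (1 / p))\<^sup>2)))"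
    for k :: "real \<times> 'a \<Rightarrow> complex"
  proof (cases "continuous_on UNIV k")
    case True
    then have m: "continuous_on UNIV (\<lambda>z. k z * chi z)" by (intro continuous_on_mult chi_cont)
    obtain M where M: "0 \<le> M" "\<And>z. norm z \<le> L \<Longrightarrow> norm (k z * chi z) \<le> M"
      using bounded_on_cball[OF m, of L] by metis
    have mM: "norm (k z * chi z) \<le> M" for z
      using M supp[of z] by (cases "norm z \<le> L") auto
    have msupp: "k z * chi z = 0" if "L < norm z" for z using supp[OF that] by simp
    show ?thesis
      using restriction_estimate[OF borel_measurable_continuous_onI[OF m] mM L msupp p \<sigma> exponents] True
      unfolding I_def E_def by simp
  qed auto
  then have "\<forall>k :: real \<times> 'a \<Rightarrow> complex. \<exists>C. 0 \<le> C \<and> (continuous_on UNIV k \<longrightarrow> (\<forall>\<phi> B. \<phi> \<in> borel_measurable borel \<longrightarrow> (\<forall>z. norm (\<phi> z) \<le> B) \<longrightarrow>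
      I \<phi> \<noteq> \<infinity> \<longrightarrow> E (\<lambda>z. k z * chi z * \<phi> z) \<le> ennreal (C * (enn2real (I \<phi>) powr (1 / p))\<^sup>2)))"
    by (rule allI)
  from choice[OF this] obtain c where "\<forall>k :: real \<times> 'a \<Rightarrow> complex. 0 \<le> c k \<and> (continuous_on UNIV k \<longrightarrow> (\<forall>\<phi> B. \<phi> \<in> borel_measurable borel \<longrightarrow> (\<forall>z. norm (\<phi> z) \<le> B) \<longrightarrow>
      I \<phi> \<noteq> \<infinity> \<longrightarrow> E (\<lambda>z. k z * chi z * \<phi> z) \<le> ennreal (c k * (enn2real (I \<phi>) powr (1 / p))\<^sup>2)))"
    by (rule exE)
  then have c0: "0 \<le> c k" and c: "continuous_on UNIV k \<Longrightarrow> \<phi> \<in> borel_measurable borel \<Longrightarrow> (\<And>z. norm (\<phi> z) \<le> B) \<Longrightarrow>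
      I \<phi> \<noteq> \<infinity> \<Longrightarrow> E (\<lambda>z. k z * chi z * \<phi> z) \<le> ennreal (c k * (enn2real (I \<phi>) powr (1 / p))\<^sup>2)" for k \<phi> B
    by blast+
  define C0 where "C0 = c (\<lambda>_. 1)"
  define Ct where "Ct = c (\<lambda>z. of_real (fst z))"
  define Cb where "Cb b = c (\<lambda>z. of_real (snd z \<bullet> b))" for b
  define D where "D = C0 + Ct + (\<Sum>b\<in>(Basis::'a set). Cb b)"
  have D0: "0 \<le> D" by (simp add: D_def C0_def Ct_def Cb_def c0 sum_nonneg)
  define P where "P = 152 * (2 * pi) ^ DIM('a)"
  have P0: "0 \<le> P" by (simp add: P_def)
  \<comment> \<open>The square root undoes the square in the energy bound; the summand 1 makes
    \<open>K\<close> positive even when the estimate constants vanish.\<close>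
  define K where "K = sqrt (P * ((17 + 2 * \<gamma>\<^sup>2) * D)) + 1"
  have PD: "0 \<le> P * ((17 + 2 * \<gamma>\<^sup>2) * D)" using P0 D0 by (intro mult_nonneg_nonneg) auto
  then have K0: "0 < K" unfolding K_def by (simp add: add_nonneg_pos)
  have K2: "P * ((17 + 2 * \<gamma>\<^sup>2) * D) \<le> K\<^sup>2"
    using PD by (simp add: K_def power2_sum)
  show ?thesis
  proof (intro exI[of _ K] conjI allI impI K0)
    fix \<phi> :: "real \<times> 'a \<Rightarrow> complex"
    assume schwartz: "schwartz \<phi>" and fin: "(\<integral>\<^sup>+z. ennreal (norm (\<phi> z) powr p) \<partial>lborel) \<noteq> \<infinity>"
    have finI: "I \<phi> \<noteq> \<infinity>" using fin by (simp add: I_def)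
    have \<phi>: "smooth \<phi>" using schwartz by (simp add: schwartz_def)
    \<comment> \<open>The Schwartz seminorm with no derivative and exponent 0 is the supremum of
      |\<phi>|.\<close>
    have "\<exists>B. \<forall>x. norm x ^ 0 * norm (iter_partial [] \<phi> x) \<le> B"
      using schwartz unfolding schwartz_def by (metis empty_set empty_subsetI)
    then obtain B where B: "\<And>z. norm (\<phi> z) \<le> B" by auto
    have [measurable]: "\<phi> \<in> borel_measurable borel"
      by (intro borel_measurable_continuous_onI smooth_continuous_on \<phi>)
    define N where "N = enn2real (\<integral>\<^sup>+z. ennreal (norm (\<phi> z) powr p) \<partial>lborel) powr (1 / p)"
    define F where "F z = chi z * \<phi> z" for z
    have F: "integrable lborel F"
      unfolding F_def[abs_def] by (rule product_integrable[OF chi \<phi> supp])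
    have Fsupp: "F z = 0" if "L < norm z" for z using supp[OF that] by (simp add: F_def)
    obtain C where "\<forall>t \<xi>. norm (fourier (\<lambda>x. F (t, x)) \<xi>) \<le> C * product_weight \<xi>"
      unfolding F_def using fourier_slice_le_product_weight[OF chi \<phi> supp] by (rule exE)
    then have C: "norm (fourier (\<lambda>x. F (t, x)) \<xi>) \<le> C * product_weight \<xi>" for t \<xi>
      by simp
    define h where "h \<xi> = of_real (bracket_sq \<xi> powr (\<gamma> / 2)) * paraboloid_fourier F \<xi>" for \<xi>
    define At where "At = paraboloid_fourier (\<lambda>z. of_real (fst z) * F z)"
    define Ab where "Ab b = paraboloid_fourier (\<lambda>z. of_real (snd z \<bullet> b) * F z)" for b
    define h' where "h' b \<xi> = of_real (bracket_sq \<xi> powr (\<gamma> / 2)) * (\<i> * (2 * of_real (\<xi> \<bullet> b) * At \<xi> - Ab b \<xi>)) +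
        of_real (\<gamma> / 2 * bracket_sq \<xi> powr (\<gamma> / 2 - 1) * (2 * (\<xi> \<bullet> b))) * paraboloid_fourier F \<xi>" for b \<xi>
    have int_mult: "integrable lborel (\<lambda>z. k z * F z)" if k: "continuous_on UNIV k" for k :: "real \<times> 'a \<Rightarrow> complex"
    proof -
      have c: "continuous_on UNIV (\<lambda>z. k z * F z)"
        unfolding F_def by (intro continuous_on_mult k chi_cont smooth_continuous_on \<phi>)
      obtain M where M: "0 \<le> M" "\<And>z. norm z \<le> L \<Longrightarrow> norm (k z * F z) \<le> M"
        using bounded_on_cball[OF c, of L] by metis
      have "norm (k z * F z) \<le> M" for z using M Fsupp[of z] by (cases "norm z \<le> L") auto
      then show ?thesis
        by (rule integrable_bounded_support[OF borel_measurable_continuous_onI[OF c], where L = L]) (simp add: Fsupp)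
    qed
    have A_cont: "continuous_on UNIV (paraboloid_fourier F)" "continuous_on UNIV At" "continuous_on UNIV (Ab b)" for b
      unfolding At_def Ab_def by (intro continuous_on_paraboloid_fourier int_mult F continuous_intros)+
    have [measurable]: "paraboloid_fourier F \<in> borel_measurable borel" "At \<in> borel_measurable borel" "Ab b \<in> borel_measurable borel" for b
      by (intro borel_measurable_continuous_onI A_cont)+
    have pos: "bracket_sq \<xi> \<noteq> 0" for \<xi> :: 'a using bracket_sq_pos[of \<xi>] by linarith
    have h_cont: "continuous_on UNIV h" and h'_cont: "continuous_on UNIV (h' b)" for b
      unfolding h_def[abs_def] h'_def[abs_def] using pos by (intro continuous_intros A_cont; simp)+
    have h_der: "has_line_derivative h b (h' b)" if "b \<in> Basis" for b
      unfolding h_def[abs_def] h'_def[abs_def] At_def Ab_def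
      by (rule has_line_derivative_symbol_paraboloid_fourier[OF F Fsupp that])
    let ?E = "\<lambda>\<xi>. (norm (paraboloid_fourier F \<xi>))\<^sup>2 + (norm (At \<xi>))\<^sup>2 + (\<Sum>b\<in>Basis. (norm (Ab b \<xi>))\<^sup>2)"
    let ?G = "\<lambda>x. \<integral>\<xi>. cis (x \<bullet> \<xi>) * h \<xi> \<partial>lborel"
    have energy: "(\<integral>\<^sup>+\<xi>. ennreal (bracket_sq \<xi> powr (\<alpha> + \<gamma>)) * ennreal (?E \<xi>) \<partial>lborel) \<le> ennreal (D * N\<^sup>2)"
    proof -
      let ?w = "\<lambda>\<xi>::'a. ennreal (bracket_sq \<xi> powr (\<alpha> + \<gamma>))"
      have "(\<integral>\<^sup>+\<xi>. ?w \<xi> * ennreal (?E \<xi>) \<partial>lborel) =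
        (\<integral>\<^sup>+\<xi>. ?w \<xi> * ennreal ((norm (paraboloid_fourier F \<xi>))\<^sup>2) + (?w \<xi> * ennreal ((norm (At \<xi>))\<^sup>2) +
          (\<Sum>b\<in>Basis. ?w \<xi> * ennreal ((norm (Ab b \<xi>))\<^sup>2))) \<partial>lborel)"
        by (intro nn_integral_cong)
          (simp add: sum_nonneg distrib_left sum_distrib_left[symmetric] add.assoc)
      also have "\<dots> = (\<integral>\<^sup>+\<xi>. ?w \<xi> * ennreal ((norm (paraboloid_fourier F \<xi>))\<^sup>2) \<partial>lborel) +
        ((\<integral>\<^sup>+\<xi>. ?w \<xi> * ennreal ((norm (At \<xi>))\<^sup>2) \<partial>lborel) + (\<Sum>b\<in>Basis. \<integral>\<^sup>+\<xi>. ?w \<xi> * ennreal ((norm (Ab b \<xi>))\<^sup>2) \<partial>lborel))"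
        by (subst nn_integral_add, measurable, subst nn_integral_add, measurable, subst nn_integral_sum, measurable)
      also have "\<dots> \<le> ennreal (C0 * N\<^sup>2) + (ennreal (Ct * N\<^sup>2) + (\<Sum>b\<in>(Basis::'a set). ennreal (Cb b * N\<^sup>2)))"
      proof (intro add_mono sum_mono)
        show "(\<integral>\<^sup>+\<xi>. ?w \<xi> * ennreal ((norm (paraboloid_fourier F \<xi>))\<^sup>2) \<partial>lborel) \<le> ennreal (C0 * N\<^sup>2)"
          using c[OF _ _ B finI, of "\<lambda>_. 1"] by (simp add: N_def F_def[abs_def] C0_def I_def E_def)
        show "(\<integral>\<^sup>+\<xi>. ?w \<xi> * ennreal ((norm (At \<xi>))\<^sup>2) \<partial>lborel) \<le> ennreal (Ct * N\<^sup>2)"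
          using c[OF _ _ B finI, of "\<lambda>z. of_real (fst z)"]
          by (simp add: N_def F_def[abs_def] At_def Ct_def I_def E_def mult.assoc continuous_intros)
        show "(\<integral>\<^sup>+\<xi>. ?w \<xi> * ennreal ((norm (Ab b \<xi>))\<^sup>2) \<partial>lborel) \<le> ennreal (Cb b * N\<^sup>2)" for b
          using c[OF _ _ B finI, of "\<lambda>z. of_real (snd z \<bullet> b)"]
          by (simp add: N_def F_def[abs_def] Ab_def Cb_def I_def E_def mult.assoc continuous_intros)
      qed
      also have "\<dots> = ennreal (D * N\<^sup>2)"
        using c0
        by (simp add: D_def C0_def Ct_def Cb_def sum_nonneg distrib_right sum_distrib_right ennreal_plus[symmetric] add.assoc del: ennreal_plus)
      finally show ?thesis .
    qed
    have G_le: "(\<integral>\<^sup>+x. ennreal (((norm x powr \<alpha> + 1) * norm (?G x))\<^sup>2) \<partial>lborel) \<le> ennreal ((K * N)\<^sup>2)"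
    \<comment> \<open>If \<open>h\<close> is not integrable, \<open>?G\<close> is 0 by default and
      the bound is trivial, so the decay of \<open>h\<close> is not investigated.\<close>
    proof (cases "integrable lborel h")
      case True
      have "(\<integral>\<^sup>+x. ennreal (((norm x powr \<alpha> + 1) * norm (?G x))\<^sup>2) \<partial>lborel) \<le> ennreal P *
        (\<integral>\<^sup>+\<xi>. ennreal (bracket_sq \<xi> powr \<alpha> * (norm (h \<xi>))\<^sup>2 + bracket_sq \<xi> powr (\<alpha> - 1) * (\<Sum>b\<in>Basis. (norm (h' b \<xi>))\<^sup>2)) \<partial>lborel)"
        unfolding P_def by (rule weighted_plancherel[OF True h_cont h'_cont h_der alpha])
      also have "\<dots> \<le> ennreal P * (\<integral>\<^sup>+\<xi>. ennreal (17 + 2 * \<gamma>\<^sup>2) * (ennreal (bracket_sq \<xi> powr (\<alpha> + \<gamma>)) * ennreal (?E \<xi>)) \<partial>lborel)"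
      proof (intro mult_left_mono nn_integral_mono)
        fix \<xi> :: 'a
        have "bracket_sq \<xi> powr \<alpha> * (norm (h \<xi>))\<^sup>2 + bracket_sq \<xi> powr (\<alpha> - 1) * (\<Sum>b\<in>Basis. (norm (h' b \<xi>))\<^sup>2) \<le>
            (17 + 2 * \<gamma>\<^sup>2) * (bracket_sq \<xi> powr (\<alpha> + \<gamma>) * ?E \<xi>)"
          unfolding h_def h'_def by (rule gradient_energy_le)
        then have "ennreal (bracket_sq \<xi> powr \<alpha> * (norm (h \<xi>))\<^sup>2 + bracket_sq \<xi> powr (\<alpha> - 1) * (\<Sum>b\<in>Basis. (norm (h' b \<xi>))\<^sup>2)) \<le>
            ennreal ((17 + 2 * \<gamma>\<^sup>2) * (bracket_sq \<xi> powr (\<alpha> + \<gamma>) * ?E \<xi>))"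
          by (rule ennreal_leI)
        also have "\<dots> = ennreal (17 + 2 * \<gamma>\<^sup>2) * (ennreal (bracket_sq \<xi> powr (\<alpha> + \<gamma>)) * ennreal (?E \<xi>))"
          by (subst ennreal_mult, simp, simp add: sum_nonneg, subst ennreal_mult) (auto simp: sum_nonneg simp del: ennreal_plus)
        finally show "ennreal (bracket_sq \<xi> powr \<alpha> * (norm (h \<xi>))\<^sup>2 + bracket_sq \<xi> powr (\<alpha> - 1) * (\<Sum>b\<in>Basis. (norm (h' b \<xi>))\<^sup>2)) \<le>
            ennreal (17 + 2 * \<gamma>\<^sup>2) * (ennreal (bracket_sq \<xi> powr (\<alpha> + \<gamma>)) * ennreal (?E \<xi>))" .
      qed simp
      also have "\<dots> = ennreal P * (ennreal (17 + 2 * \<gamma>\<^sup>2) * (\<integral>\<^sup>+\<xi>. ennreal (bracket_sq \<xi> powr (\<alpha> + \<gamma>)) * ennreal (?E \<xi>) \<partial>lborel))"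
        by (intro arg_cong[where f = "(*) (ennreal P)"] nn_integral_cmult) measurable
      also have "\<dots> \<le> ennreal P * (ennreal (17 + 2 * \<gamma>\<^sup>2) * ennreal (D * N\<^sup>2))"
        by (intro mult_left_mono energy) auto
      also have "\<dots> = ennreal (P * ((17 + 2 * \<gamma>\<^sup>2) * D) * N\<^sup>2)"
        using P0 D0 by (simp add: ennreal_mult[symmetric] mult.assoc del: ennreal_plus)
      also have "\<dots> \<le> ennreal ((K * N)\<^sup>2)"
        unfolding power_mult_distrib by (intro ennreal_leI mult_right_mono K2) simp
      finally show ?thesis .
    next
      case False
      then have "?G x = 0" for x by (rule integral_cis_mult_eq_0)
      then show ?thesis by simp
    qed
    have "(\<integral>\<^sup>+x. ennreal ((norm (of_real (norm x powr \<alpha> + 1) * Lambda \<gamma> (schroedinger_integral F) x))\<^sup>2) \<partial>lborel) \<le>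
        (\<integral>\<^sup>+x. ennreal (((norm x powr \<alpha> + 1) * norm (?G x))\<^sup>2) \<partial>lborel)"
    proof (intro nn_integral_mono ennreal_leI power_mono)
      fix x :: 'a
      have "0 \<le> norm x powr \<alpha> + 1" by simp
      then have "norm (of_real (norm x powr \<alpha> + 1) * Lambda \<gamma> (schroedinger_integral F) x) =
          (norm x powr \<alpha> + 1) * norm (Lambda \<gamma> (schroedinger_integral F) x)"
        by (simp only: norm_mult norm_of_real abs_of_nonneg)
      also have "\<dots> \<le> (norm x powr \<alpha> + 1) * norm (?G x)"
        unfolding h_def by (intro mult_left_mono norm_Lambda_schroedinger_integral_le[OF F Fsupp C]) auto
      finally show "norm (of_real (norm x powr \<alpha> + 1) * Lambda \<gamma> (schroedinger_integral F) x) \<le> (norm x powr \<alpha> + 1) * norm (?G x)" .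
    qed simp
    then have "(\<integral>\<^sup>+x. ennreal ((norm (of_real (norm x powr \<alpha> + 1) * Lambda \<gamma> (schroedinger_integral F) x))\<^sup>2) \<partial>lborel) \<le> ennreal ((K * N)\<^sup>2)"
      using G_le by (rule order_trans)
    moreover have "0 \<le> K * N" using K0 by (simp add: N_def)
    ultimately have "Lp_norm 2 (\<lambda>x. of_real (norm x powr \<alpha> + 1) * Lambda \<gamma> (schroedinger_integral F) x) \<le> ennreal (K * N)"
      by (rule Lp_norm_2_le)
    then show "Lp_norm 2 (\<lambda>x. of_real (norm x powr \<alpha> + 1) * Lambda \<gamma> (schroedinger_integral (\<lambda>z. chi z * \<phi> z)) x)
      \<le> ennreal (K * enn2real (\<integral>\<^sup>+z. ennreal (norm (\<phi> z) powr p) \<partial>lborel) powr (1 / p))"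
      by (simp only: N_def F_def[abs_def])
  qed
qed

theorem lemma2p7:
  fixes chi :: "real \<times> (real ^ 'd) \<Rightarrow> complex"
    and \<alpha> \<beta> r r' :: real
  assumes cutoff: "test_function chi"
    and alpha: "0 < \<alpha>" "\<alpha> \<le> 1 / 4"
    and beta: "0 \<le> \<beta>"
    and r: "2 \<le> r"
    and gt: "2 < r \<Longrightarrow> 2 * \<alpha> + \<beta> < (real CARD('d) + 1) / r - real CARD('d) / 2"
    and eq: "r = 2 \<Longrightarrow> 2 * \<alpha> + \<beta> \<le> 1 / 2"
    and r': "1 / r + 1 / r' = 1"
  shows "\<exists>C\<ge>0. \<forall>\<phi> :: real \<times> (real ^ 'd) \<Rightarrow> complex. schwartz \<phi> \<longrightarrow>
           Lp_norm 2 (\<lambda>x. of_real (norm x powr \<alpha> + 1) *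
               Lambda (\<alpha> + \<beta>) (schroedinger_integral (\<lambda>z. chi z * \<phi> z)) x)
             \<le> ennreal C * Lp_norm r' \<phi>"
proof -
  define d where "d = real CARD('d)"
  have d: "1 \<le> d" by (simp add: d_def Suc_le_eq)
  have rr: "1 / r' = 1 - 1 / r" using r' by linarith
  have r0: "0 < 1 / r" "1 / r \<le> 1 / 2" using r by (auto simp: field_simps)
  have r'1: "0 < 1 / r'" "1 / 2 \<le> 1 / r'" "1 / r' < 1" unfolding rr using r0 by auto
  have r'pos: "0 < r'" using r'1(1) by (simp add: zero_less_divide_iff)
  have p: "1 < r'" "r' \<le> 2"
    using r'1 r'pos by (simp_all add: field_simps)
  \<comment> \<open>With \<gamma> = \<alpha> + \<beta> the order is 2\<alpha> + \<beta>. Since 1 -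
    1/r' = 1/r, the hypothesis for r > 2, doubled, is the negativity of the dyadic exponent.\<close>
  have exponents: "r' = 2 \<and> \<alpha> + (\<alpha> + \<beta>) \<le> 1/2 \<or>
      2 * (\<alpha> + (\<alpha> + \<beta>)) + real DIM(real ^ 'd) - 2 * (real DIM(real ^ 'd) + 1) * (1 - 1 / r') < 0"
  proof (cases "r = 2")
    case True
    then have "1 / r' = 1 / 2" unfolding rr by simp
    then have "r' = 2" using r'pos by (simp add: field_simps)
    then show ?thesis using eq[OF True] by simp
  next
    case False
    then have lt: "2 * \<alpha> + \<beta> < (d + 1) / r - d / 2" using gt r by (simp add: d_def)
    define q where "q = (d + 1) / r"
    have "2 * (\<alpha> + (\<alpha> + \<beta>)) + d - 2 * q < 0" using lt by (simp add: q_def[symmetric])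
    moreover have "2 * (d + 1) * (1 - 1 / r') = 2 * q" unfolding rr q_def by simp
    ultimately show ?thesis by (simp add: d_def)
  qed
  have "0 \<le> \<alpha> + (\<alpha> + \<beta>)" "\<alpha> \<le> 1 / 2" using alpha beta by auto
  from weighted_Lambda_estimate[OF cutoff alpha(1) this(2) p this(1) exponents]
  obtain C where C: "0 < C" and est: "\<And>\<phi> :: real \<times> (real ^ 'd) \<Rightarrow> complex. schwartz \<phi> \<Longrightarrow>
    (\<integral>\<^sup>+z. ennreal (norm (\<phi> z) powr r') \<partial>lborel) \<noteq> \<infinity> \<Longrightarrow>
    Lp_norm 2 (\<lambda>x. of_real (norm x powr \<alpha> + 1) * Lambda (\<alpha> + \<beta>) (schroedinger_integral (\<lambda>z. chi z * \<phi> z)) x)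
      \<le> ennreal (C * enn2real (\<integral>\<^sup>+z. ennreal (norm (\<phi> z) powr r') \<partial>lborel) powr (1 / r'))"
    by blast
  show ?thesis
  proof (intro exI[of _ C] conjI allI impI)
    show "0 \<le> C" using C by simp
    fix \<phi> :: "real \<times> (real ^ 'd) \<Rightarrow> complex"
    assume \<phi>: "schwartz \<phi>"
    define I where "I = (\<integral>\<^sup>+z. ennreal (norm (\<phi> z) powr r') \<partial>lborel)"
    show "Lp_norm 2 (\<lambda>x. of_real (norm x powr \<alpha> + 1) *
        Lambda (\<alpha> + \<beta>) (schroedinger_integral (\<lambda>z. chi z * \<phi> z)) x) \<le> ennreal C * Lp_norm r' \<phi>"
    \<comment> \<open>In the infinite branch of \<open>Lp_norm\<close> the right side is infinite
      because \<open>C\<close> is positive; a factor 0 would make it 0.\<close>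
    proof (cases "I = \<infinity>")
      case True
      then have "ennreal C * Lp_norm r' \<phi> = \<infinity>"
        unfolding Lp_norm_def I_def[symmetric] Let_def using C by (simp add: ennreal_mult_top)
      then show ?thesis by simp
    next
      case False
      have "ennreal C * Lp_norm r' \<phi> = ennreal (C * enn2real I powr (1 / r'))"
        unfolding Lp_norm_def I_def[symmetric] Let_def using False C by (simp add: ennreal_mult)
      then show ?thesis using est[OF \<phi>] False by (simp add: I_def)
    qed
  qed
qed

end
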